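(* In the Bayesian probit linear mixed model described in the context, suppose that for each $j=1,\dots,r$ either ($a_j<0$ and $b_j=0$) or $b_j>0$, and suppose: (A1) $\bm W=(\bm X,\bm Z)$ has full column rank $p+q$; (A2) there exists a vector $\bm e\in\mathbb{R}^n$ with all entries strictly positive such that $\bm e^T\bm W^*=\bm 0$; (A3) $2a_j+q_j>0$ for $j=1,\dots,r$. Then the Markov chain $\{(\bm\eta^{(m)},\bm v^{(m)},\bm\tau^{(m)})\}_{m\ge0}$ of the two-block Gibbs sampler (equivalently its $\bm\eta$-marginal chain) is geometrically ergodic with respect to the (proper) posterior.
   Context: Model: $y_i\in\{0,1\}$, $\bm x_i\in\mathbb{R}^p$, $\bm z_i\in\mathbb{R}^q$ known, $\bm X$ ($n\times p$) has rows $\bm x_i^T$, $\bm Z$ ($n\times q$) has rows $\bm z_i^T$, $\bm W=(\bm X,\bm Z)$ with $i$th row $\bm w_i^T$. $\bm\beta\in\mathbb{R}^p$, $\bm u=(\bm u_1^T,\dots,\bm u_r^T)^T$, $\bm u_j\in\mathbb{R}^{q_j}$, $q_j>0$, $q=\sum q_j$, $\bm\eta=(\bm\beta^T,\bm u^T)^T$. $Y_i\mid\bm\beta,\bm u\overset{ind}{\sim}\mathrm{Bern}(\Phi(\bm x_i^T\bm\beta+\bm z_i^T\bm u))$ with $\Phi$ the standard normal cdf, $\bm u_j\overset{ind}{\sim}N(\bm0,\tau_j^{-1}\bm I_{q_j})$. Priors: $\pi(\bm\beta)\propto1$, $\pi(\tau_j)\propto e^{-b_j\tau_j}\tau_j^{a_j-1}$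 independently on $(0,\infty)$. $c_i=1-2y_i$; $\bm W^*$ has $i$th row $c_i\bm w_i^T$. $\bm D(\bm\tau)=\oplus_{j=1}^r\tau_j\bm I_{q_j}$ and $\bm\Sigma=\bm\Sigma(\bm\tau)=\begin{pmatrix}\bm X^T\bm X&\bm X^T\bm Z\\ \bm Z^T\bm X&\bm Z^T\bm Z+\bm D(\bm\tau)\end{pmatrix}$. Two-block Gibbs sampler: given $\bm\eta^{(m)}=(\bm\beta^{(m)},\bm u^{(m)})$, (1) draw independently $\tau_j^{(m+1)}\sim\mathrm{Gamma}(a_j+q_j/2,\ b_j+\bm u_j^{(m)T}\bm u_j^{(m)}/2)$ (shape, rate), $j=1,\dots,r$, and $v_i^{(m+1)}\sim\mathrm{TN}(\bm w_i^T\bm\eta^{(m)},1,y_i)$, $i=1,\dots,n$, where $\mathrm{TN}(\mu,1,1)$ (resp. $\mathrm{TN}(\mu,1,0)$) is the $N(\mu,1)$ distribution truncated to $(0,\infty)$ (resp. $(-\infty,0]$); (2) draw $\bm\eta^{(m+1)}\sim N_{p+q}(\bm\Sigma^{-1}\bm W^T\bm v^{(m+1)},\bm\Sigma^{-1})$ with $\bm\Sigma$ evaluated at $\bm\tau^{(m+1)}$. (On the null set where some $\bm u_j=\bm 0$ with $b_j=0$, the $\tau$-update may be defined arbitrarily, e.g. as Gamma(1,1).) A Markov chain with transition kernel $K$ and stationary distribution $\Pi$ is geometrically ergodic if there are $t\in(0,1)$ and $J:\text{state space}\to(0,\infty)$ with $\sup_O|K^m(x,O)-\Pi(O)|\le J(x)t^m$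 for all states $x$ and all $m$. *)

theory Defs
  imports "HOL-Probability.Probability"
begin

text \<open>Bayesian probit linear mixed model and its two-block Gibbs sampler.
  Index types: 'p (columns of X), 'q (columns of Z), 'n (observations),
  'r (variance components). The random-effect coordinates are partitioned
  into the r blocks by a group map g :: 'q => 'r (block j = the preimage of j),
  so q_j = card {k. g k = j}. The parameter eta = (beta, u) lives in
  real^('p::finite + 'q::finite), with Inl k the beta-coordinates and Inr k the u-coordinates.\<close>

definition Wmat :: "real^'p::finite^'n \<Rightarrow> real^'q::finite^'n \<Rightarrow> real^('p::finite + 'q::finite)^'n" where
  "Wmat X Z = (\<chi> i c. case c of Inl k \<Rightarrow> X $ i $ k | Inr k \<Rightarrow> Z $ i $ k)"

definition Wstar :: "real^'p::finite^'n \<Rightarrow> real^'q::finite^'n \<Rightarrow> ('n \<Rightarrow> real) \<Rightarrow> real^('p::finite + 'q::finite)^'n" where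
  "Wstar X Z y = (\<chi> i. (1 - 2 * y i) *\<^sub>R (Wmat X Z $ i))"

definition qdim :: "('q::finite \<Rightarrow> 'r::finite) \<Rightarrow> 'r \<Rightarrow> nat" where
  "qdim g j = card {k. g k = j}"

definition usq :: "('q::finite \<Rightarrow> 'r::finite) \<Rightarrow> real^('p::finite + 'q::finite) \<Rightarrow> 'r \<Rightarrow> real" where
  "usq g eta j = (\<Sum>k\<in>{k. g k = j}. (eta $ Inr k)\<^sup>2)"

definition Dmat :: "('q::finite \<Rightarrow> 'r::finite) \<Rightarrow> real^'r \<Rightarrow> real^('p::finite + 'q::finite)^('p::finite + 'q::finite)" where
  "Dmat g tau = (\<chi> c d. if c = d then (case c of Inl _ \<Rightarrow> 0 | Inr k \<Rightarrow> tau $ g k) else 0)"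

definition Sigma_mat :: "real^('p::finite + 'q::finite)^'n \<Rightarrow> ('q::finite \<Rightarrow> 'r::finite) \<Rightarrow> real^'r \<Rightarrow> real^('p::finite + 'q::finite)^('p::finite + 'q::finite)" where
  "Sigma_mat W g tau = transpose W ** W + Dmat g tau"

definition Phi :: "real \<Rightarrow> real" where
  "Phi x = (LBINT t:{..x}. std_normal_density t)"

definition gamma_pdf :: "real \<Rightarrow> real \<Rightarrow> real \<Rightarrow> real" where
  "gamma_pdf sh rt x = (if 0 < x then rt powr sh * x powr (sh - 1) * exp (- rt * x) / Gamma sh else 0)"

definition tn_pdf :: "real \<Rightarrow> real \<Rightarrow> real \<Rightarrow> real" where
  "tn_pdf mu y x =
     (if y = 1 then (if 0 < x then std_normal_density (x - mu) / Phi mu else 0)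
      else (if x \<le> 0 then std_normal_density (x - mu) / (1 - Phi mu) else 0))"

definition mvn_prec_pdf :: "real^'d::finite^'d \<Rightarrow> real^'d \<Rightarrow> real^'d \<Rightarrow> real" where
  "mvn_prec_pdf P m x =
     sqrt (det P / (2 * pi) ^ CARD('d)) * exp (- ((x - m) \<bullet> (P *v (x - m))) / 2)"

text \<open>Step (1): tau-update given eta (independent Gammas; Gamma(1,1) on the null set
  where the rate b_j + u_j^T u_j / 2 is not positive).\<close>
definition tau_dist :: "('q::finite \<Rightarrow> 'r::finite) \<Rightarrow> ('r \<Rightarrow> real) \<Rightarrow> ('r \<Rightarrow> real) \<Rightarrow> real^('p::finite + 'q::finite) \<Rightarrow> (real^'r) measure" where
  "tau_dist g a b eta = density lborel (\<lambda>tau. ennreal (\<Prod>j\<in>UNIV.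
      (let rt = b j + usq g eta j / 2 in
        if 0 < rt then gamma_pdf (a j + real (qdim g j) / 2) rt (tau $ j)
        else gamma_pdf 1 1 (tau $ j))))"

definition v_dist :: "real^('p::finite + 'q::finite)^'n \<Rightarrow> ('n \<Rightarrow> real) \<Rightarrow> real^('p::finite + 'q::finite) \<Rightarrow> (real^'n) measure" where
  "v_dist W y eta = density lborel (\<lambda>v. ennreal (\<Prod>i\<in>UNIV. tn_pdf ((W $ i) \<bullet> eta) (y i) (v $ i)))"

definition eta_dist :: "real^('p::finite + 'q::finite)^'n \<Rightarrow> ('q::finite \<Rightarrow> 'r::finite) \<Rightarrow> real^'r \<Rightarrow> real^'n \<Rightarrow> (real^('p::finite + 'q::finite)) measure" where
  "eta_dist W g tau v = density lborel (\<lambda>x. ennreal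
      (mvn_prec_pdf (Sigma_mat W g tau) (matrix_inv (Sigma_mat W g tau) *v (transpose W *v v)) x))"

definition gibbs_kernel :: "real^'p::finite^'n \<Rightarrow> real^'q::finite^'n \<Rightarrow> ('q::finite \<Rightarrow> 'r::finite) \<Rightarrow> ('n \<Rightarrow> real)
    \<Rightarrow> ('r \<Rightarrow> real) \<Rightarrow> ('r \<Rightarrow> real) \<Rightarrow> real^('p::finite + 'q::finite) \<Rightarrow> (real^('p::finite + 'q::finite)) measure" where
  "gibbs_kernel X Z g y a b eta =
     tau_dist g a b eta \<bind> (\<lambda>tau. v_dist (Wmat X Z) y eta \<bind> (\<lambda>v. eta_dist (Wmat X Z) g tau v))"

primrec kernel_pow :: "('a \<Rightarrow> 'a measure) \<Rightarrow> 'a measure \<Rightarrow> nat \<Rightarrow> 'a \<Rightarrow> 'a measure" where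
  "kernel_pow K M 0 x = return M x"
| "kernel_pow K M (Suc m) x = kernel_pow K M m x \<bind> K"

text \<open>Unnormalised joint posterior density of (eta, tau): probit likelihood,
  flat prior on beta, u_j | tau_j ~ N(0, tau_j^{-1} I), prior e^{-b_j tau_j} tau_j^{a_j - 1} on (0,oo).\<close>
definition joint_post :: "real^'p::finite^'n \<Rightarrow> real^'q::finite^'n \<Rightarrow> ('q::finite \<Rightarrow> 'r::finite) \<Rightarrow> ('n \<Rightarrow> real)
    \<Rightarrow> ('r \<Rightarrow> real) \<Rightarrow> ('r \<Rightarrow> real) \<Rightarrow> real^('p::finite + 'q::finite) \<Rightarrow> real^'r \<Rightarrow> real" where
  "joint_post X Z g y a b eta tau =
     (\<Prod>i\<in>UNIV. if y i = 1 then Phi ((Wmat X Z $ i) \<bullet> eta) else 1 - Phi ((Wmat X Z $ i) \<bullet> eta)) *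
     (\<Prod>j\<in>UNIV. if 0 < tau $ j then
         (tau $ j / (2 * pi)) powr (real (qdim g j) / 2) * exp (- tau $ j * usq g eta j / 2)
         * exp (- b j * tau $ j) * (tau $ j) powr (a j - 1)
       else 0)"

definition post_eta :: "real^'p::finite^'n \<Rightarrow> real^'q::finite^'n \<Rightarrow> ('q::finite \<Rightarrow> 'r::finite) \<Rightarrow> ('n \<Rightarrow> real)
    \<Rightarrow> ('r \<Rightarrow> real) \<Rightarrow> ('r \<Rightarrow> real) \<Rightarrow> real^('p::finite + 'q::finite) \<Rightarrow> ennreal" where
  "post_eta X Z g y a b eta = (\<integral>\<^sup>+ tau. ennreal (joint_post X Z g y a b eta tau) \<partial>lborel)"

definition post_const :: "real^'p::finite^'n \<Rightarrow> real^'q::finite^'n \<Rightarrow> ('q::finite \<Rightarrow> 'r::finite) \<Rightarrow> ('n \<Rightarrow> real)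
    \<Rightarrow> ('r \<Rightarrow> real) \<Rightarrow> ('r \<Rightarrow> real) \<Rightarrow> ennreal" where
  "post_const X Z g y a b = (\<integral>\<^sup>+ eta. post_eta X Z g y a b eta \<partial>lborel)"

definition posterior :: "real^'p::finite^'n \<Rightarrow> real^'q::finite^'n \<Rightarrow> ('q::finite \<Rightarrow> 'r::finite) \<Rightarrow> ('n \<Rightarrow> real)
    \<Rightarrow> ('r \<Rightarrow> real) \<Rightarrow> ('r \<Rightarrow> real) \<Rightarrow> (real^('p::finite + 'q::finite)) measure" where
  "posterior X Z g y a b =
     density lborel (\<lambda>eta. post_eta X Z g y a b eta / post_const X Z g y a b)"

definition geom_ergodic :: "('a \<Rightarrow> 'a measure) \<Rightarrow> 'a measure \<Rightarrow> 'a measure \<Rightarrow> bool" where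
  "geom_ergodic K M PI \<longleftrightarrow>
     (\<exists>t::real. 0 < t \<and> t < 1 \<and> (\<exists>J :: 'a \<Rightarrow> real. (\<forall>x\<in>space M. 0 < J x) \<and>
        (\<forall>x\<in>space M. \<forall>m. \<forall>A\<in>sets M.
            \<bar>measure (kernel_pow K M m x) A - measure PI A\<bar> \<le> J x * t ^ m)))"

end

theory Submission
  imports Defs
begin

text \<open>
  The chain is geometrically ergodic by a weighted Harris theorem: a drift condition for
  \<open>V \<eta> = |W \<eta>|\<^sup>2 + \<Sum> (u\<^sub>j\<^sup>T u\<^sub>j) powr (- c\<^sub>j)\<close>, the sum ranging over the blocks with \<open>b\<^sub>j = 0\<close>, together
  with a minorization on the sublevel sets of \<open>V\<close>.

  For the quadratic term, \<open>|W m| \<le> |v|\<close> for the conditional mean \<open>m\<close> and the second moment of a truncated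
  normal variable is at most \<open>2 + max 0 \<mu>\<^sup>2\<close>, where \<open>\<mu>\<close> is signed so that a positive value agrees with the observed
  label; (A2) forbids all labels from agreeing at once, so the agreeing coordinates carry at most a
  fraction \<open>\<rho> < 1\<close> of \<open>|W \<eta>|\<^sup>2\<close>.  The same balance makes the likelihood decay like a Gaussian, which gives properness.

  For the singular terms, comparing determinants one diagonal entry at a time bounds the negative moment
  of \<open>u\<^sub>j\<^sup>T u\<^sub>j\<close> given \<open>\<tau>\<close>, and averaging over the Gamma update multiplies
  the singular term by \<open>\<Gamma>(q/2 - c) \<Gamma>(\<alpha> + c) / (\<Gamma>(q/2) \<Gamma>(\<alpha>))\<close> with \<open>\<alpha> = a + q/2 < q/2\<close>, which is below 1 by the
  strict convexity of \<open>ln_Gamma\<close>.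
\<close>

section \<open>Geometric ergodicity from drift and minorization\<close>

text \<open>The obstacle is the region near \<open>u_j = 0\<close> in blocks with
  \<open>b_j = 0\<close>. The Gamma rate there is \<open>usq / 2\<close>, which tends to 0, so a
  bound on the quadratic term alone leaves the update densities without a common minorant; the
  singular terms keep the rate away from 0 on sublevel sets. A small block draws a large precision,
  which tends to make the next block small again, so their drift only shows after averaging over
  \<tau>. The condition \<open>a_j < 0\<close> enters twice: in that average, and in the
  integrability of the posterior at \<open>u_j = 0\<close>. Ergodicity is claimed from every
  starting point, so states with rate 0 cannot be discarded; only the statements about the posterior
  may treat them as a null set. Likewise the kernel integrates over all \<tau>, also where the
  precision matrix is not positive definite, and its measurability has to hold there too. The
  contraction is proved for oscillations of bounded functions weighted by \<open>V\<close>; it needs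
  neither a coupling nor a norm on measures.\<close>

lemma kernel_pow_measurable [measurable]:
  assumes [measurable]: "K \<in> M \<rightarrow>\<^sub>M subprob_algebra M"
  shows "kernel_pow K M m \<in> M \<rightarrow>\<^sub>M subprob_algebra M"
proof (induction m)
  case 0
  show ?case by simp
next
  case (Suc m)
  note Suc.IH [measurable]
  have "(\<lambda>x. kernel_pow K M m x \<bind> K) \<in> M \<rightarrow>\<^sub>M subprob_algebra M"
    by (rule measurable_bind2[where N = M]) measurable
  then show ?case by simp
qed

text \<open>\<open>kernel_pow\<close> adds the new step last. Splitting off the first step instead
  turns the oscillation bound for \<open>m\<close> steps into the hypothesis of a one-step
  contraction.\<close>

lemma kernel_pow_Suc_left:
  assumes K [measurable]: "K \<in> M \<rightarrow>\<^sub>M subprob_algebra M" and x: "x \<in> space M"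
  shows "kernel_pow K M (Suc m) x = K x \<bind> kernel_pow K M m"
proof (induction m)
  case 0
  have "kernel_pow K M 0 = return M" by (rule ext) simp
  then show ?case using x by (simp add: bind_return[OF K] bind_return'' sets_kernel[OF K])
next
  case (Suc m)
  have *: "kernel_pow K M (Suc m) = (\<lambda>y. kernel_pow K M m y \<bind> K)"
    by (rule ext) simp
  have "kernel_pow K M (Suc (Suc m)) x = (K x \<bind> kernel_pow K M m) \<bind> K"
    using Suc by simp
  also have "\<dots> = K x \<bind> (\<lambda>y. kernel_pow K M m y \<bind> K)"
    by (rule bind_assoc[where N = M and R = M])
       (use K x kernel_pow_measurable[OF K] in \<open>simp_all add: measurable_cong_sets[OF sets_kernel[OF K x] refl]\<close>)
  finally show ?case unfolding * .
qed

lemma kernel_pow_invariant: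
  assumes K: "K \<in> M \<rightarrow>\<^sub>M subprob_algebra M" and [simp]: "sets P = sets M" and inv: "P \<bind> K = P"
  shows "P \<bind> kernel_pow K M m = P"
proof (induction m)
  case 0
  have "kernel_pow K M 0 = return M" by (rule ext) simp
  then show ?case by (simp add: bind_return'')
next
  case (Suc m)
  have *: "kernel_pow K M (Suc m) = (\<lambda>y. kernel_pow K M m y \<bind> K)"
    by (rule ext) simp
  have "(P \<bind> kernel_pow K M m) \<bind> K = P \<bind> (\<lambda>y. kernel_pow K M m y \<bind> K)"
    by (rule bind_assoc[where N = M and R = M])
       (use K in \<open>simp_all add: kernel_pow_measurable cong: measurable_cong_sets\<close>)
  then show ?case unfolding * using Suc inv by simp
qed

lemma prob_space_kernel_pow:
  assumes K: "K \<in> M \<rightarrow>\<^sub>M subprob_algebra M" and prob: "\<And>x. x \<in> space M \<Longrightarrow> prob_space (K x)"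
    and x: "x \<in> space M"
  shows "prob_space (kernel_pow K M m x)"
proof (induction m)
  case 0
  then show ?case using x by (simp add: prob_space_return)
next
  case (Suc m)
  have s: "sets (kernel_pow K M m x) = sets M"
    using kernel_pow_measurable[OF K] x by (rule sets_kernel)
  have "prob_space (kernel_pow K M m x \<bind> K)"
    by (rule prob_space.prob_space_bind[OF Suc, where S = M])
       (use K prob s sets_eq_imp_space_eq[OF s] in \<open>auto cong: measurable_cong_sets intro!: AE_I2\<close>)
  then show ?case by simp
qed

text \<open>Every \<open>- f y - w y\<close> lies below every \<open>w x - f x\<close>, so any
  number separating the two families works; the infimum of the second is taken. A two-point bound
  thus becomes a bound on one shifted function, which can be integrated.\<close>

lemma weighted_oscillation_center:
  fixes f w :: "'a \<Rightarrow> real"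
  assumes "\<And>x y. x \<in> S \<Longrightarrow> y \<in> S \<Longrightarrow> \<bar>f x - f y\<bar> \<le> w x + w y"
  obtains c where "\<And>x. x \<in> S \<Longrightarrow> \<bar>f x + c\<bar> \<le> w x"
proof (cases "S = {}")
  case True then show ?thesis using that by auto
next
  case False
  then obtain x0 where x0: "x0 \<in> S" by auto
  define c where "c = (INF x\<in>S. w x - f x)"
  have lb: "- f y - w y \<le> w x - f x" if "x \<in> S" "y \<in> S" for x y
    using assms[OF that] by (auto simp: abs_le_iff)
  have "c \<le> w x - f x" if "x \<in> S" for x
    unfolding c_def using lb[OF _ x0] that by (intro cINF_lower) (auto intro!: bdd_belowI2)
  moreover have "- f y - w y \<le> c" if "y \<in> S" for y
    unfolding c_def using lb[OF _ that] False by (intro cINF_greatest) auto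
  ultimately have "\<bar>f x + c\<bar> \<le> w x" if "x \<in> S" for x
    using that by (fastforce simp: abs_le_iff)
  then show ?thesis using that by blast
qed

text \<open>Both \<open>h - f\<close> and \<open>h + f\<close> are nonnegative, and the integral of
  a nonnegative function can only grow from \<open>N\<close> to \<open>M\<close>.\<close>

lemma integral_diff_le_of_submeasure:
  fixes f h :: "'a \<Rightarrow> real"
  assumes le: "\<And>A. A \<in> sets M \<Longrightarrow> emeasure N A \<le> emeasure M A" and s: "sets N = sets M"
    and f: "integrable M f" and h: "integrable M h" and b: "\<And>x. x \<in> space M \<Longrightarrow> \<bar>f x\<bar> \<le> h x"
  shows "\<bar>(\<integral>x. f x \<partial>M) - (\<integral>x. f x \<partial>N)\<bar> \<le> (\<integral>x. h x \<partial>M) - (\<integral>x. h x \<partial>N)"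
    and "integrable N h"
proof -
  have "N \<le> M" using s le by (simp add: le_measure)
  then have mono: "(\<integral>\<^sup>+x. u x \<partial>N) \<le> (\<integral>\<^sup>+x. u x \<partial>M)" for u
    using s by (intro nn_integral_mono_measure) auto
  have int: "integrable N u" if "integrable M u" for u :: "'a \<Rightarrow> real"
    using that mono[of "\<lambda>x. ennreal (norm (u x))"] s
    by (auto simp: integrable_iff_bounded cong: measurable_cong_sets intro: le_less_trans)
  have le: "(\<integral>x. u x \<partial>N) \<le> (\<integral>x. u x \<partial>M)" if "integrable M u" "\<And>x. x \<in> space M \<Longrightarrow> 0 \<le> u x" for u :: "'a \<Rightarrow> real"
  proof -
    have "ennreal (\<integral>x. u x \<partial>N) \<le> ennreal (\<integral>x. u x \<partial>M)"
      using mono[of u] that int[of u] sets_eq_imp_space_eq[OF s]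
      by (subst (1 2) nn_integral_eq_integral[symmetric]) (auto intro!: AE_I2)
    then show ?thesis using that by (subst (asm) ennreal_le_iff) (auto intro!: integral_nonneg_AE AE_I2)
  qed
  show "integrable N h" using int h .
  have "(\<integral>x. h x - f x \<partial>N) \<le> (\<integral>x. h x - f x \<partial>M)" "(\<integral>x. h x + f x \<partial>N) \<le> (\<integral>x. h x + f x \<partial>M)"
    by (rule le; use f h b in \<open>force simp: abs_le_iff\<close>)+
  then show "\<bar>(\<integral>x. f x \<partial>M) - (\<integral>x. f x \<partial>N)\<bar> \<le> (\<integral>x. h x \<partial>M) - (\<integral>x. h x \<partial>N)"
    using f h int by (simp add: abs_le_iff)
qed

lemma harris_contraction:
  fixes V :: "'a \<Rightarrow> real"
  assumes K: "K \<in> M \<rightarrow>\<^sub>M subprob_algebra M" and prob: "\<And>x. x \<in> space M \<Longrightarrow> prob_space (K x)"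
    and V [measurable]: "V \<in> borel_measurable M" and Vpos: "\<And>x. 0 \<le> V x"
    and drift: "\<And>x. x \<in> space M \<Longrightarrow> (\<integral>\<^sup>+y. V y \<partial>K x) \<le> ennreal (\<rho> * V x + L)"
    and \<rho>: "0 \<le> \<rho>" "\<rho> < 1" and L: "0 \<le> L"
    and N: "sets N = sets M" "0 < measure N (space M)"
    and minor: "\<And>x A. x \<in> space M \<Longrightarrow> V x \<le> (4 * L + 2) / (1 - \<rho>) \<Longrightarrow> A \<in> sets M \<Longrightarrow> emeasure N A \<le> emeasure (K x) A"
  shows "\<exists>\<beta> t. 0 < \<beta> \<and> 0 < t \<and> t < 1 \<and> (\<forall>f c. f \<in> borel_measurable M \<longrightarrow> (\<exists>B. \<forall>x\<in>space M. \<bar>f x\<bar> \<le> B) \<longrightarrow>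
     (\<forall>x\<in>space M. \<forall>y\<in>space M. \<bar>f x - f y\<bar> \<le> c * (2 + \<beta> * V x + \<beta> * V y)) \<longrightarrow>
     (\<forall>x\<in>space M. \<forall>y\<in>space M. \<bar>(\<integral>z. f z \<partial>K x) - (\<integral>z. f z \<partial>K y)\<bar> \<le> (t * c) * (2 + \<beta> * V x + \<beta> * V y)))"
proof -
  define \<epsilon> where "\<epsilon> = measure N (space M)"
  \<comment> \<open>This choice gives \<open>2 * \<beta> * L \<le> \<epsilon>\<close>, so that of
    the gain \<open>2 * \<epsilon>\<close> from the common part at least \<epsilon>
    survives.\<close>
  define \<beta> where "\<beta> = \<epsilon> / (2 * (L + 1))"
  \<comment> \<open>The contraction available far out. Beyond the threshold, half of the drift gap
    \<open>1 - \<rho>\<close> pays for \<open>2 * L + 1\<close>, and the other half leaves room for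
    \<open>s\<close>; the extra 1, worth \<beta> after scaling, covers the loss \<open>2 * s\<close>
    on the constant weight 2.\<close>
  define s where "s = min (\<beta> / 2) ((1 - \<rho>) / 2)"
  define t where "t = max (1 - \<epsilon> / 2) (1 - s)"
  have eps: "\<epsilon> > 0" using N by (simp add: \<epsilon>_def)
  have beta: "\<beta> > 0" using eps L by (simp add: \<beta>_def)
  have bL: "2 * \<beta> * L \<le> \<epsilon>"
  proof -
    have "2 * \<beta> * L = \<epsilon> * (L / (L + 1))" using L by (simp add: \<beta>_def field_simps)
    also have "\<dots> \<le> \<epsilon> * 1" using eps L by (intro mult_left_mono) auto
    finally show ?thesis by simp
  qed
  have s: "0 < s" "s \<le> \<beta> / 2" "s \<le> (1 - \<rho>) / 2"
    using beta \<rho> unfolding s_def by (simp_all only: min.cobounded1 min.cobounded2) (simp add: min_def)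
  have t: "0 < t" "t < 1" "\<rho> \<le> t" "1 - \<epsilon> / 2 \<le> t" "1 - s \<le> t"
    using eps s \<rho> by (auto simp: t_def max_def)
  have setsK: "sets (K x) = sets M" if "x \<in> space M" for x using sets_kernel[OF K that] .
  note spK = sets_eq_imp_space_eq[OF setsK]
  have intV: "integrable (K x) V" if x: "x \<in> space M" for x
    using drift[OF x] V setsK[OF x] Vpos
    by (auto simp: integrable_iff_bounded cong: measurable_cong_sets intro: le_less_trans)
  have PV: "(\<integral>z. V z \<partial>K x) \<le> \<rho> * V x + L" if x: "x \<in> space M" for x
    using drift[OF x] intV[OF x] Vpos \<rho> L
    by (subst (asm) nn_integral_eq_integral) (auto simp del: ennreal_plus)
  show ?thesis
  proof (rule exI[of _ \<beta>], rule exI[of _ t], intro conjI allI impI ballI beta t(1,2))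
    fix f :: "'a \<Rightarrow> real" and c :: real and x y
    assume f [measurable]: "f \<in> borel_measurable M" and bd: "\<exists>B. \<forall>x\<in>space M. \<bar>f x\<bar> \<le> B"
      and lip: "\<forall>x\<in>space M. \<forall>y\<in>space M. \<bar>f x - f y\<bar> \<le> c * (2 + \<beta> * V x + \<beta> * V y)"
      and x: "x \<in> space M" and y: "y \<in> space M"
    define h where "h = (\<lambda>z. c * (1 + \<beta> * V z))"
    have "0 \<le> c * (2 + \<beta> * V x + \<beta> * V x)" using lip x by force
    moreover have "2 + \<beta> * V x + \<beta> * V x > 0" using beta Vpos[of x] by (smt (verit) mult_nonneg_nonneg)
    ultimately have c: "0 \<le> c" by (simp add: zero_le_mult_iff)
    obtain d where d: "\<And>z. z \<in> space M \<Longrightarrow> \<bar>f z + d\<bar> \<le> h z"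
      using lip by (rule_tac weighted_oscillation_center[of "space M" f h]) (auto simp: h_def algebra_simps)
    define S where "S = V x + V y"
    have S: "0 \<le> S" using Vpos by (simp add: S_def)
    have intf: "integrable (K z) f" if z: "z \<in> space M" for z
    proof -
      interpret prob_space "K z" by (rule prob[OF z])
      from bd obtain B where "\<forall>x\<in>space M. \<bar>f x\<bar> \<le> B" by auto
      then show ?thesis using setsK[OF z] spK[OF z]
        by (intro integrable_const_bound[where B = B]) (auto cong: measurable_cong_sets intro!: AE_I2)
    qed
    have inth: "integrable (K z) h" if z: "z \<in> space M" for z
    proof -
      interpret prob_space "K z" by (rule prob[OF z])
      show ?thesis unfolding h_def using intV[OF z] by auto
    qed
    have fd: "(\<integral>w. f w + d \<partial>K z) = (\<integral>w. f w \<partial>K z) + d" if z: "z \<in> space M" for z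
    proof -
      interpret prob_space "K z" by (rule prob[OF z])
      show ?thesis using intf[OF z] by (simp add: prob_space)
    qed
    have intfd: "integrable (K z) (\<lambda>w. f w + d)" if z: "z \<in> space M" for z
    proof -
      interpret prob_space "K z" by (rule prob[OF z])
      show ?thesis using intf[OF z] by simp
    qed
    have Ph: "(\<integral>w. h w \<partial>K z) \<le> c * (1 + \<beta> * (\<rho> * V z + L))" if z: "z \<in> space M" for z
    proof -
      interpret prob_space "K z" by (rule prob[OF z])
      have "(\<integral>w. h w \<partial>K z) = c * (1 + \<beta> * (\<integral>w. V w \<partial>K z))"
        unfolding h_def using intV[OF z] by (simp add: prob_space)
      then show ?thesis using PV[OF z] beta c by (auto intro!: mult_left_mono)
    qed
    have eq: "(\<integral>z. f z \<partial>K x) - (\<integral>z. f z \<partial>K y) = (\<integral>z. f z + d \<partial>K x) - (\<integral>z. f z + d \<partial>K y)"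
      using fd[OF x] fd[OF y] by simp
    show "\<bar>(\<integral>z. f z \<partial>K x) - (\<integral>z. f z \<partial>K y)\<bar> \<le> (t * c) * (2 + \<beta> * V x + \<beta> * V y)"
    proof (cases "S \<le> (4 * L + 2) / (1 - \<rho>)")
      case True
      have Vx: "V x \<le> (4 * L + 2) / (1 - \<rho>)" and Vy: "V y \<le> (4 * L + 2) / (1 - \<rho>)"
        using True Vpos[of x] Vpos[of y] unfolding S_def by linarith+
      have near: "\<bar>(\<integral>w. f w + d \<partial>K z) - (\<integral>w. f w + d \<partial>N)\<bar> \<le> c * (1 + \<beta> * (\<rho> * V z + L)) - (\<integral>w. h w \<partial>N)"
        and hN: "integrable N h"
        if z: "z \<in> space M" and Vz: "V z \<le> (4 * L + 2) / (1 - \<rho>)" for z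
      proof -
        note * = integral_diff_le_of_submeasure[of "K z" N "\<lambda>w. f w + d" h]
        show "integrable N h"
          using minor[OF z Vz] setsK[OF z] N(1) intfd[OF z] inth[OF z] d spK[OF z] by (intro *) auto
        have "\<bar>(\<integral>w. f w + d \<partial>K z) - (\<integral>w. f w + d \<partial>N)\<bar> \<le> (\<integral>w. h w \<partial>K z) - (\<integral>w. h w \<partial>N)"
          using minor[OF z Vz] setsK[OF z] N(1) intfd[OF z] inth[OF z] d spK[OF z] by (intro *) auto
        with Ph[OF z] show "\<bar>(\<integral>w. f w + d \<partial>K z) - (\<integral>w. f w + d \<partial>N)\<bar> \<le> c * (1 + \<beta> * (\<rho> * V z + L)) - (\<integral>w. h w \<partial>N)"
          by linarith
      qed
      have spN: "space N = space M" using N(1) by (rule sets_eq_imp_space_eq)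
      have finN: "finite_measure N"
      proof
        have "emeasure N (space M) \<le> emeasure (K x) (space M)" using minor[OF x Vx] by auto
        also have "\<dots> = 1" using prob_space.emeasure_space_1[OF prob[OF x]] spK[OF x] by simp
        finally show "emeasure N (space N) \<noteq> \<infinity>" using spN by (auto simp: top_unique)
      qed
      interpret N: finite_measure N by (rule finN)
      have "c * \<epsilon> = (\<integral>w. c \<partial>N)" by (simp add: \<epsilon>_def spN)
      also have "\<dots> \<le> (\<integral>w. h w \<partial>N)"
        using hN[OF x Vx] c beta Vpos by (intro integral_mono) (auto simp: h_def intro!: mult_le_cancel_left1[THEN iffD2])
      finally have hNge: "c * \<epsilon> \<le> (\<integral>w. h w \<partial>N)" .
      have "\<bar>(\<integral>z. f z \<partial>K x) - (\<integral>z. f z \<partial>K y)\<bar> \<le> c * (1 + \<beta> * (\<rho> * V x + L)) + c * (1 + \<beta> * (\<rho> * V y + L)) - 2 * (c * \<epsilon>)"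
        unfolding eq using near[OF x Vx] near[OF y Vy] hNge by linarith
      also have "\<dots> = c * (2 + 2 * \<beta> * L - 2 * \<epsilon> + \<rho> * (\<beta> * S))"
        by (simp add: S_def algebra_simps)
      also have "\<dots> \<le> c * (t * (2 + \<beta> * S))"
      proof (rule mult_left_mono[OF _ c])
        have "\<rho> * (\<beta> * S) \<le> t * (\<beta> * S)" using t beta S by (intro mult_right_mono) auto
        then show "2 + 2 * \<beta> * L - 2 * \<epsilon> + \<rho> * (\<beta> * S) \<le> t * (2 + \<beta> * S)"
          using bL t by (simp add: algebra_simps)
      qed
      finally show ?thesis by (simp add: S_def algebra_simps)
    next
      case False
      have "\<bar>\<integral>w. f w + d \<partial>K z\<bar> \<le> c * (1 + \<beta> * (\<rho> * V z + L))" if z: "z \<in> space M" for z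
      proof -
        have "\<bar>\<integral>w. f w + d \<partial>K z\<bar> \<le> (\<integral>w. \<bar>f w + d\<bar> \<partial>K z)" by (rule integral_abs_bound)
        also have "\<dots> \<le> (\<integral>w. h w \<partial>K z)"
          using intfd[OF z] inth[OF z] d spK[OF z] by (intro integral_mono) auto
        finally show ?thesis using Ph[OF z] by simp
      qed
      from this[OF x] this[OF y]
      have "\<bar>(\<integral>z. f z \<partial>K x) - (\<integral>z. f z \<partial>K y)\<bar> \<le> c * (1 + \<beta> * (\<rho> * V x + L)) + c * (1 + \<beta> * (\<rho> * V y + L))"
        unfolding eq by linarith
      also have "\<dots> = c * (2 + 2 * \<beta> * L + \<rho> * (\<beta> * S))"
        by (simp add: S_def algebra_simps)
      also have "\<dots> \<le> c * ((1 - s) * (2 + \<beta> * S))"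
      proof (rule mult_left_mono[OF _ c])
        have "(4 * L + 2) \<le> S * (1 - \<rho>)" using False \<rho> by (simp add: field_simps)
        then have "\<beta> * (2 * L + 1) \<le> \<beta> * (S * ((1 - \<rho>) / 2))" using beta by (intro mult_left_mono) auto
        also have "\<dots> \<le> \<beta> * (S * (1 - \<rho> - s))" using beta S s by (intro mult_left_mono) auto
        finally have "\<beta> * (2 * L + 1) \<le> \<beta> * (S * (1 - \<rho> - s))" .
        then show "2 + 2 * \<beta> * L + \<rho> * (\<beta> * S) \<le> (1 - s) * (2 + \<beta> * S)"
          using s by (simp add: algebra_simps)
      qed
      also have "\<dots> \<le> c * (t * (2 + \<beta> * S))"
        using c t beta S by (intro mult_left_mono mult_right_mono) auto
      finally show ?thesis by (simp add: S_def algebra_simps)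
    qed
  qed
qed

text \<open>Truncating \<open>V\<close> and iterating the drift bound: invariance gives
  \<open>\<integral> min V N dP \<le> \<integral> min (\<rho>\<^sup>m V + L / (1 - \<rho>)) N dP\<close>, and \<open>m \<rightarrow> \<infinity>\<close>, \<open>N \<rightarrow> \<infinity>\<close>.\<close>
lemma drift_invariant_integrable:
  fixes V :: "'a \<Rightarrow> real"
  assumes K: "K \<in> M \<rightarrow>\<^sub>M subprob_algebra M" and prob: "\<And>x. x \<in> space M \<Longrightarrow> prob_space (K x)"
    and V [measurable]: "V \<in> borel_measurable M" and Vpos: "\<And>x. 0 \<le> V x"
    and drift: "\<And>x. x \<in> space M \<Longrightarrow> (\<integral>\<^sup>+y. V y \<partial>K x) \<le> ennreal (\<rho> * V x + L)"
    and \<rho>: "0 \<le> \<rho>" "\<rho> < 1" and L: "0 \<le> L"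
    and P: "prob_space P" "sets P = sets M" and inv: "P \<bind> K = P"
  shows "integrable P V"
proof -
  interpret P: prob_space P by fact
  \<comment> \<open>The fixed point of \<open>\<lambda>z. \<rho> * z + L\<close>, so the bound on
    the iterates reproduces itself at every step.\<close>
  define C where "C = L / (1 - \<rho>)"
  have C: "0 \<le> C" "\<rho> * C + L = C" using \<rho> L by (auto simp: C_def field_simps)
  have setsP [measurable_cong]: "sets P = sets M" by fact
  have spP: "space P = space M" using P(2) by (rule sets_eq_imp_space_eq)
  have it: "(\<integral>\<^sup>+y. V y \<partial>kernel_pow K M m x) \<le> ennreal (\<rho> ^ m * V x + C)" if x: "x \<in> space M" for m x
  proof (induction m)
    case 0
    then show ?case using x C by (simp add: nn_integral_return ennreal_leI)
  next
    case (Suc m)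
    interpret Q: prob_space "kernel_pow K M m x" by (rule prob_space_kernel_pow[OF K prob x])
    have sQ [measurable_cong]: "sets (kernel_pow K M m x) = sets M" using kernel_pow_measurable[OF K] x by (rule sets_kernel)
    have "(\<integral>\<^sup>+y. V y \<partial>kernel_pow K M (Suc m) x) = (\<integral>\<^sup>+z. \<integral>\<^sup>+y. V y \<partial>K z \<partial>kernel_pow K M m x)"
      using K sQ by (simp, intro nn_integral_bind[where B = M]) (auto cong: measurable_cong_sets)
    also have "\<dots> \<le> (\<integral>\<^sup>+z. ennreal \<rho> * ennreal (V z) + ennreal L \<partial>kernel_pow K M m x)"
      using drift sets_eq_imp_space_eq[OF sQ] \<rho> L Vpos
      by (intro nn_integral_mono) (simp add: ennreal_mult'[symmetric] ennreal_plus[symmetric] del: ennreal_plus)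
    also have "\<dots> = ennreal \<rho> * (\<integral>\<^sup>+z. V z \<partial>kernel_pow K M m x) + ennreal L"
      by (subst nn_integral_add) (auto simp: nn_integral_cmult Q.emeasure_space_1)
    also have "\<dots> \<le> ennreal \<rho> * ennreal (\<rho> ^ m * V x + C) + ennreal L"
      by (intro add_right_mono mult_left_mono Suc) auto
    also have "\<dots> = ennreal (\<rho> ^ Suc m * V x + (\<rho> * C + L))"
      using \<rho> L C Vpos by (simp add: ennreal_mult'[symmetric] ennreal_plus[symmetric] algebra_simps del: ennreal_plus)
    finally show ?case using C by simp
  qed
  \<comment> \<open>Truncation is needed because invariance applied to \<open>V\<close> itself might
    only compare infinity with infinity; the truncated integrands are dominated by the constant
    \<open>N\<close>.\<close>
  have bound: "(\<integral>\<^sup>+x. ennreal (min (V x) (real N)) \<partial>P) \<le> ennreal C" for N :: nat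
  proof -
    have "(\<integral>\<^sup>+x. ennreal (min (V x) N) \<partial>P) \<le> (\<integral>\<^sup>+x. ennreal (min (\<rho> ^ m * V x + C) N) \<partial>P)" for m
    proof -
      have "(\<integral>\<^sup>+x. ennreal (min (V x) N) \<partial>P) = (\<integral>\<^sup>+x. ennreal (min (V x) N) \<partial>(P \<bind> kernel_pow K M m))"
        by (simp add: kernel_pow_invariant[OF K P(2) inv])
      also have "\<dots> = (\<integral>\<^sup>+z. \<integral>\<^sup>+y. ennreal (min (V y) N) \<partial>kernel_pow K M m z \<partial>P)"
        using kernel_pow_measurable[OF K] by (intro nn_integral_bind[where B = M]) (auto cong: measurable_cong_sets)
      also have "\<dots> \<le> (\<integral>\<^sup>+x. ennreal (min (\<rho> ^ m * V x + C) N) \<partial>P)"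
      proof (rule nn_integral_mono)
        fix x assume "x \<in> space P"
        then have x: "x \<in> space M" using spP by simp
        interpret Q: prob_space "kernel_pow K M m x" by (rule prob_space_kernel_pow[OF K prob x])
        have "(\<integral>\<^sup>+y. ennreal (min (V y) N) \<partial>kernel_pow K M m x) \<le> (\<integral>\<^sup>+y. ennreal (V y) \<partial>kernel_pow K M m x)"
          by (intro nn_integral_mono ennreal_leI) simp
        also note it[OF x]
        finally have 1: "(\<integral>\<^sup>+y. ennreal (min (V y) N) \<partial>kernel_pow K M m x) \<le> ennreal (\<rho> ^ m * V x + C)" .
        have "(\<integral>\<^sup>+y. ennreal (min (V y) N) \<partial>kernel_pow K M m x) \<le> (\<integral>\<^sup>+y. ennreal N \<partial>kernel_pow K M m x)"
          by (intro nn_integral_mono ennreal_leI) simp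
        then have "(\<integral>\<^sup>+y. ennreal (min (V y) N) \<partial>kernel_pow K M m x) \<le> ennreal N"
          by (simp add: Q.emeasure_space_1)
        with 1 show "(\<integral>\<^sup>+y. ennreal (min (V y) N) \<partial>kernel_pow K M m x) \<le> ennreal (min (\<rho> ^ m * V x + C) N)"
          by (auto simp: min_def)
      qed
      finally show ?thesis .
    qed
    moreover have "(\<lambda>m. \<integral>\<^sup>+x. ennreal (min (\<rho> ^ m * V x + C) N) \<partial>P) \<longlonglongrightarrow> (\<integral>\<^sup>+x. ennreal (min C N) \<partial>P)"
    proof (rule nn_integral_dominated_convergence[where w = "\<lambda>_. ennreal N"])
      show "AE x in P. (\<lambda>m. ennreal (min (\<rho> ^ m * V x + C) N)) \<longlonglongrightarrow> ennreal (min C N)"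
      proof (rule AE_I2)
        fix x
        have "(\<lambda>m. \<rho> ^ m * V x + C) \<longlonglongrightarrow> 0 * V x + C"
          using \<rho> by (intro tendsto_intros LIMSEQ_power_zero) auto
        then show "(\<lambda>m. ennreal (min (\<rho> ^ m * V x + C) N)) \<longlonglongrightarrow> ennreal (min C N)"
          by (intro tendsto_ennrealI tendsto_min tendsto_const) simp
      qed
    qed (auto simp: P.emeasure_space_1 intro!: ennreal_leI)
    ultimately have "(\<integral>\<^sup>+x. ennreal (min (V x) N) \<partial>P) \<le> (\<integral>\<^sup>+x. ennreal (min C N) \<partial>P)"
      by (intro LIMSEQ_le_const) auto
    also have "\<dots> \<le> ennreal C" by (auto simp: P.emeasure_space_1 intro!: ennreal_leI)
    finally show ?thesis .
  qed
  have "(\<integral>\<^sup>+x. ennreal (V x) \<partial>P) = (\<integral>\<^sup>+x. (SUP N::nat. ennreal (min (V x) (real N))) \<partial>P)"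
  proof (rule nn_integral_cong)
    fix x
    obtain n :: nat where "V x \<le> real n" using real_arch_simple by blast
    then have "ennreal (V x) \<le> (SUP N::nat. ennreal (min (V x) (real N)))"
      by (intro SUP_upper2[of n]) auto
    moreover have "(SUP N::nat. ennreal (min (V x) (real N))) \<le> ennreal (V x)"
      by (intro SUP_least ennreal_leI) simp
    ultimately show "ennreal (V x) = (SUP N::nat. ennreal (min (V x) (real N)))" by (rule antisym)
  qed
  also have "\<dots> = (SUP N::nat. \<integral>\<^sup>+x. ennreal (min (V x) (real N)) \<partial>P)"
    by (rule nn_integral_monotone_convergence_SUP) (auto simp: incseq_def le_fun_def intro!: ennreal_leI)
  also have "\<dots> \<le> ennreal C" using bound by (intro SUP_least)
  finally show ?thesis using Vpos
    by (auto simp: integrable_iff_bounded intro: le_less_trans)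
qed

text \<open>The contraction is iterated on
  \<open>\<lambda>x. measure (kernel_pow K M m x) A\<close>, starting from an indicator, whose
  oscillation is below the weight with constant 1. Integrating the resulting two-point bound over
  \<open>y\<close> against \<open>P\<close> replaces the second chain by \<open>P\<close> itself;
  this is where integrability of \<open>V\<close> is needed and where \<open>J\<close> comes
  from.\<close>

theorem harris_geom_ergodic:
  fixes V :: "'a \<Rightarrow> real"
  assumes K: "K \<in> M \<rightarrow>\<^sub>M subprob_algebra M" and prob: "\<And>x. x \<in> space M \<Longrightarrow> prob_space (K x)"
    and V [measurable]: "V \<in> borel_measurable M" and Vpos: "\<And>x. 0 \<le> V x"
    and drift: "\<And>x. x \<in> space M \<Longrightarrow> (\<integral>\<^sup>+y. V y \<partial>K x) \<le> ennreal (\<rho> * V x + L)"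
    and \<rho>: "0 \<le> \<rho>" "\<rho> < 1" and L: "0 \<le> L"
    and minor: "\<And>R. \<exists>N. sets N = sets M \<and> 0 < measure N (space M) \<and>
       (\<forall>x\<in>space M. V x \<le> R \<longrightarrow> (\<forall>A\<in>sets M. emeasure N A \<le> emeasure (K x) A))"
    and P: "prob_space P" "sets P = sets M" and inv: "P \<bind> K = P"
  shows "geom_ergodic K M P"
proof -
  interpret P: prob_space P by fact
  have spP: "space P = space M" using P(2) by (rule sets_eq_imp_space_eq)
  have setsP [measurable_cong]: "sets P = sets M" by fact
  note IV = drift_invariant_integrable[OF K prob V Vpos drift \<rho> L P inv]
  from minor[of "(4 * L + 2) / (1 - \<rho>)"] obtain N where N: "sets N = sets M" "0 < measure N (space M)"
    and mn: "\<And>x A. x \<in> space M \<Longrightarrow> V x \<le> (4 * L + 2) / (1 - \<rho>) \<Longrightarrow> A \<in> sets M \<Longrightarrow> emeasure N A \<le> emeasure (K x) A"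
    by auto
  obtain \<beta> t where bt: "0 < \<beta>" "0 < t" "t < 1" and contr: "\<And>f c x y. f \<in> borel_measurable M \<Longrightarrow> (\<exists>B. \<forall>x\<in>space M. \<bar>f x\<bar> \<le> B) \<Longrightarrow>
     (\<forall>x\<in>space M. \<forall>y\<in>space M. \<bar>f x - f y\<bar> \<le> c * (2 + \<beta> * V x + \<beta> * V y)) \<Longrightarrow> x \<in> space M \<Longrightarrow> y \<in> space M \<Longrightarrow>
     \<bar>(\<integral>z. f z \<partial>K x) - (\<integral>z. f z \<partial>K y)\<bar> \<le> (t * c) * (2 + \<beta> * V x + \<beta> * V y)"
    using harris_contraction[OF K prob V Vpos drift \<rho> L N mn] by blast
  have meas_bind: "measure (Q \<bind> kernel_pow K M m) A = (\<integral>y. measure (kernel_pow K M m y) A \<partial>Q)"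
    if Q: "prob_space Q" "sets Q = sets M" and A: "A \<in> sets M" for Q A m
  proof -
    interpret Q: prob_space Q by fact
    show ?thesis
      using kernel_pow_measurable[OF K] Q A
      by (intro Q.measure_bind[where N = M]) (auto cong: measurable_cong_sets)
  qed
  have main: "\<forall>x\<in>space M. \<forall>y\<in>space M. \<bar>measure (kernel_pow K M m x) A - measure (kernel_pow K M m y) A\<bar>
      \<le> t ^ m * (2 + \<beta> * V x + \<beta> * V y)" if A [measurable]: "A \<in> sets M" for A m
  proof (induction m)
    case 0
    have "\<bar>indicat_real A x - indicat_real A y\<bar> \<le> 2" for x y by (auto simp: indicator_def)
    moreover have "2 \<le> 2 + \<beta> * V x + \<beta> * V y" for x y using bt Vpos by (simp add: add_nonneg_nonneg)
    ultimately have "\<bar>indicat_real A x - indicat_real A y\<bar> \<le> 2 + \<beta> * V x + \<beta> * V y" for x y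
      by (rule order_trans)
    then show ?case using A by (auto simp: measure_return)
  next
    case (Suc m)
    let ?f = "\<lambda>x. measure (kernel_pow K M m x) A"
    have fm: "?f \<in> borel_measurable M"
      using kernel_pow_measurable[OF K] A measurable_compose measurable_measure_subprob_algebra by blast
    have fb: "\<exists>B. \<forall>x\<in>space M. \<bar>?f x\<bar> \<le> B"
      using prob_space_kernel_pow[OF K prob] by (intro exI[of _ 1]) (auto intro: prob_space.prob_le_1)
    have eq: "measure (kernel_pow K M (Suc m) x) A = (\<integral>y. ?f y \<partial>K x)" if "x \<in> space M" for x
      unfolding kernel_pow_Suc_left[OF K that] using meas_bind[OF prob[OF that] sets_kernel[OF K that] A] .
    show ?case
    proof (intro ballI)
      fix x y assume xy: "x \<in> space M" "y \<in> space M"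
      show "\<bar>measure (kernel_pow K M (Suc m) x) A - measure (kernel_pow K M (Suc m) y) A\<bar>
          \<le> t ^ Suc m * (2 + \<beta> * V x + \<beta> * V y)"
        unfolding eq[OF xy(1)] eq[OF xy(2)] power_Suc by (rule contr[OF fm fb Suc xy])
    qed
  qed
  define J where "J = (\<lambda>x. 2 + \<beta> * V x + \<beta> * (\<integral>y. V y \<partial>P))"
  have "\<bar>measure (kernel_pow K M m x) A - measure P A\<bar> \<le> J x * t ^ m" if x: "x \<in> space M" and A: "A \<in> sets M" for x A m
  proof -
    let ?f = "\<lambda>x. measure (kernel_pow K M m x) A"
    have fm: "?f \<in> borel_measurable M"
      using kernel_pow_measurable[OF K] A measurable_compose measurable_measure_subprob_algebra by blast
    have fi: "integrable P ?f" using fm prob_space_kernel_pow[OF K prob] spP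
      by (intro P.integrable_const_bound[where B = 1]) (auto intro!: AE_I2 prob_space.prob_le_1)
    have "measure P A = (\<integral>y. ?f y \<partial>P)"
      using meas_bind[OF P A, of m] by (simp add: kernel_pow_invariant[OF K P(2) inv])
    then have "?f x - measure P A = (\<integral>y. ?f x - ?f y \<partial>P)" using fi by (simp add: P.prob_space)
    then have "\<bar>?f x - measure P A\<bar> \<le> (\<integral>y. \<bar>?f x - ?f y\<bar> \<partial>P)" by (simp add: integral_abs_bound)
    also have "\<dots> \<le> (\<integral>y. t ^ m * (2 + \<beta> * V x + \<beta> * V y) \<partial>P)"
      using fi IV main[OF A] x spP by (intro integral_mono) auto
    also have "\<dots> = J x * t ^ m" using IV by (simp add: J_def P.prob_space)
    finally show ?thesis .
  qed
  moreover have "0 < J x" for x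
    using bt Vpos by (auto simp: J_def intro!: add_pos_nonneg mult_nonneg_nonneg integral_nonneg_AE)
  ultimately show ?thesis unfolding geom_ergodic_def using bt by blast
qed

section \<open>Gaussian integrals with a precision matrix\<close>

lemma borel_measurable_vec_nth [measurable (raw)]:
  fixes f :: "'a \<Rightarrow> real^'n::finite"
  assumes "f \<in> borel_measurable M"
  shows "(\<lambda>x. f x $ i) \<in> borel_measurable M"
  using assms by (rule borel_measurable_continuous_on[OF continuous_on_component[OF continuous_on_id], rotated])

lemma continuous_on_matrix_vector_mult' [continuous_intros]:
  fixes f :: "'a::topological_space \<Rightarrow> real^'n::finite"
  assumes "continuous_on S f"
  shows "continuous_on S (\<lambda>x. A *v f x)"
  using assms by (rule bounded_linear.continuous_on[OF matrix_vector_mul_bounded_linear])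

lemma nn_integral_lborel_shift:
  fixes f :: "'a::euclidean_space \<Rightarrow> ennreal"
  assumes [measurable]: "f \<in> borel_measurable borel"
  shows "(\<integral>\<^sup>+x. f (c + x) \<partial>lborel) = (\<integral>\<^sup>+x. f x \<partial>lborel)"
  by (subst (2) lborel_distr_plus[of c, symmetric]) (simp add: nn_integral_distr)

lemma nn_integral_lborel_vec_prod:
  fixes f :: "'n::finite \<Rightarrow> real \<Rightarrow> ennreal"
  assumes [measurable]: "\<And>i. f i \<in> borel_measurable borel"
  shows "(\<integral>\<^sup>+x. (\<Prod>i\<in>UNIV. f i (x $ i)) \<partial>(lborel :: (real^'n) measure)) = (\<Prod>i\<in>UNIV. \<integral>\<^sup>+t. f i t \<partial>lborel)"
proof -
  let ?e = "\<lambda>i::'n. axis i (1::real)"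
  have inj: "inj ?e" by (auto simp: inj_def axis_eq_axis)
  have B: "Basis = range ?e" by (auto simp: Basis_vec_def)
  have e: "inv ?e (?e i) = i" for i using inj by (rule inv_f_f)
  have "(\<integral>\<^sup>+x. (\<Prod>i\<in>UNIV. f i (x $ i)) \<partial>(lborel :: (real^'n) measure))
      = (\<integral>\<^sup>+x. (\<Prod>b\<in>Basis. f (inv ?e b) (x \<bullet> b)) \<partial>(lborel :: (real^'n) measure))"
    unfolding B by (subst prod.reindex[OF inj]) (simp add: e inner_axis)
  also have "\<dots> = (\<Prod>b\<in>(Basis :: (real^'n) set). \<integral>\<^sup>+t. f (inv ?e b) t \<partial>lborel)"
    by (rule nn_integral_lborel_prod) auto
  also have "\<dots> = (\<Prod>i\<in>UNIV. \<integral>\<^sup>+t. f i t \<partial>lborel)"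
    unfolding B by (subst prod.reindex[OF inj]) (simp add: e)
  finally show ?thesis .
qed

text \<open>Integration along the \<open>k\<close>-th coordinate direction, using only translation invariance; the
  unit-mass weight in \<open>x $ k\<close> selects one representative of each line.\<close>
lemma nn_integral_lborel_lines:
  fixes f :: "real^'n::finite \<Rightarrow> ennreal"
  assumes [measurable]: "f \<in> borel_measurable borel"
  shows "(\<integral>\<^sup>+x. f x \<partial>lborel) = (\<integral>\<^sup>+x. indicator {0..1::real} (x $ k) * (\<integral>\<^sup>+t. f (x + t *\<^sub>R axis k 1) \<partial>lborel) \<partial>lborel)"
proof -
  have 1: "(\<integral>\<^sup>+t. indicator {0..1::real} (s - t) \<partial>lborel) = (1::ennreal)" for s :: real
  proof -
    have "(\<integral>\<^sup>+t. indicator {0..1::real} (s - t) \<partial>lborel) = (\<integral>\<^sup>+t. indicator {s - 1..s} t \<partial>lborel)"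
      by (intro nn_integral_cong) (auto simp: indicator_def)
    then show ?thesis by simp
  qed
  have "(\<integral>\<^sup>+x. f x \<partial>lborel) = (\<integral>\<^sup>+x. (\<integral>\<^sup>+t. f x * indicator {0..1} (x $ k - t) \<partial>lborel) \<partial>lborel)"
    by (simp add: nn_integral_cmult 1)
  also have "\<dots> = (\<integral>\<^sup>+t. (\<integral>\<^sup>+x. f x * indicator {0..1} (x $ k - t) \<partial>lborel) \<partial>lborel)"
    by (rule lborel_pair.Fubini') measurable
  also have "\<dots> = (\<integral>\<^sup>+t. (\<integral>\<^sup>+x. f (x + t *\<^sub>R axis k 1) * indicator {0..1} (x $ k) \<partial>lborel) \<partial>lborel)"
  proof (rule nn_integral_cong)
    fix t :: real
    show "(\<integral>\<^sup>+x. f x * indicator {0..1} (x $ k - t) \<partial>lborel) = (\<integral>\<^sup>+x. f (x + t *\<^sub>R axis k 1) * indicator {0..1} (x $ k) \<partial>lborel)"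
      by (subst nn_integral_lborel_shift[of _ "t *\<^sub>R axis k 1", symmetric])
         (auto simp: axis_def add.commute intro!: nn_integral_cong)
  qed
  also have "\<dots> = (\<integral>\<^sup>+x. (\<integral>\<^sup>+t. f (x + t *\<^sub>R axis k 1) * indicator {0..1} (x $ k) \<partial>lborel) \<partial>lborel)"
    by (rule lborel_pair.Fubini') measurable
  also have "\<dots> = (\<integral>\<^sup>+x. indicator {0..1::real} (x $ k) * (\<integral>\<^sup>+t. f (x + t *\<^sub>R axis k 1) \<partial>lborel) \<partial>lborel)"
    by (intro nn_integral_cong, subst nn_integral_multc) (auto simp: mult.commute)
  finally show ?thesis .
qed

text \<open>The condition \<open>r $ k = 0\<close> makes \<open>r \<bullet> x\<close> constant along
  lines in direction \<open>k\<close>, so on each such line the shear is a translation.\<close>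

lemma nn_integral_lborel_shear:
  fixes f :: "real^'n::finite \<Rightarrow> ennreal"
  assumes [measurable]: "f \<in> borel_measurable borel" and r: "r $ k = 0"
  shows "(\<integral>\<^sup>+x. f (x + (r \<bullet> x) *\<^sub>R axis k 1) \<partial>lborel) = (\<integral>\<^sup>+x. f x \<partial>lborel)"
proof -
  have "(\<integral>\<^sup>+x. f (x + (r \<bullet> x) *\<^sub>R axis k 1) \<partial>lborel)
      = (\<integral>\<^sup>+x. indicator {0..1::real} (x $ k) * (\<integral>\<^sup>+t. f (x + t *\<^sub>R axis k 1 + (r \<bullet> (x + t *\<^sub>R axis k 1)) *\<^sub>R axis k 1) \<partial>lborel) \<partial>lborel)"
    by (rule nn_integral_lborel_lines) measurable
  also have "\<dots> = (\<integral>\<^sup>+x. indicator {0..1::real} (x $ k) * (\<integral>\<^sup>+t. f (x + t *\<^sub>R axis k 1) \<partial>lborel) \<partial>lborel)"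
  proof (rule nn_integral_cong, rule arg_cong2[where f = "(*)"], rule refl)
    fix x :: "real^'n"
    have "(\<integral>\<^sup>+t. f (x + t *\<^sub>R axis k 1 + (r \<bullet> (x + t *\<^sub>R axis k 1)) *\<^sub>R axis k 1) \<partial>lborel)
        = (\<integral>\<^sup>+t. f (x + ((r \<bullet> x) + t) *\<^sub>R axis k 1) \<partial>lborel)"
      using r by (simp add: inner_add_right inner_axis algebra_simps)
    also have "\<dots> = (\<integral>\<^sup>+t. f (x + t *\<^sub>R axis k 1) \<partial>lborel)"
      by (rule nn_integral_lborel_shift[where f = "\<lambda>t. f (x + t *\<^sub>R axis k 1)"]) measurable
    finally show "(\<integral>\<^sup>+t. f (x + t *\<^sub>R axis k 1 + (r \<bullet> (x + t *\<^sub>R axis k 1)) *\<^sub>R axis k 1) \<partial>lborel)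
        = (\<integral>\<^sup>+t. f (x + t *\<^sub>R axis k 1) \<partial>lborel)" .
  qed
  also have "\<dots> = (\<integral>\<^sup>+x. f x \<partial>lborel)"
    by (rule nn_integral_lborel_lines[symmetric]) measurable
  finally show ?thesis .
qed

section \<open>Positive definite matrices and the multivariate normal density\<close>

definition pos_def :: "real^'d::finite^'d \<Rightarrow> bool" where
  "pos_def P \<longleftrightarrow> transpose P = P \<and> (\<forall>x. x \<noteq> 0 \<longrightarrow> 0 < x \<bullet> (P *v x))"

lemma pos_def_sym: "pos_def P \<Longrightarrow> x \<bullet> (P *v y) = (P *v x) \<bullet> y"
  unfolding pos_def_def by (metis dot_lmul_matrix transpose_matrix_vector)

lemma pos_def_pos: "pos_def P \<Longrightarrow> x \<noteq> 0 \<Longrightarrow> 0 < x \<bullet> (P *v x)"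
  by (simp add: pos_def_def)

lemma pos_def_nonneg: "pos_def P \<Longrightarrow> 0 \<le> x \<bullet> (P *v x)"
  by (cases "x = 0") (auto simp: pos_def_def less_imp_le)

lemma matrix_vector_axis: "(A *v axis k (1::real)) = column k A"
  by (simp add: matrix_vector_mul_component vec_eq_iff column_def inner_axis)

lemma axis_quadratic: "axis k (1::real) \<bullet> (P *v axis k 1) = P $ k $ k"
  by (simp add: matrix_vector_axis inner_axis' column_def)

lemma pos_def_diag: "pos_def P \<Longrightarrow> 0 < P $ k $ k"
  using pos_def_pos[of P "axis k 1"] axis_quadratic[of k P] by (simp add: axis_eq_0_iff)

lemma gaussian_nn_integral_1:
  fixes p :: real
  assumes p: "0 < p"
  shows "(\<integral>\<^sup>+x. ennreal (exp (- (p * x\<^sup>2) / 2)) \<partial>lborel) = ennreal (sqrt (2 * pi / p))"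
proof -
  define s where "s = 1 / sqrt p"
  have s: "0 < s" "s\<^sup>2 = 1 / p" using p by (auto simp: s_def power_divide)
  interpret prob_space "density lborel (normal_density 0 s)" using s by (intro prob_space_normal_density)
  have 1: "(\<integral>\<^sup>+x. ennreal (normal_density 0 s x) \<partial>lborel) = 1"
    using emeasure_space_1 by (simp add: emeasure_density)
  have "exp (- (p * x\<^sup>2) / 2) = sqrt (2 * pi / p) * normal_density 0 s x" for x
    using p s by (simp add: normal_density_def)
  then have "(\<integral>\<^sup>+x. ennreal (exp (- (p * x\<^sup>2) / 2)) \<partial>lborel) = (\<integral>\<^sup>+x. ennreal (sqrt (2 * pi / p)) * ennreal (normal_density 0 s x) \<partial>lborel)"
    using p by (simp add: ennreal_mult'[symmetric])
  also have "\<dots> = ennreal (sqrt (2 * pi / p))" by (simp add: nn_integral_cmult 1)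
  finally show ?thesis .
qed

lemma quadratic_form_diag:
  fixes P :: "real^'d::finite^'d"
  assumes "\<And>i j. i \<noteq> j \<Longrightarrow> P $ i $ j = 0"
  shows "x \<bullet> (P *v x) = (\<Sum>i\<in>UNIV. P $ i $ i * (x $ i)\<^sup>2)"
proof -
  have "(P *v x) $ i = P $ i $ i * x $ i" for i
  proof -
    have "(P *v x) $ i = (\<Sum>j\<in>UNIV. if j = i then P $ i $ i * x $ i else 0)"
      unfolding matrix_vector_mult_def vec_lambda_beta using assms by (intro sum.cong) auto
    then show ?thesis by simp
  qed
  then show ?thesis by (simp add: inner_vec_def power2_eq_square ac_simps)
qed

text \<open>Each step of the induction clears one more row by a unimodular shear (symmetric Gaussian elimination).\<close>
lemma pos_def_gaussian_integral:
  fixes P :: "real^'d::finite^'d"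
  assumes "pos_def P"
  shows "0 < det P \<and> (\<integral>\<^sup>+x. ennreal (exp (- (x \<bullet> (P *v x)) / 2)) \<partial>lborel) = ennreal (sqrt ((2 * pi) ^ CARD('d) / det P))"
proof -
  let ?claim = "\<lambda>P :: real^'d^'d. 0 < det P \<and> (\<integral>\<^sup>+x. ennreal (exp (- (x \<bullet> (P *v x)) / 2)) \<partial>lborel) = ennreal (sqrt ((2 * pi) ^ CARD('d) / det P))"
  \<comment> \<open>\<open>T\<close> collects the rows that may still have off-diagonal entries. The
    matrix is quantified inside the induction because each elimination step changes it.\<close>
  have "finite T \<Longrightarrow> \<forall>P :: real^'d^'d. pos_def P \<longrightarrow> (\<forall>k c. k \<notin> T \<longrightarrow> c \<noteq> k \<longrightarrow> P $ k $ c = 0) \<longrightarrow> ?claim P" for T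
  proof (induction rule: finite_induct)
    case empty
    show ?case
    proof (intro allI impI)
      fix P :: "real^'d^'d" assume P: "pos_def P" and d: "\<forall>k c. k \<notin> {} \<longrightarrow> c \<noteq> k \<longrightarrow> P $ k $ c = 0"
      have det: "det P = (\<Prod>i\<in>UNIV. P $ i $ i)" using d by (intro det_diagonal) auto
      have pos: "0 < P $ i $ i" for i using pos_def_diag[OF P] .
      have "(\<integral>\<^sup>+x. ennreal (exp (- (x \<bullet> (P *v x)) / 2)) \<partial>lborel)
         = (\<integral>\<^sup>+x. (\<Prod>i\<in>UNIV. ennreal (exp (- (P $ i $ i * (x $ i)\<^sup>2) / 2))) \<partial>(lborel :: (real^'d) measure))"
        using d by (subst quadratic_form_diag) (auto simp: prod_ennreal exp_sum[symmetric] sum_negf sum_divide_distrib)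
      also have "\<dots> = (\<Prod>i\<in>UNIV. \<integral>\<^sup>+t. ennreal (exp (- (P $ i $ i * t\<^sup>2) / 2)) \<partial>lborel)"
        by (rule nn_integral_lborel_vec_prod) measurable
      also have "\<dots> = (\<Prod>i\<in>UNIV. ennreal (sqrt (2 * pi / P $ i $ i)))"
        by (rule prod.cong[OF refl gaussian_nn_integral_1[OF pos]])
      also have "\<dots> = ennreal (sqrt ((2 * pi) ^ CARD('d) / det P))"
        proof -
        have "sqrt (\<Prod>i\<in>A. h i) = (\<Prod>i\<in>A. sqrt (h i))" for h :: "'d \<Rightarrow> real" and A
          by (induction A rule: infinite_finite_induct) (auto simp: real_sqrt_mult)
        from this[of "\<lambda>i. 2 * pi / P $ i $ i" UNIV] show ?thesis
          unfolding det using pos by (simp add: prod_ennreal less_imp_le prod_dividef)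
      qed
      finally show "?claim P" using pos by (simp add: det prod_pos)
    qed
  next
    case (insert k T)
    show ?case
    proof (intro allI impI)
      fix P :: "real^'d^'d"
      assume P: "pos_def P" and d: "\<forall>i c. i \<notin> insert k T \<longrightarrow> c \<noteq> i \<longrightarrow> P $ i $ c = 0"
      define p where "p = P $ k $ k"
      have p: "0 < p" unfolding p_def by (rule pos_def_diag[OF P])
      have sym: "P $ i $ j = P $ j $ i" for i j using P unfolding pos_def_def transpose_def vec_eq_iff by (metis vec_lambda_beta)
      define r :: "real^'d" where "r = (\<chi> c. if c = k then 0 else P $ k $ c / p)"
      define E :: "real^'d^'d" where "E = (\<chi> i c. (if i = c then 1 else 0) + (if i = k then r $ c else 0))"
      \<comment> \<open>The Schur complement of the pivot \<open>p\<close>, padded by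
        \<open>p\<close> itself at position \<open>k\<close>.\<close>
      define Q :: "real^'d^'d" where "Q = (\<chi> c d. if c = k \<or> d = k then (if c = d then p else 0) else P $ c $ d - P $ c $ k * P $ k $ d / p)"
      have Ex: "E *v x = x + (r \<bullet> x) *\<^sub>R axis k 1" for x
        by (simp add: E_def matrix_vector_mult_def vec_eq_iff inner_vec_def axis_def distrib_right sum.distrib if_distrib[of "\<lambda>u. u * _"] cong: if_cong)
      have PQ: "P = transpose E ** (Q ** E)"
      proof -
        have QE: "(Q ** E) $ i $ d = Q $ i $ d + Q $ i $ k * r $ d" for i d
          by (simp add: E_def matrix_matrix_mult_def distrib_left sum.distrib if_distrib[of "\<lambda>u. _ * u"] cong: if_cong)
        have "(transpose E ** (Q ** E)) $ c $ d = (Q ** E) $ c $ d + r $ c * (Q ** E) $ k $ d" for c d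
          by (simp add: E_def matrix_matrix_mult_def transpose_def distrib_right sum.distrib if_distrib[of "\<lambda>u. u * _"] cong: if_cong)
        then have TQ: "(transpose E ** (Q ** E)) $ c $ d = Q $ c $ d + Q $ c $ k * r $ d + r $ c * (Q $ k $ d + Q $ k $ k * r $ d)" for c d
          by (simp only: QE)
        have "P $ c $ d = Q $ c $ d + Q $ c $ k * r $ d + r $ c * (Q $ k $ d + Q $ k $ k * r $ d)" for c d
          using p sym[of c k] by (cases "c = k"; cases "d = k") (auto simp: Q_def r_def p_def[symmetric])
        then show ?thesis by (simp only: vec_eq_iff TQ) simp
      qed
      have detE: "det E = 1"
      proof -
        \<comment> \<open>\<open>transpose E\<close> is the identity with column \<open>k\<close>
          replaced by \<open>axis k 1 + r\<close>; Cramer's lemma reads off its determinant as entry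
          \<open>k\<close> of that vector, which is 1 because \<open>r $ k = 0\<close>.\<close>
        have "transpose E = (\<chi> i j. if j = k then ((mat 1 :: real^'d^'d) *v (axis k 1 + r)) $ i else (mat 1 :: real^'d^'d) $ i $ j)"
          unfolding matrix_vector_mul_lid by (auto simp: E_def transpose_def vec_eq_iff mat_def axis_def)
        then have "det (transpose E) = (axis k 1 + r) $ k * det (mat 1 :: real^'d^'d)"
          by (simp only: cramer_lemma)
        then show ?thesis by (simp add: r_def)
      qed
      have qf: "x \<bullet> (P *v x) = (E *v x) \<bullet> (Q *v (E *v x))" for x
        unfolding PQ matrix_vector_mul_assoc[symmetric] transpose_matrix_vector
        by (metis dot_lmul_matrix inner_commute)
      have inv: "E *v (x - (r \<bullet> x) *\<^sub>R axis k 1) = x" for x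
        unfolding Ex by (simp add: inner_diff_right inner_axis r_def)
      have Q: "pos_def Q"
        unfolding pos_def_def
      proof (intro conjI allI impI)
        show "transpose Q = Q" using sym by (auto simp: Q_def transpose_def vec_eq_iff)
        fix x :: "real^'d" assume x: "x \<noteq> 0"
        let ?y = "x - (r \<bullet> x) *\<^sub>R axis k 1"
        have "?y \<noteq> 0" using inv[of x] x by (metis matrix_vector_mult_0_right)
        then have "0 < ?y \<bullet> (P *v ?y)" by (rule pos_def_pos[OF P])
        then show "0 < x \<bullet> (Q *v x)" unfolding qf inv .
      qed
      have "\<forall>i c. i \<notin> T \<longrightarrow> c \<noteq> i \<longrightarrow> Q $ i $ c = 0"
        using d by (auto simp: Q_def)
      with Q insert.IH have IH: "?claim Q" by blast
      have det: "det P = det Q" unfolding PQ by (simp add: det_mul detE)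
      have "(\<integral>\<^sup>+x. ennreal (exp (- (x \<bullet> (P *v x)) / 2)) \<partial>lborel)
          = (\<integral>\<^sup>+x. ennreal (exp (- ((x + (r \<bullet> x) *\<^sub>R axis k 1) \<bullet> (Q *v (x + (r \<bullet> x) *\<^sub>R axis k 1))) / 2)) \<partial>lborel)"
        unfolding qf Ex ..
      also have "\<dots> = (\<integral>\<^sup>+x. ennreal (exp (- (x \<bullet> (Q *v x)) / 2)) \<partial>lborel)"
        by (rule nn_integral_lborel_shear[where f = "\<lambda>x. ennreal (exp (- (x \<bullet> (Q *v x)) / 2))"])
           (auto simp: r_def intro!: borel_measurable_continuous_onI continuous_intros)
      finally show "?claim P" using IH det by simp
    qed
  qed
  from this[of UNIV] show ?thesis using assms by auto
qed

lemma pos_def_det: "pos_def P \<Longrightarrow> 0 < det P"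
  using pos_def_gaussian_integral by blast

lemma pos_def_matrix_inv:
  assumes "pos_def P"
  shows "P *v (matrix_inv P *v x) = x"
proof -
  have "invertible P" using pos_def_det[OF assms] by (simp add: invertible_det_nz)
  then have "P ** matrix_inv P = mat 1"
    unfolding invertible_def matrix_inv_def by (metis (mono_tags, lifting) someI_ex)
  then show ?thesis by (simp add: matrix_vector_mul_assoc)
qed

lemma mvn_prec_pdf_measurable [measurable]: "mvn_prec_pdf P m \<in> borel_measurable borel"
  unfolding mvn_prec_pdf_def
  by (intro borel_measurable_continuous_onI continuous_intros) auto

lemma mvn_prec_pdf_nonneg: "pos_def P \<Longrightarrow> 0 \<le> mvn_prec_pdf P m x"
  unfolding mvn_prec_pdf_def using pos_def_det[of P] by (auto intro!: mult_nonneg_nonneg)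

lemma nn_integral_mvn_prec_pdf:
  fixes P :: "real^'d::finite^'d"
  assumes P: "pos_def P"
  shows "(\<integral>\<^sup>+x. ennreal (mvn_prec_pdf P m x) \<partial>lborel) = 1"
proof -
  have d: "0 < det P" using pos_def_det[OF P] .
  have "(\<integral>\<^sup>+x. ennreal (mvn_prec_pdf P m x) \<partial>lborel) = (\<integral>\<^sup>+x. ennreal (mvn_prec_pdf P m (m + x)) \<partial>lborel)"
    by (rule nn_integral_lborel_shift[symmetric]) measurable
  also have "\<dots> = (\<integral>\<^sup>+x. ennreal (sqrt (det P / (2 * pi) ^ CARD('d))) * ennreal (exp (- (x \<bullet> (P *v x)) / 2)) \<partial>lborel)"
    using d by (simp add: mvn_prec_pdf_def ennreal_mult')
  also have "\<dots> = ennreal (sqrt (det P / (2 * pi) ^ CARD('d))) * ennreal (sqrt ((2 * pi) ^ CARD('d) / det P))"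
    using pos_def_gaussian_integral[OF P]
    by (subst nn_integral_cmult) (auto intro!: borel_measurable_continuous_onI continuous_intros)
  also have "\<dots> = ennreal (sqrt ((det P / (2 * pi) ^ CARD('d)) * ((2 * pi) ^ CARD('d) / det P)))"
    using d by (simp add: ennreal_mult'[symmetric] real_sqrt_mult[symmetric])
  also have "\<dots> = 1" using d by simp
  finally show ?thesis .
qed

text \<open>The exact value is \<open>CARD('d)\<close>; the bound comes from \<open>y \<le> 4 exp (y / 4)\<close>.\<close>
lemma mvn_prec_pdf_quadratic_moment:
  fixes P :: "real^'d::finite^'d"
  assumes P: "pos_def P"
  shows "(\<integral>\<^sup>+x. ennreal ((x - m) \<bullet> (P *v (x - m))) * ennreal (mvn_prec_pdf P m x) \<partial>lborel) \<le> ennreal (4 * sqrt (2 ^ CARD('d)))"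
proof -
  have d: "0 < det P" using pos_def_det[OF P] .
  \<comment> \<open>Multiplying \<open>exp (- y / 2)\<close> by \<open>exp (y / 4)\<close> leaves
    the exponential of the Gaussian with precision \<open>P / 2\<close>; the change of determinant
    accounts for \<open>sqrt (2 ^ CARD('d))\<close>.\<close>
  have half: "pos_def ((1/2) *\<^sub>R P)"
    using P unfolding pos_def_def
    by (auto simp: transpose_def vec_eq_iff scaleR_matrix_vector_assoc[symmetric])
  have dh: "det ((1/2) *\<^sub>R P) = det P / 2 ^ CARD('d)"
  proof -
    have "(1/2) *\<^sub>R P = (\<chi> i. (1/2) *s (P $ i))" by (simp add: vec_eq_iff)
    then show ?thesis using det_rows_mul[of "\<lambda>_. 1/2" "\<lambda>i. P $ i"] by (simp add: power_one_over)
  qed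
  have eq: "mvn_prec_pdf P m x * (4 * exp (((x - m) \<bullet> (P *v (x - m))) / 4)) = 4 * sqrt (2 ^ CARD('d)) * mvn_prec_pdf ((1/2) *\<^sub>R P) m x" for x
  proof -
    have "sqrt (2 ^ CARD('d)) * sqrt (det P / 2 ^ CARD('d) / (2 * pi) ^ CARD('d)) = sqrt (det P / (2 * pi) ^ CARD('d))"
      by (simp add: real_sqrt_mult[symmetric])
    note c = this
    have e: "exp (- y / 2) * (4 * exp (y / 4)) = 4 * exp (- (1 / 2 * y) / 2)" for y :: real
      by (simp add: mult_exp_exp)
    show ?thesis
      unfolding mvn_prec_pdf_def dh scaleR_matrix_vector_assoc[symmetric] inner_scaleR_right c[symmetric] mult.assoc e
      by (simp only: mult.left_commute)
  qed
  have "(\<integral>\<^sup>+x. ennreal ((x - m) \<bullet> (P *v (x - m))) * ennreal (mvn_prec_pdf P m x) \<partial>lborel)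
     \<le> (\<integral>\<^sup>+x. ennreal (4 * sqrt (2 ^ CARD('d))) * ennreal (mvn_prec_pdf ((1/2) *\<^sub>R P) m x) \<partial>lborel)"
  proof (rule nn_integral_mono)
    fix x :: "real^'d"
    let ?y = "(x - m) \<bullet> (P *v (x - m))"
    have y: "0 \<le> ?y" by (rule pos_def_nonneg[OF P])
    have "?y \<le> 4 * exp (?y / 4)" using exp_ge_add_one_self[of "?y / 4"] by linarith
    then have "?y * mvn_prec_pdf P m x \<le> 4 * sqrt (2 ^ CARD('d)) * mvn_prec_pdf ((1/2) *\<^sub>R P) m x"
      using mult_left_mono[OF _ mvn_prec_pdf_nonneg[OF P]] eq[of x] by (metis mult.commute)
    then show "ennreal ?y * ennreal (mvn_prec_pdf P m x) \<le> ennreal (4 * sqrt (2 ^ CARD('d))) * ennreal (mvn_prec_pdf ((1/2) *\<^sub>R P) m x)"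
      using y mvn_prec_pdf_nonneg[OF P] by (simp add: ennreal_mult'[symmetric] ennreal_leI)
  qed
  also have "\<dots> = ennreal (4 * sqrt (2 ^ CARD('d)))"
    by (simp add: nn_integral_cmult nn_integral_mvn_prec_pdf[OF half])
  finally show ?thesis .
qed

section \<open>Diagonal perturbations of the precision matrix\<close>

definition diag_on :: "'d set \<Rightarrow> real \<Rightarrow> real^'d::finite^'d" where
  "diag_on S s = (\<chi> i j. if i = j \<and> i \<in> S then s else 0)"

lemma quadratic_diag_on: "x \<bullet> (diag_on S s *v x) = s * (\<Sum>k\<in>S. (x $ k)\<^sup>2)"
proof -
  have "x \<bullet> (diag_on S s *v x) = (\<Sum>i\<in>UNIV. (if i \<in> S then s else 0) * (x $ i)\<^sup>2)"
    by (subst quadratic_form_diag) (auto simp: diag_on_def)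
  also have "\<dots> = (\<Sum>i\<in>S. s * (x $ i)\<^sup>2)"
    by (subst sum.inter_restrict[of UNIV _ S, simplified]) (auto intro!: sum.cong)
  finally show ?thesis by (simp add: sum_distrib_left)
qed

lemma pos_def_add_diag_on:
  assumes "pos_def P" "0 \<le> s"
  shows "pos_def (P + diag_on S s)"
  unfolding pos_def_def
proof (intro conjI allI impI)
  show "transpose (P + diag_on S s) = P + diag_on S s"
    using assms(1) by (auto simp: pos_def_def transpose_def vec_eq_iff diag_on_def)
  fix x :: "real^'a" assume "x \<noteq> 0"
  then show "0 < x \<bullet> ((P + diag_on S s) *v x)"
    using pos_def_pos[OF assms(1)] assms(2)
    by (auto simp: matrix_vector_mult_add_rdistrib inner_add_right quadratic_diag_on intro!: add_pos_nonneg mult_nonneg_nonneg sum_nonneg)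
qed

text \<open>Column \<open>k\<close> of the perturbed matrix is \<open>A\<close> applied to
  \<open>axis k 1 + s *\<^sub>R z\<close>, with \<open>z\<close> column \<open>k\<close> of the
  inverse, so the determinant is multiplied by \<open>1 + s * z $ k\<close>. That
  \<open>z $ k\<close> is at least \<open>1 / A $ k $ k\<close> is Cauchy-Schwarz for the form of
  \<open>A\<close>, obtained from its nonnegativity at
  \<open>z - l *\<^sub>R axis k 1\<close>.\<close>

lemma det_add_diag_single:
  fixes A :: "real^'d::finite^'d"
  assumes A: "pos_def A" and s: "0 \<le> s"
  shows "det A * (1 + s / A $ k $ k) \<le> det (A + diag_on {k} s)"
proof -
  define z where "z = matrix_inv A *v axis k 1"
  define l where "l = 1 / A $ k $ k"
  have akk: "0 < A $ k $ k" using pos_def_diag[OF A] .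
  have Az: "A *v z = axis k 1" unfolding z_def by (rule pos_def_matrix_inv[OF A])
  have "0 \<le> (z - l *\<^sub>R axis k 1) \<bullet> (A *v (z - l *\<^sub>R axis k 1))" by (rule pos_def_nonneg[OF A])
  also have "\<dots> = z \<bullet> (A *v z) - 2 * l * (axis k 1 \<bullet> (A *v z)) + l\<^sup>2 * (axis k 1 \<bullet> (A *v axis k 1))"
    using pos_def_sym[OF A, of z "axis k 1"]
    by (simp add: matrix_vector_mult_diff_distrib inner_diff_left inner_diff_right matrix_vector_mult_scaleR power2_eq_square inner_commute algebra_simps)
  also have "\<dots> = z $ k - l"
    unfolding Az axis_quadratic using akk by (simp add: inner_axis inner_axis' l_def power2_eq_square) 
  finally have zk: "1 / A $ k $ k \<le> z $ k" by (simp add: l_def)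
  have "A + diag_on {k} s = (\<chi> i j. if j = k then (A *v (axis k 1 + s *\<^sub>R z)) $ i else A $ i $ j)"
    unfolding matrix_vector_right_distrib matrix_vector_mult_scaleR Az matrix_vector_axis
    by (auto simp: vec_eq_iff diag_on_def column_def axis_def)
  then have "det (A + diag_on {k} s) = (axis k 1 + s *\<^sub>R z) $ k * det A"
    by (simp only: cramer_lemma)
  also have "\<dots> = det A * (1 + s * z $ k)" by simp
  finally show ?thesis
    using mult_left_mono[OF zk s] pos_def_det[OF A] by simp
qed

text \<open>Perturbing one coordinate leaves the other diagonal entries alone, so the single-entry
  bound can be repeated. Only the entries in \<open>S\<close> need to be bounded; in the sampler the
  rest of the diagonal holds the precisions of the other blocks, which must not enter.\<close>

lemma det_add_diag_on:
  fixes A :: "real^'d::finite^'d"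
  assumes A: "pos_def A" and s: "0 \<le> s" and bd: "\<And>k. k \<in> S \<Longrightarrow> A $ k $ k \<le> \<kappa>"
  shows "det A * (1 + s / \<kappa>) ^ card S \<le> det (A + diag_on S s)"
proof -
  have "finite S" by simp
  then show ?thesis using bd
  proof (induction S rule: finite_induct)
    case empty
    then show ?case by (simp add: diag_on_def vec_eq_iff zero_vec_def[symmetric] vec_lambda_unique)
  next
    case (insert k S)
    let ?B = "A + diag_on S s"
    have B: "pos_def ?B" by (rule pos_def_add_diag_on[OF A s])
    have Bk: "?B $ k $ k = A $ k $ k" using insert by (simp add: diag_on_def)
    have k: "0 < A $ k $ k" "A $ k $ k \<le> \<kappa>" using pos_def_diag[OF A] insert by auto
    then have "0 < \<kappa>" by linarith
    then have sk: "0 \<le> 1 + s / \<kappa>" using s by simp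
    have "det A * (1 + s / \<kappa>) ^ card (insert k S) = (det A * (1 + s / \<kappa>) ^ card S) * (1 + s / \<kappa>)"
      using insert by simp
    also have "\<dots> \<le> det ?B * (1 + s / \<kappa>)"
      using insert sk by (intro mult_right_mono) auto
    also have "\<dots> \<le> det ?B * (1 + s / A $ k $ k)"
      using pos_def_det[OF B] k s by (intro mult_left_mono) (auto intro!: divide_left_mono)
    also have "\<dots> \<le> det (?B + diag_on {k} s)"
      using det_add_diag_single[OF B s, of k] Bk by simp
    also have "?B + diag_on {k} s = A + diag_on (insert k S) s"
      using insert by (auto simp: diag_on_def vec_eq_iff)
    finally show ?case .
  qed
qed

text \<open>Completing the square: the remainder is the value of the left-hand side at the new mean.\<close>
lemma mvn_prec_pdf_laplace:
  fixes P :: "real^'d::finite^'d"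
  assumes P: "pos_def P" and t: "0 \<le> t" and bd: "\<And>k. k \<in> S \<Longrightarrow> P $ k $ k \<le> \<kappa>" and \<kappa>: "0 < \<kappa>"
  shows "(\<integral>\<^sup>+x. ennreal (exp (- (t * (\<Sum>k\<in>S. (x $ k)\<^sup>2)))) * ennreal (mvn_prec_pdf P m x) \<partial>lborel)
    \<le> ennreal ((1 + 2 * t / \<kappa>) powr (- real (card S) / 2))"
proof -
  define Q where "Q = P + diag_on S (2 * t)"
  have Q: "pos_def Q" unfolding Q_def using t by (intro pos_def_add_diag_on[OF P]) auto
  define w where "w = matrix_inv Q *v (P *v m)"
  have Qw: "Q *v w = P *v m" unfolding w_def by (rule pos_def_matrix_inv[OF Q])
  let ?l = "\<lambda>x. (x - m) \<bullet> (P *v (x - m)) + 2 * t * (\<Sum>k\<in>S. (x $ k)\<^sup>2)"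
  have l: "?l x = (x - w) \<bullet> (Q *v (x - w)) + (m \<bullet> (P *v m) - w \<bullet> (Q *v w))" for x
  proof -
    have "?l x = x \<bullet> (Q *v x) - 2 * (x \<bullet> (P *v m)) + m \<bullet> (P *v m)"
      using pos_def_sym[OF P, of m x] unfolding Q_def
      by (simp add: matrix_vector_mult_add_rdistrib quadratic_diag_on inner_add_right matrix_vector_mult_diff_distrib inner_diff_left inner_diff_right inner_commute)
    also have "\<dots> = (x - w) \<bullet> (Q *v (x - w)) + (m \<bullet> (P *v m) - w \<bullet> (Q *v w))"
      using pos_def_sym[OF Q, of w x] unfolding Qw[symmetric]
      by (simp add: matrix_vector_mult_diff_distrib inner_diff_left inner_diff_right inner_commute)
    finally show ?thesis .
  qed
  have "0 \<le> ?l w" using pos_def_nonneg[OF P] t by (auto intro!: add_nonneg_nonneg mult_nonneg_nonneg sum_nonneg)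
  then have rem: "0 \<le> m \<bullet> (P *v m) - w \<bullet> (Q *v w)" unfolding l by simp
  have dP: "0 < det P" and dQ: "0 < det Q" using pos_def_det P Q by auto
  have "(\<integral>\<^sup>+x. ennreal (exp (- (t * (\<Sum>k\<in>S. (x $ k)\<^sup>2)))) * ennreal (mvn_prec_pdf P m x) \<partial>lborel)
     \<le> (\<integral>\<^sup>+x. ennreal (sqrt (det P / det Q)) * ennreal (mvn_prec_pdf Q w x) \<partial>lborel)"
  proof (rule nn_integral_mono)
    fix x :: "real^'d"
    have "exp (- (t * (\<Sum>k\<in>S. (x $ k)\<^sup>2))) * mvn_prec_pdf P m x = sqrt (det P / (2 * pi) ^ CARD('d)) * exp (- ?l x / 2)"
      by (simp add: mvn_prec_pdf_def mult_exp_exp field_simps)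
    also have "\<dots> \<le> sqrt (det P / (2 * pi) ^ CARD('d)) * exp (- ((x - w) \<bullet> (Q *v (x - w))) / 2)"
      using dP rem unfolding l by (intro mult_left_mono) auto
    also have "\<dots> = sqrt (det P / det Q) * mvn_prec_pdf Q w x"
      using dP dQ by (simp add: mvn_prec_pdf_def real_sqrt_divide)
    finally show "ennreal (exp (- (t * (\<Sum>k\<in>S. (x $ k)\<^sup>2)))) * ennreal (mvn_prec_pdf P m x)
       \<le> ennreal (sqrt (det P / det Q)) * ennreal (mvn_prec_pdf Q w x)"
      using mvn_prec_pdf_nonneg[OF Q] dP dQ by (simp add: ennreal_mult'[symmetric] ennreal_leI)
  qed
  also have "\<dots> = ennreal (sqrt (det P / det Q))"
    by (simp add: nn_integral_cmult nn_integral_mvn_prec_pdf[OF Q])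
  also have "\<dots> \<le> ennreal ((1 + 2 * t / \<kappa>) powr (- real (card S) / 2))"
  proof (rule ennreal_leI)
    have pos: "0 < 1 + 2 * t / \<kappa>" using t \<kappa> by (auto intro!: add_pos_nonneg)
    have "det P * (1 + 2 * t / \<kappa>) ^ card S \<le> det Q"
      unfolding Q_def using t bd by (intro det_add_diag_on[OF P]) auto
    then have "det P / det Q \<le> 1 / (1 + 2 * t / \<kappa>) ^ card S"
      using dQ pos by (simp add: field_simps)
    then have "sqrt (det P / det Q) \<le> sqrt (1 / (1 + 2 * t / \<kappa>) ^ card S)" by simp
    also have "\<dots> = (1 + 2 * t / \<kappa>) powr (- real (card S) / 2)"
      using pos by (simp add: powr_half_sqrt[symmetric] powr_realpow[symmetric] powr_minus_divide powr_powr powr_divide)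
    finally show "sqrt (det P / det Q) \<le> (1 + 2 * t / \<kappa>) powr (- real (card S) / 2)" .
  qed
  finally show ?thesis .
qed

section \<open>Gamma and truncated normal integrals\<close>

lemma ennreal_eq_divI:
  assumes "ennreal g = ennreal c * I" "0 < c"
  shows "I = ennreal (g / c)"
proof -
  have "I = ennreal (1 / c) * (ennreal c * I)"
    using assms(2) by (simp add: mult.assoc[symmetric] ennreal_mult'[symmetric])
  also have "\<dots> = ennreal (g / c)"
    using assms by (simp add: assms(1)[symmetric] ennreal_mult'[symmetric])
  finally show ?thesis .
qed

lemma nn_integral_gamma_kernel:
  assumes s: "0 < s" and r: "0 < r"
  shows "(\<integral>\<^sup>+x. ennreal (if 0 < x then x powr (s - 1) * exp (- r * x) else 0) \<partial>lborel) = ennreal (Gamma s / r powr s)"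
proof -
  let ?f = "\<lambda>t::real. ennreal (indicator {0..} t * t powr (s - 1) / exp t)"
  have "ennreal (Gamma s) = (\<integral>\<^sup>+t. ?f t \<partial>lborel)" using s by (rule Gamma_conv_nn_integral_real)
  also have "\<dots> = ennreal \<bar>r\<bar> * (\<integral>\<^sup>+t. ?f (0 + r * t) \<partial>lborel)"
    using r by (intro nn_integral_real_affine) auto
  also have "(\<integral>\<^sup>+t. ?f (0 + r * t) \<partial>lborel) = (\<integral>\<^sup>+x. ennreal (r powr (s - 1)) * ennreal (if 0 < x then x powr (s - 1) * exp (- r * x) else 0) \<partial>lborel)"
  proof (rule nn_integral_cong)
    fix x :: real
    consider "x < 0" | "x = 0" | "0 < x" by linarith
    then show "?f (0 + r * x) = ennreal (r powr (s - 1)) * ennreal (if 0 < x then x powr (s - 1) * exp (- r * x) else 0)"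
      using r by cases (auto simp: indicator_def ennreal_mult'[symmetric] powr_mult exp_minus divide_inverse mult_nonneg_nonneg mult_less_0_iff zero_le_mult_iff)
  qed
  also have "\<dots> = ennreal (r powr (s - 1)) * (\<integral>\<^sup>+x. ennreal (if 0 < x then x powr (s - 1) * exp (- r * x) else 0) \<partial>lborel)"
    by (rule nn_integral_cmult) measurable
  also have "ennreal \<bar>r\<bar> * \<dots> = ennreal (r * r powr (s - 1)) * (\<integral>\<^sup>+x. ennreal (if 0 < x then x powr (s - 1) * exp (- r * x) else 0) \<partial>lborel)"
    using r by (simp add: ennreal_mult' mult.assoc)
  also have "r * r powr (s - 1) = r powr s" using r by (simp add: powr_mult_base)
  finally show ?thesis using r by (intro ennreal_eq_divI) auto
qed

lemma gamma_pdf_nonneg: "0 < s \<Longrightarrow> 0 \<le> gamma_pdf s r x"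
  by (auto simp: gamma_pdf_def intro!: divide_nonneg_nonneg less_imp_le[OF Gamma_real_pos])

lemma gamma_pdf_measurable [measurable (raw)]:
  assumes [measurable]: "f \<in> borel_measurable M" "h \<in> borel_measurable M"
  shows "(\<lambda>x. gamma_pdf s (f x) (h x)) \<in> borel_measurable M"
  unfolding gamma_pdf_def by measurable

lemma gamma_pdf_moment:
  assumes s: "0 < s" and r: "0 < r" and c: "0 < s + c"
  shows "(\<integral>\<^sup>+x. ennreal (x powr c) * ennreal (gamma_pdf s r x) \<partial>lborel) = ennreal (Gamma (s + c) / Gamma s * r powr (- c))"
proof -
  have "(\<integral>\<^sup>+x. ennreal (x powr c) * ennreal (gamma_pdf s r x) \<partial>lborel)
     = (\<integral>\<^sup>+x. ennreal (r powr s / Gamma s) * ennreal (if 0 < x then x powr (s + c - 1) * exp (- r * x) else 0) \<partial>lborel)"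
  proof (rule nn_integral_cong)
    fix x :: real
    have "x powr c * x powr (s - 1) = x powr (s + c - 1)" if "0 < x" using that by (simp add: powr_add[symmetric] algebra_simps)
    then show "ennreal (x powr c) * ennreal (gamma_pdf s r x) = ennreal (r powr s / Gamma s) * ennreal (if 0 < x then x powr (s + c - 1) * exp (- r * x) else 0)"
      using Gamma_real_pos[OF s] by (auto simp: gamma_pdf_def ennreal_mult'[symmetric] algebra_simps)
  qed
  also have "\<dots> = ennreal (r powr s / Gamma s) * ennreal (Gamma (s + c) / r powr (s + c))"
    using nn_integral_gamma_kernel[OF c r] by (subst nn_integral_cmult) auto
  also have "\<dots> = ennreal (Gamma (s + c) / Gamma s * r powr (- c))"
    using r Gamma_real_pos[OF s] Gamma_real_pos[OF c]
    by (simp add: ennreal_mult'[symmetric] powr_add powr_minus field_simps)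
  finally show ?thesis .
qed

lemma nn_integral_gamma_pdf:
  assumes s: "0 < s" and r: "0 < r"
  shows "(\<integral>\<^sup>+x. ennreal (gamma_pdf s r x) \<partial>lborel) = 1"
proof -
  have "(\<integral>\<^sup>+x. ennreal (gamma_pdf s r x) \<partial>lborel) = (\<integral>\<^sup>+x. ennreal (x powr 0) * ennreal (gamma_pdf s r x) \<partial>lborel)"
    by (intro nn_integral_cong) (auto simp: gamma_pdf_def)
  also have "\<dots> = 1" using gamma_pdf_moment[of s r 0] s r Gamma_real_pos[OF s] by simp
  finally show ?thesis .
qed

text \<open>A beta integral of the second kind. Writing the power of
  \<open>1 + 2 * t / \<kappa>\<close> as a Gamma integral over \<open>w\<close> and exchanging the
  order leaves one Gamma integral in \<open>t\<close> and then one in \<open>w\<close>.\<close>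

lemma nn_integral_inverse_beta_kernel:
  assumes c: "0 < c" "c < \<beta>" and k: "0 < \<kappa>"
  shows "(\<integral>\<^sup>+t. ennreal (if 0 < t then t powr (c - 1) * (1 + 2 * t / \<kappa>) powr (- \<beta>) else 0) \<partial>lborel)
    = ennreal ((\<kappa> / 2) powr c * Gamma c * Gamma (\<beta> - c) / Gamma \<beta>)"
proof -
  have gb: "0 < Gamma \<beta>" "0 < Gamma c" "0 < Gamma (\<beta> - c)" using c by (auto intro!: Gamma_real_pos)
  let ?G = "\<lambda>t w::real. if 0 < t \<and> 0 < w then t powr (c - 1) * (w powr (\<beta> - 1) * exp (- (1 + 2 * t / \<kappa>) * w)) else 0"
  have "ennreal (Gamma \<beta>) * (\<integral>\<^sup>+t. ennreal (if 0 < t then t powr (c - 1) * (1 + 2 * t / \<kappa>) powr (- \<beta>) else 0) \<partial>lborel)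
     = (\<integral>\<^sup>+t. (\<integral>\<^sup>+w. ennreal (?G t w) \<partial>lborel) \<partial>lborel)"
  proof (subst nn_integral_cmult[symmetric], measurable, rule nn_integral_cong)
    fix t :: real
    show "ennreal (Gamma \<beta>) * ennreal (if 0 < t then t powr (c - 1) * (1 + 2 * t / \<kappa>) powr (- \<beta>) else 0) = (\<integral>\<^sup>+w. ennreal (?G t w) \<partial>lborel)"
    proof (cases "0 < t")
      case True
      then have p: "0 < 1 + 2 * t / \<kappa>" using k by (simp add: add_pos_pos)
      have "(\<integral>\<^sup>+w. ennreal (?G t w) \<partial>lborel) = (\<integral>\<^sup>+w. ennreal (t powr (c - 1)) * ennreal (if 0 < w then w powr (\<beta> - 1) * exp (- (1 + 2 * t / \<kappa>) * w) else 0) \<partial>lborel)"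
        using True by (intro nn_integral_cong) (auto simp: ennreal_mult'[symmetric])
      also have "\<dots> = ennreal (t powr (c - 1)) * ennreal (Gamma \<beta> / (1 + 2 * t / \<kappa>) powr \<beta>)"
        using nn_integral_gamma_kernel[of \<beta> "1 + 2 * t / \<kappa>"] c p by (subst nn_integral_cmult) auto
      finally show ?thesis using True gb
        by (simp add: ennreal_mult'[symmetric] powr_minus divide_inverse mult_ac)
    qed simp
  qed
  also have "\<dots> = (\<integral>\<^sup>+w. (\<integral>\<^sup>+t. ennreal (?G t w) \<partial>lborel) \<partial>lborel)"
    by (rule lborel_pair.Fubini') measurable
  also have "\<dots> = (\<integral>\<^sup>+w. ennreal (Gamma c * (\<kappa> / 2) powr c) * ennreal (if 0 < w then w powr (\<beta> - c - 1) * exp (- 1 * w) else 0) \<partial>lborel)"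
  proof (rule nn_integral_cong)
    fix w :: real
    show "(\<integral>\<^sup>+t. ennreal (?G t w) \<partial>lborel) = ennreal (Gamma c * (\<kappa> / 2) powr c) * ennreal (if 0 < w then w powr (\<beta> - c - 1) * exp (- 1 * w) else 0)"
    proof (cases "0 < w")
      case True
      have "(\<integral>\<^sup>+t. ennreal (?G t w) \<partial>lborel) = (\<integral>\<^sup>+t. ennreal (w powr (\<beta> - 1) * exp (- w)) * ennreal (if 0 < t then t powr (c - 1) * exp (- (2 * w / \<kappa>) * t) else 0) \<partial>lborel)"
        using True by (intro nn_integral_cong) (auto simp: ennreal_mult'[symmetric] mult_exp_exp algebra_simps intro!: arg_cong[where f = ennreal])
      also have "\<dots> = ennreal (w powr (\<beta> - 1) * exp (- w)) * ennreal (Gamma c / (2 * w / \<kappa>) powr c)"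
        using nn_integral_gamma_kernel[of c "2 * w / \<kappa>"] c True k by (subst nn_integral_cmult) auto
      also have "\<dots> = ennreal (Gamma c * (\<kappa> / 2) powr c * (w powr (\<beta> - c - 1) * exp (- w)))"
      proof -
        have "w powr (\<beta> - 1) / (2 * w / \<kappa>) powr c = (\<kappa> / 2) powr c * w powr (\<beta> - c - 1)"
          using True k by (simp add: powr_divide powr_mult powr_diff mult_ac)
        then have "w powr (\<beta> - 1) * exp (- w) * (Gamma c / (2 * w / \<kappa>) powr c) = Gamma c * ((\<kappa> / 2) powr c * w powr (\<beta> - c - 1)) * exp (- w)"
          by (simp only: divide_inverse mult_ac)
        then show ?thesis by (simp add: ennreal_mult'[symmetric] mult.assoc)
      qed
      finally show ?thesis using True gb by (simp add: ennreal_mult'[symmetric])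
    qed simp
  qed
  also have "\<dots> = ennreal (Gamma c * (\<kappa> / 2) powr c) * ennreal (Gamma (\<beta> - c) / 1 powr (\<beta> - c))"
    using nn_integral_gamma_kernel[of "\<beta> - c" 1] c by (subst nn_integral_cmult) auto
  also have "\<dots> = ennreal (Gamma c * (\<kappa> / 2) powr c * Gamma (\<beta> - c))"
    using gb by (simp add: ennreal_mult'[symmetric])
  finally have "ennreal (Gamma c * (\<kappa> / 2) powr c * Gamma (\<beta> - c)) = ennreal (Gamma \<beta>) * (\<integral>\<^sup>+t. ennreal (if 0 < t then t powr (c - 1) * (1 + 2 * t / \<kappa>) powr (- \<beta>) else 0) \<partial>lborel)" ..
  from ennreal_eq_divI[OF this gb(1)] show ?thesis by (simp add: mult_ac)
qed

text \<open>The increments of \<open>ln_Gamma\<close> over \<open>[\<alpha>, \<alpha> + c]\<close>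
  and \<open>[\<beta> - c, \<beta>]\<close> are \<open>c\<close> times values of
  \<open>Digamma\<close> inside these intervals. The third hypothesis puts the first interval to the
  left of the second, and \<open>Digamma\<close> is strictly increasing.\<close>

lemma Gamma_product_strict:
  fixes \<alpha> \<beta> c :: real
  assumes "0 < \<alpha>" "0 < c" "\<alpha> + c \<le> \<beta> - c"
  shows "Gamma (\<beta> - c) * Gamma (\<alpha> + c) < Gamma \<beta> * Gamma \<alpha>"
proof -
  have mvt: "\<exists>z. x < z \<and> z < y \<and> ln_Gamma y - ln_Gamma x = (y - x) * Digamma z" if "0 < x" "x < y" for x y :: real
    using that by (intro MVT2) (auto intro!: derivative_eq_intros)
  obtain z1 where z1: "\<beta> - c < z1" "z1 < \<beta>" "ln_Gamma \<beta> - ln_Gamma (\<beta> - c) = (\<beta> - (\<beta> - c)) * Digamma z1"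
    using mvt[of "\<beta> - c" \<beta>] assms by auto
  obtain z2 where z2: "\<alpha> < z2" "z2 < \<alpha> + c" "ln_Gamma (\<alpha> + c) - ln_Gamma \<alpha> = (\<alpha> + c - \<alpha>) * Digamma z2"
    using mvt[of \<alpha> "\<alpha> + c"] assms by auto
  have "Digamma z2 < Digamma z1"
    using z1 z2 assms by (intro Digamma_real_strict_mono) auto
  then have "c * Digamma z2 < c * Digamma z1" using assms by simp
  with z1(3) z2(3) have "ln_Gamma (\<beta> - c) + ln_Gamma (\<alpha> + c) < ln_Gamma \<beta> + ln_Gamma \<alpha>" by simp
  then have "exp (ln_Gamma (\<beta> - c) + ln_Gamma (\<alpha> + c)) < exp (ln_Gamma \<beta> + ln_Gamma \<alpha>)" by simp
  then show ?thesis using assms by (simp add: exp_add Gamma_real_pos_exp)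
qed

section \<open>Normal tails and truncated normal moments\<close>

lemma nn_integral_std_normal: "(\<integral>\<^sup>+x. ennreal (std_normal_density x) \<partial>lborel) = 1"
proof -
  interpret prob_space "density lborel std_normal_density" by (intro prob_space_normal_density) simp
  show ?thesis using emeasure_space_1 by (simp add: emeasure_density)
qed

lemma Phi_nn_integral: "ennreal (Phi x) = (\<integral>\<^sup>+t. indicator {..x} t * ennreal (std_normal_density t) \<partial>lborel)"
proof -
  have "integrable lborel (\<lambda>t. indicator {..x} t *\<^sub>R std_normal_density t)"
    by (intro integrable_mult_indicator) auto
  then have "(\<integral>\<^sup>+t. ennreal (indicator {..x} t *\<^sub>R std_normal_density t) \<partial>lborel) = ennreal (Phi x)"
    unfolding Phi_def set_lebesgue_integral_def by (rule nn_integral_eq_integral) (auto simp: normal_density_nonneg)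
  then show ?thesis
    by (subst (asm) nn_integral_cong[where v = "\<lambda>t. indicator {..x} t * ennreal (std_normal_density t)"])
       (auto simp: indicator_def)
qed

lemma Phi_nonneg: "0 \<le> Phi x"
  unfolding Phi_def set_lebesgue_integral_def by (intro integral_nonneg_AE) (auto simp: normal_density_nonneg)

lemma std_normal_shift_pos:
  "(\<integral>\<^sup>+v. ennreal (if 0 < v then std_normal_density (v - \<mu>) else 0) \<partial>lborel) = ennreal (Phi \<mu>)"
proof -
  have "(\<integral>\<^sup>+v. ennreal (if 0 < v then std_normal_density (v - \<mu>) else 0) \<partial>lborel) = (\<integral>\<^sup>+t. indicator {..<\<mu>} t * ennreal (std_normal_density t) \<partial>lborel)"
    by (subst nn_integral_real_affine[where c = "-1" and t = \<mu>])
       (auto simp: std_normal_density_def indicator_def intro!: nn_integral_cong)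
  also have "\<dots> = (\<integral>\<^sup>+t. indicator {..\<mu>} t * ennreal (std_normal_density t) \<partial>lborel)"
    by (intro nn_integral_cong_AE eventually_mono[OF AE_lborel_singleton[of \<mu>]]) (auto simp: indicator_def)
  finally show ?thesis by (simp add: Phi_nn_integral)
qed

lemma std_normal_shift_neg:
  "(\<integral>\<^sup>+v. ennreal (if v \<le> 0 then std_normal_density (v - \<mu>) else 0) \<partial>lborel) = ennreal (Phi (- \<mu>))"
proof -
  have "(\<integral>\<^sup>+v. ennreal (if v \<le> 0 then std_normal_density (v - \<mu>) else 0) \<partial>lborel) = (\<integral>\<^sup>+t. indicator {..- \<mu>} t * ennreal (std_normal_density t) \<partial>lborel)"
    by (subst nn_integral_real_affine[where c = "1" and t = \<mu>])
       (auto simp: std_normal_density_def indicator_def intro!: nn_integral_cong)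
  then show ?thesis by (simp add: Phi_nn_integral)
qed

lemma Phi_minus: "1 - Phi \<mu> = Phi (- \<mu>)"
proof -
  have "(\<integral>\<^sup>+v. ennreal (if 0 < v then std_normal_density (v - \<mu>) else 0) \<partial>lborel)
      + (\<integral>\<^sup>+v. ennreal (if v \<le> 0 then std_normal_density (v - \<mu>) else 0) \<partial>lborel)
      = (\<integral>\<^sup>+v. ennreal (std_normal_density (v - \<mu>)) \<partial>lborel)"
    by (subst nn_integral_add[symmetric]) (auto intro!: nn_integral_cong)
  also have "\<dots> = 1"
    using nn_integral_lborel_shift[of "\<lambda>v. ennreal (std_normal_density v)" "- \<mu>"] nn_integral_std_normal by simp
  finally have "ennreal (Phi \<mu>) + ennreal (Phi (- \<mu>)) = 1"
    by (simp only: std_normal_shift_pos std_normal_shift_neg)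
  then have "ennreal (Phi \<mu> + Phi (- \<mu>)) = ennreal 1" using Phi_nonneg by simp
  then show ?thesis using Phi_nonneg by (subst (asm) ennreal_inj) (auto simp: add_nonneg_nonneg)
qed

lemma Phi_pos: "0 < Phi x"
proof (rule ccontr)
  assume "\<not> 0 < Phi x"
  then have "Phi x = 0" using Phi_nonneg[of x] by simp
  then have "(\<integral>\<^sup>+t. indicator {..x} t * ennreal (std_normal_density t) \<partial>lborel) = 0"
    using Phi_nn_integral[of x] by simp
  then have "AE t in lborel. indicator {..x} t * ennreal (std_normal_density t) = 0"
    by (subst (asm) nn_integral_0_iff_AE) auto
  then have "AE t in lborel. t \<notin> {x - 1..x}"
    using normal_density_pos[of 1 0, THEN not_le[THEN iffD2]]
    by (elim eventually_mono) (auto simp: indicator_def ennreal_eq_0_iff split: if_splits)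
  then have "{x - 1..x} \<in> null_sets lborel" by (subst AE_iff_null_sets) auto
  then show False by (simp add: null_sets_def)
qed

lemma Phi_le_1: "Phi x \<le> 1" and Phi_lt_1: "Phi x < 1"
  using Phi_minus[of x] Phi_pos[of "- x"] by auto

lemma Phi_mono: "mono Phi"
proof (rule monoI)
  fix x y :: real assume "x \<le> y"
  then have "ennreal (Phi x) \<le> ennreal (Phi y)"
    unfolding Phi_nn_integral by (intro nn_integral_mono) (auto simp: indicator_def)
  then show "Phi x \<le> Phi y" using Phi_nonneg by (simp add: ennreal_le_iff)
qed

lemma Phi_measurable [measurable]: "Phi \<in> borel_measurable borel"
  using Phi_mono by (rule borel_measurable_mono)

text \<open>For \<open>v \<le> 0 \<le> x\<close> the cross term has the right sign, so
  \<open>(v - x)\<^sup>2 \<ge> v\<^sup>2 + x\<^sup>2\<close> and the density factors out a full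
  standard normal.\<close>

lemma Phi_tail:
  assumes x: "0 \<le> x"
  shows "Phi (- x) \<le> exp (- x\<^sup>2 / 2)"
proof -
  have "ennreal (Phi (- x)) = (\<integral>\<^sup>+v. ennreal (if v \<le> 0 then std_normal_density (v - x) else 0) \<partial>lborel)"
    using std_normal_shift_neg[of x] by simp
  also have "\<dots> \<le> (\<integral>\<^sup>+v. ennreal (exp (- x\<^sup>2 / 2)) * ennreal (std_normal_density v) \<partial>lborel)"
  proof (rule nn_integral_mono)
    fix v :: real
    have "std_normal_density (v - x) \<le> exp (- x\<^sup>2 / 2) * std_normal_density v" if "v \<le> 0"
    proof -
      have "v * x \<le> 0" using that x by (simp add: mult_nonpos_nonneg)
      then have "- ((v - x)\<^sup>2) / 2 \<le> - x\<^sup>2 / 2 + - v\<^sup>2 / 2" by (simp add: power2_eq_square field_simps)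
      then have "exp (- ((v - x)\<^sup>2) / 2) \<le> exp (- x\<^sup>2 / 2) * exp (- v\<^sup>2 / 2)" by (simp add: exp_add[symmetric])
      then show ?thesis by (simp add: std_normal_density_def divide_simps)
    qed
    then show "ennreal (if v \<le> 0 then std_normal_density (v - x) else 0) \<le> ennreal (exp (- x\<^sup>2 / 2)) * ennreal (std_normal_density v)"
      by (auto simp: ennreal_mult'[symmetric] intro!: ennreal_leI)
  qed
  also have "\<dots> = ennreal (exp (- x\<^sup>2 / 2))" by (simp add: nn_integral_cmult nn_integral_std_normal)
  finally show ?thesis by (simp add: ennreal_le_iff)
qed

lemma tn_pdf_nonneg: "0 \<le> tn_pdf \<mu> y x"
  using Phi_pos[of \<mu>] Phi_lt_1[of \<mu>] by (auto simp: tn_pdf_def normal_density_nonneg)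

lemma tn_pdf_measurable [measurable (raw)]:
  assumes [measurable]: "f \<in> borel_measurable M" "h \<in> borel_measurable M"
  shows "(\<lambda>x. tn_pdf (f x) y (h x)) \<in> borel_measurable M"
  unfolding tn_pdf_def std_normal_density_def by measurable

lemma nn_integral_tn_pdf: "(\<integral>\<^sup>+x. ennreal (tn_pdf \<mu> y x) \<partial>lborel) = 1"
proof (cases "y = 1")
  case True
  have "(\<integral>\<^sup>+x. ennreal (tn_pdf \<mu> y x) \<partial>lborel) = (\<integral>\<^sup>+x. ennreal (1 / Phi \<mu>) * ennreal (if 0 < x then std_normal_density (x - \<mu>) else 0) \<partial>lborel)"
    using True Phi_pos[of \<mu>] by (intro nn_integral_cong) (auto simp: tn_pdf_def ennreal_mult'[symmetric])
  also have "\<dots> = ennreal (1 / Phi \<mu>) * ennreal (Phi \<mu>)"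
    by (subst nn_integral_cmult) (auto simp: std_normal_shift_pos)
  finally show ?thesis using Phi_pos[of \<mu>] by (simp add: ennreal_mult'[symmetric])
next
  case False
  have "(\<integral>\<^sup>+x. ennreal (tn_pdf \<mu> y x) \<partial>lborel) = (\<integral>\<^sup>+x. ennreal (1 / Phi (- \<mu>)) * ennreal (if x \<le> 0 then std_normal_density (x - \<mu>) else 0) \<partial>lborel)"
    using False Phi_pos[of "- \<mu>"] by (intro nn_integral_cong) (auto simp: tn_pdf_def ennreal_mult'[symmetric] Phi_minus)
  also have "\<dots> = ennreal (1 / Phi (- \<mu>)) * ennreal (Phi (- \<mu>))"
    by (subst nn_integral_cmult) (auto simp: std_normal_shift_neg)
  finally show ?thesis using Phi_pos[of "- \<mu>"] by (simp add: ennreal_mult'[symmetric])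
qed

text \<open>The derivative of \<open>- v \<phi> (v - \<mu>)\<close> is \<open>(v\<^sup>2 - \<mu> v - 1) \<phi> (v - \<mu>)\<close>, so on \<open>[0, T]\<close> the integral of
  \<open>v\<^sup>2 \<phi>\<close> is at most that of \<open>(\<mu> v + 1) \<phi> \<le> (v\<^sup>2 / 2 + \<mu>\<^sup>2 / 2 + 1) \<phi>\<close>.\<close>
lemma truncated_second_moment:
  "(\<integral>\<^sup>+v. ennreal (v\<^sup>2) * ennreal (if 0 < v then std_normal_density (v - \<mu>) else 0) \<partial>lborel) \<le> ennreal ((2 + (max \<mu> 0)\<^sup>2) * Phi \<mu>)"
proof -
  define \<phi> where "\<phi> = (\<lambda>v. std_normal_density (v - \<mu>))"
  define C where "C = 2 + (max \<mu> 0)\<^sup>2"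
  have C: "0 < C" unfolding C_def by (simp add: add_pos_nonneg)
  have nn: "0 \<le> \<phi> v" for v by (simp add: \<phi>_def normal_density_nonneg)
  have cont [continuous_intros]: "continuous_on S \<phi>" for S unfolding \<phi>_def std_normal_density_def
    by (intro continuous_intros) auto
  have bound: "integral {0..T} (\<lambda>v. v\<^sup>2 * \<phi> v) \<le> C * integral {0..T} \<phi>" if T: "0 \<le> T" for T
  proof -
    have int: "f integrable_on {0..T}" if "continuous_on {0..T} f" for f :: "real \<Rightarrow> real"
      using that by (rule integrable_continuous_real)
    have "((\<lambda>v. (v\<^sup>2 - \<mu> * v - 1) * \<phi> v) has_integral (- T * \<phi> T) - (- 0 * \<phi> 0)) {0..T}"
    proof (rule fundamental_theorem_of_calculus[OF T])
      fix v assume "v \<in> {0..T}"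
      have "((\<lambda>v. 1 / sqrt (2 * pi) * exp (- (v - \<mu>)\<^sup>2 / 2)) has_real_derivative - (v - \<mu>) * (1 / sqrt (2 * pi) * exp (- (v - \<mu>)\<^sup>2 / 2))) (at v within {0..T})"
      proof -
        have "((\<lambda>v. exp (- (v - \<mu>)\<^sup>2 / 2)) has_real_derivative - (v - \<mu>) * exp (- (v - \<mu>)\<^sup>2 / 2)) (at v within {0..T})"
          by (auto intro!: derivative_eq_intros simp: field_simps)
        from DERIV_cmult[OF this, of "1 / sqrt (2 * pi)"] show ?thesis by (simp only: mult.left_commute)
      qed
      then have "(\<phi> has_real_derivative - (v - \<mu>) * \<phi> v) (at v within {0..T})"
        unfolding \<phi>_def std_normal_density_def .
      then have "((\<lambda>v. - v * \<phi> v) has_real_derivative (v\<^sup>2 - \<mu> * v - 1) * \<phi> v) (at v within {0..T})"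
        by (auto intro!: derivative_eq_intros simp: power2_eq_square algebra_simps)
      then show "((\<lambda>v. - v * \<phi> v) has_vector_derivative (v\<^sup>2 - \<mu> * v - 1) * \<phi> v) (at v within {0..T})"
        by (simp add: has_real_derivative_iff_has_vector_derivative)
    qed
    then have "integral {0..T} (\<lambda>v. (v\<^sup>2 - \<mu> * v - 1) * \<phi> v) = - T * \<phi> T" by (simp add: integral_unique)
    \<comment> \<open>The boundary term at \<open>T\<close> has the favourable sign, so it need not
      be shown to vanish in the limit.\<close>
    also have "\<dots> \<le> 0" using T nn[of T] by simp
    finally have neg: "integral {0..T} (\<lambda>v. (v\<^sup>2 - \<mu> * v - 1) * \<phi> v) \<le> 0" .
    have "integral {0..T} (\<lambda>v. v\<^sup>2 * \<phi> v / 2 - C / 2 * \<phi> v) \<le> integral {0..T} (\<lambda>v. (v\<^sup>2 - \<mu> * v - 1) * \<phi> v)"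
    proof (rule integral_le)
      fix v assume v: "v \<in> {0..T}"
      let ?m = "max \<mu> 0"
      have "\<mu> * v \<le> ?m * v" using v by (intro mult_right_mono) auto
      also have "\<dots> \<le> ?m\<^sup>2 / 2 + v\<^sup>2 / 2" using sum_squares_bound[of ?m v] by (simp add: field_simps)
      finally have "v\<^sup>2 / 2 - C / 2 \<le> v\<^sup>2 - \<mu> * v - 1" unfolding C_def by (simp add: field_simps)
      from mult_right_mono[OF this nn[of v]] show "v\<^sup>2 * \<phi> v / 2 - C / 2 * \<phi> v \<le> (v\<^sup>2 - \<mu> * v - 1) * \<phi> v"
        by (simp add: algebra_simps)
    qed (auto intro!: int continuous_intros)
    also note neg
    also have "integral {0..T} (\<lambda>v. v\<^sup>2 * \<phi> v / 2 - C / 2 * \<phi> v) = integral {0..T} (\<lambda>v. v\<^sup>2 * \<phi> v) / 2 - C / 2 * integral {0..T} \<phi>"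
      by (subst integral_diff) (auto intro!: int continuous_intros)
    finally show ?thesis by simp
  qed
  have step: "(\<integral>\<^sup>+v. indicator {0..real n} v * ennreal (v\<^sup>2 * \<phi> v) \<partial>lborel) \<le> ennreal (C * Phi \<mu>)" for n :: nat
  proof -
    have hi: "(f has_integral integral {0..real n} f) {0..real n}" if "continuous_on {0..real n} f" for f :: "real \<Rightarrow> real"
      using integrable_continuous_real[OF that] by (rule integrable_integral)
    have "(\<integral>\<^sup>+v. indicator {0..real n} v * ennreal (v\<^sup>2 * \<phi> v) \<partial>lborel) = (\<integral>\<^sup>+v. ennreal (indicator {0..real n} v * (v\<^sup>2 * \<phi> v)) \<partial>lborel)"
      by (intro nn_integral_cong) (auto simp: indicator_def)
    also have "\<dots> = ennreal (integral {0..real n} (\<lambda>v. v\<^sup>2 * \<phi> v))"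
      by (rule nn_integral_has_integral_lebesgue) (auto simp: nn intro!: hi continuous_intros)
    also have "\<dots> \<le> ennreal (C * integral {0..real n} \<phi>)" by (intro ennreal_leI bound) simp
    also have "\<dots> = ennreal C * ennreal (integral {0..real n} \<phi>)" using C by (simp add: ennreal_mult')
    also have "ennreal (integral {0..real n} \<phi>) = (\<integral>\<^sup>+v. ennreal (indicator {0..real n} v * \<phi> v) \<partial>lborel)"
      by (rule nn_integral_has_integral_lebesgue[symmetric]) (auto simp: nn intro!: hi continuous_intros)
    also have "\<dots> \<le> (\<integral>\<^sup>+v. ennreal (if 0 < v then \<phi> v else 0) \<partial>lborel)"
      by (intro nn_integral_mono_AE eventually_mono[OF AE_lborel_singleton[of 0]]) (auto simp: indicator_def nn)
    also have "\<dots> = ennreal (Phi \<mu>)" unfolding \<phi>_def by (rule std_normal_shift_pos)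
    finally show ?thesis using C by (simp add: ennreal_mult' mult_left_mono)
  qed
  have "(\<integral>\<^sup>+v. ennreal (v\<^sup>2) * ennreal (if 0 < v then \<phi> v else 0) \<partial>lborel)
      \<le> (\<integral>\<^sup>+v. (SUP n::nat. indicator {0..real n} v * ennreal (v\<^sup>2 * \<phi> v)) \<partial>lborel)"
  proof (rule nn_integral_mono)
    fix v :: real
    obtain n :: nat where "v \<le> real n" using real_arch_simple by blast
    then show "ennreal (v\<^sup>2) * ennreal (if 0 < v then \<phi> v else 0) \<le> (SUP n::nat. indicator {0..real n} v * ennreal (v\<^sup>2 * \<phi> v))"
      by (intro SUP_upper2[of n]) (auto simp: indicator_def ennreal_mult'[symmetric])
  qed
  also have "\<dots> = (SUP n::nat. \<integral>\<^sup>+v. indicator {0..real n} v * ennreal (v\<^sup>2 * \<phi> v) \<partial>lborel)"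
    by (rule nn_integral_monotone_convergence_SUP)
       (auto simp: incseq_def le_fun_def indicator_def \<phi>_def std_normal_density_def)
  also have "\<dots> \<le> ennreal (C * Phi \<mu>)" using step by (intro SUP_least)
  finally show ?thesis unfolding \<phi>_def C_def .
qed

text \<open>Reflection turns label 0 with mean \<mu> into label 1 with mean \<open>- \<mu>\<close>,
  up to the single point 0. The \<open>max\<close> is essential: a predictor that contradicts its
  label, however large, leaves the second moment bounded, and the contraction of the quadratic term
  rests on this.\<close>

lemma tn_pdf_second_moment:
  assumes "y = 0 \<or> y = 1"
  shows "(\<integral>\<^sup>+v. ennreal (v\<^sup>2) * ennreal (tn_pdf \<mu> y v) \<partial>lborel) \<le> ennreal (2 + (max ((2 * y - 1) * \<mu>) 0)\<^sup>2)"
proof -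
  have pos: "(\<integral>\<^sup>+v. ennreal (v\<^sup>2) * ennreal (if 0 < v then std_normal_density (v - \<nu>) / Phi \<nu> else 0) \<partial>lborel) \<le> ennreal (2 + (max \<nu> 0)\<^sup>2)" for \<nu>
  proof -
    have "(\<integral>\<^sup>+v. ennreal (v\<^sup>2) * ennreal (if 0 < v then std_normal_density (v - \<nu>) / Phi \<nu> else 0) \<partial>lborel)
       = (\<integral>\<^sup>+v. ennreal (1 / Phi \<nu>) * (ennreal (v\<^sup>2) * ennreal (if 0 < v then std_normal_density (v - \<nu>) else 0)) \<partial>lborel)"
      using Phi_pos[of \<nu>] by (intro nn_integral_cong) (auto simp: ennreal_mult'[symmetric])
    also have "\<dots> = ennreal (1 / Phi \<nu>) * (\<integral>\<^sup>+v. ennreal (v\<^sup>2) * ennreal (if 0 < v then std_normal_density (v - \<nu>) else 0) \<partial>lborel)"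
      by (rule nn_integral_cmult) measurable
    also have "\<dots> \<le> ennreal (1 / Phi \<nu>) * ennreal ((2 + (max \<nu> 0)\<^sup>2) * Phi \<nu>)"
      by (intro mult_left_mono truncated_second_moment) auto
    finally show ?thesis using Phi_pos[of \<nu>] by (simp add: ennreal_mult'[symmetric])
  qed
  from assms show ?thesis
  proof
    assume y: "y = 0"
    have "(\<integral>\<^sup>+v. ennreal (v\<^sup>2) * ennreal (tn_pdf \<mu> y v) \<partial>lborel) = (\<integral>\<^sup>+v. ennreal (v\<^sup>2) * ennreal (tn_pdf \<mu> y (- v)) \<partial>lborel)"
      by (subst nn_integral_real_affine[where c = "-1" and t = 0]) auto
    also have "\<dots> = (\<integral>\<^sup>+v. ennreal (v\<^sup>2) * ennreal (if 0 < v then std_normal_density (v - (- \<mu>)) / Phi (- \<mu>) else 0) \<partial>lborel)"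
      by (intro nn_integral_cong_AE eventually_mono[OF AE_lborel_singleton[of 0]])
         (auto simp: y tn_pdf_def Phi_minus std_normal_density_def power2_eq_square algebra_simps)
    also have "\<dots> \<le> ennreal (2 + (max (- \<mu>) 0)\<^sup>2)" by (rule pos)
    finally show ?thesis using y by simp
  next
    assume "y = 1"
    then show ?thesis using pos[of \<mu>] by (simp add: tn_pdf_def)
  qed
qed

text \<open>Outside the unit interval the power is at most 1 and a Gaussian remains. Inside,
  \<open>exp 1 * exp (- \<bar>x\<bar>)\<close> is at least 1, which turns the power into the
  integrand of \<open>Gamma (1 - s)\<close> on each half-line.\<close>

lemma nn_integral_singular_gaussian_finite:
  fixes s \<epsilon> :: real
  assumes s: "0 \<le> s" "s < 1" and e: "0 < \<epsilon>"
  shows "(\<integral>\<^sup>+x. ennreal (\<bar>x\<bar> powr (- s) * exp (- \<epsilon> * x\<^sup>2)) \<partial>lborel) < \<infinity>"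
proof -
  let ?g = "\<lambda>x::real. ennreal (if 0 < x then x powr ((1 - s) - 1) * exp (- 1 * x) else 0)"
  have g: "(\<integral>\<^sup>+x. ?g x \<partial>lborel) = ennreal (Gamma (1 - s) / 1 powr (1 - s))"
    using s by (intro nn_integral_gamma_kernel) auto
  have g': "(\<integral>\<^sup>+x. ?g (- x) \<partial>lborel) = (\<integral>\<^sup>+x. ?g x \<partial>lborel)"
    by (subst (2) nn_integral_real_affine[where c = "-1" and t = 0]) (auto intro!: nn_integral_cong)
  have h: "(\<integral>\<^sup>+x. ennreal (exp (- (2 * \<epsilon> * x\<^sup>2) / 2)) \<partial>lborel) = ennreal (sqrt (2 * pi / (2 * \<epsilon>)))"
    using e by (intro gaussian_nn_integral_1) auto
  have "(\<integral>\<^sup>+x. ennreal (\<bar>x\<bar> powr (- s) * exp (- \<epsilon> * x\<^sup>2)) \<partial>lborel)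
     \<le> (\<integral>\<^sup>+x. ennreal (exp 1) * (?g x + ?g (- x)) + ennreal (exp (- (2 * \<epsilon> * x\<^sup>2) / 2)) \<partial>lborel)"
  proof (rule nn_integral_mono)
    fix x :: real
    show "ennreal (\<bar>x\<bar> powr (- s) * exp (- \<epsilon> * x\<^sup>2)) \<le> ennreal (exp 1) * (?g x + ?g (- x)) + ennreal (exp (- (2 * \<epsilon> * x\<^sup>2) / 2))"
    proof (cases "1 \<le> \<bar>x\<bar>")
      case True
      then have "\<bar>x\<bar> powr (- s) \<le> 1 powr (- s)" using s by (intro powr_mono2') auto
      then have "\<bar>x\<bar> powr (- s) * exp (- \<epsilon> * x\<^sup>2) \<le> exp (- (2 * \<epsilon> * x\<^sup>2) / 2)" by (simp add: mult_left_le_one_le)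
      then show ?thesis by (intro add_increasing[OF zero_le ennreal_leI])
    next
      case False
      have "\<bar>x\<bar> powr (- s) * exp (- \<epsilon> * x\<^sup>2) \<le> \<bar>x\<bar> powr (- s) * 1"
        using e by (intro mult_left_mono) (auto simp: mult_nonneg_nonneg)
      also have "\<dots> \<le> \<bar>x\<bar> powr (- s) * (exp 1 * exp (- \<bar>x\<bar>))"
        using False by (intro mult_left_mono) (auto simp: mult_exp_exp)
      finally have *: "\<bar>x\<bar> powr (- s) * exp (- \<epsilon> * x\<^sup>2) \<le> exp 1 * (\<bar>x\<bar> powr (- s) * exp (- \<bar>x\<bar>))" by (simp add: mult_ac)
      have "ennreal (exp 1 * (\<bar>x\<bar> powr (- s) * exp (- \<bar>x\<bar>))) \<le> ennreal (exp 1) * (?g x + ?g (- x))"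
        by (cases "x > 0"; cases "x = 0") (auto simp: ennreal_mult'[symmetric])
      then show ?thesis by (intro add_increasing2[OF zero_le order_trans[OF ennreal_leI[OF *]]])
    qed
  qed
  also have "\<dots> = ennreal (exp 1) * ((\<integral>\<^sup>+x. ?g x \<partial>lborel) + (\<integral>\<^sup>+x. ?g (- x) \<partial>lborel)) + (\<integral>\<^sup>+x. ennreal (exp (- (2 * \<epsilon> * x\<^sup>2) / 2)) \<partial>lborel)"
    by (simp add: nn_integral_add nn_integral_cmult)
  also have "\<dots> < \<infinity>" unfolding g' g h by (simp add: ennreal_mult_less_top)
  finally show ?thesis .
qed

section \<open>The Gibbs kernel\<close>

lemma density_kernel_measurable:
  fixes f :: "'a \<Rightarrow> 'b::euclidean_space \<Rightarrow> ennreal"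
  assumes [measurable]: "case_prod f \<in> borel_measurable (M \<Otimes>\<^sub>M borel)"
    and le: "\<And>x. x \<in> space M \<Longrightarrow> (\<integral>\<^sup>+z. f x z \<partial>lborel) \<le> 1"
  shows "(\<lambda>x. density lborel (f x)) \<in> M \<rightarrow>\<^sub>M subprob_algebra borel"
proof (rule measurable_subprob_algebra)
  fix x assume x [measurable]: "x \<in> space M"
  have [measurable]: "f x \<in> borel_measurable borel" by measurable
  show "subprob_space (density lborel (f x))"
    using le[OF x] by (intro subprob_spaceI) (auto simp: emeasure_density)
next
  fix A :: "'b set" assume [measurable]: "A \<in> sets borel"
  have "(\<lambda>x. \<integral>\<^sup>+z. f x z * indicator A z \<partial>lborel) \<in> borel_measurable M" by measurable
  then show "(\<lambda>x. emeasure (density lborel (f x)) A) \<in> borel_measurable M"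
    by (rule measurable_cong[THEN iffD1, rotated]) (simp add: emeasure_density)
qed simp

lemma distr_outside_space:
  assumes "\<And>x. x \<in> space M \<Longrightarrow> f x \<notin> space N"
  shows "distr M N f = null_measure N"
proof -
  have "f -` A \<inter> space M = {}" if "A \<in> sets N" for A
    using assms sets.sets_into_space[OF that] by auto
  then have "distr M N f = measure_of (space N) (sets N) (\<lambda>_. 0)"
    unfolding distr_def by (intro measure_of_eq) (auto simp: sets.space_closed sets.sigma_sets_eq)
  then show ?thesis by (simp add: null_measure_def)
qed

text \<open>\<open>bind\<close> pushes \<open>M\<close> forward into the space of subprobability
  measures. If no value of \<open>f\<close> lies in that space, all preimages are empty and the join
  is taken over a null measure.\<close>

lemma bind_outside_subprob:
  assumes "space M \<noteq> {}" "\<And>x. x \<in> space M \<Longrightarrow> sets (f x) = sets N" "\<And>x. x \<in> space M \<Longrightarrow> \<not> subprob_space (f x)"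
  shows "sets (M \<bind> f) = sets N" and "A \<in> sets N \<Longrightarrow> emeasure (M \<bind> f) A = 0"
proof -
  have "sets (f (SOME x. x \<in> space M)) = sets N"
    by (rule assms(2)) (use assms(1) in \<open>simp add: some_in_eq\<close>)
  then have "subprob_algebra (f (SOME x. x \<in> space M)) = subprob_algebra N" by (rule subprob_algebra_cong)
  then have "M \<bind> f = join (distr M (subprob_algebra N) f)"
    using assms(1) by (simp add: bind_def)
  also have "distr M (subprob_algebra N) f = null_measure (subprob_algebra N)"
    using assms(3) by (intro distr_outside_space) (auto simp: space_subprob_algebra)
  finally have eq: "M \<bind> f = join (null_measure (subprob_algebra N))" .
  show "sets (M \<bind> f) = sets N" unfolding eq by simp
  show "A \<in> sets N \<Longrightarrow> emeasure (M \<bind> f) A = 0" unfolding eq by (subst emeasure_join) auto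
qed

lemma borel_measurable_det:
  fixes A :: "'a \<Rightarrow> real^'d::finite^'d"
  assumes "\<And>i j. (\<lambda>x. A x $ i $ j) \<in> borel_measurable M"
  shows "(\<lambda>x. det (A x)) \<in> borel_measurable M"
  unfolding det_def
  by (intro borel_measurable_sum borel_measurable_times borel_measurable_prod borel_measurable_const assms)

text \<open>Expresses the inverse through determinants, hence through polynomials in the entries;
  this is how the conditional mean is seen to be measurable in \<tau>.\<close>

lemma matrix_inv_cramer:
  fixes P :: "real^'d::finite^'d"
  assumes d: "det P \<noteq> 0"
  shows "(matrix_inv P *v u) $ k = det (\<chi> i j. if j = k then u $ i else P $ i $ j) / det P"
proof -
  have "invertible P" using d by (simp add: invertible_det_nz)
  then have "P ** matrix_inv P = mat 1"
    unfolding invertible_def matrix_inv_def by (metis (mono_tags, lifting) someI_ex)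
  then have eq: "P *v (matrix_inv P *v u) = u" by (simp add: matrix_vector_mul_assoc)
  have "det (\<chi> i j. if j = k then u $ i else P $ i $ j) = (matrix_inv P *v u) $ k * det P"
    using cramer_lemma[of k P "matrix_inv P *v u"] unfolding eq .
  then show ?thesis using d by (metis nonzero_mult_div_cancel_right)
qed

section \<open>The model, its full conditionals and the kernel\<close>

locale probit_lmm =
  fixes X :: "real^'p::finite^'n::finite" and Z :: "real^'q::finite^'n" and g :: "'q \<Rightarrow> 'r::finite"
    and y :: "'n \<Rightarrow> real" and a b :: "'r \<Rightarrow> real"
  assumes y01: "\<forall>i. y i = 0 \<or> y i = 1"
    and blocks: "surj g"
    and hyp_ab: "\<forall>j. (a j < 0 \<and> b j = 0) \<or> 0 < b j"
    and A1: "rank (Wmat X Z) = CARD('p + 'q)"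
    and A2: "\<exists>e :: real^'n. (\<forall>i. 0 < e $ i) \<and> e v* Wstar X Z y = 0"
    and A3: "\<forall>j. 0 < 2 * a j + real (qdim g j)"
begin

abbreviation "W \<equiv> Wmat X Z"
abbreviation "S \<equiv> Sigma_mat W g"
abbreviation "gibbs \<equiv> gibbs_kernel X Z g y a b"
abbreviation "post \<equiv> post_eta X Z g y a b"
abbreviation "Post \<equiv> posterior X Z g y a b"
abbreviation "pconst \<equiv> post_const X Z g y a b"

definition \<alpha> :: "'r \<Rightarrow> real" where "\<alpha> j = a j + real (qdim g j) / 2"
definition rate :: "real^('p + 'q) \<Rightarrow> 'r \<Rightarrow> real" where "rate \<eta> j = b j + usq g \<eta> j / 2"
definition f\<tau> :: "real^('p + 'q) \<Rightarrow> real^'r \<Rightarrow> real" where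
  "f\<tau> \<eta> \<tau> = (\<Prod>j\<in>UNIV. if 0 < rate \<eta> j then gamma_pdf (\<alpha> j) (rate \<eta> j) (\<tau> $ j) else gamma_pdf 1 1 (\<tau> $ j))"
definition fv :: "real^('p + 'q) \<Rightarrow> real^'n \<Rightarrow> real" where
  "fv \<eta> v = (\<Prod>i\<in>UNIV. tn_pdf ((W $ i) \<bullet> \<eta>) (y i) (v $ i))"
definition mean :: "real^'r \<Rightarrow> real^'n \<Rightarrow> real^('p + 'q)" where
  "mean \<tau> v = matrix_inv (S \<tau>) *v (transpose W *v v)"
definition f\<eta> :: "real^'r \<Rightarrow> real^'n \<Rightarrow> real^('p + 'q) \<Rightarrow> real" where
  "f\<eta> \<tau> v x = mvn_prec_pdf (S \<tau>) (mean \<tau> v) x"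

lemma tau_dist_eq: "tau_dist g a b \<eta> = density lborel (\<lambda>\<tau>. ennreal (f\<tau> \<eta> \<tau>))"
  unfolding tau_dist_def f\<tau>_def Let_def rate_def \<alpha>_def ..

lemma v_dist_eq: "v_dist W y \<eta> = density lborel (\<lambda>v. ennreal (fv \<eta> v))"
  by (simp add: v_dist_def fv_def)

lemma eta_dist_eq: "eta_dist W g \<tau> v = density lborel (\<lambda>x. ennreal (f\<eta> \<tau> v x))"
  by (simp add: eta_dist_def f\<eta>_def mean_def)

lemma \<alpha>_pos: "0 < \<alpha> j"
  using A3[rule_format, of j] by (simp add: \<alpha>_def field_simps)

lemma usq_nonneg: "0 \<le> usq g \<eta> j"
  by (auto simp: usq_def intro!: sum_nonneg)

lemma usq_measurable [measurable (raw)]: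
  assumes [measurable]: "f \<in> borel_measurable M"
  shows "(\<lambda>x. usq g (f x :: real^('p + 'q)) j) \<in> borel_measurable M"
  unfolding usq_def by measurable

lemma rate_measurable [measurable (raw)]:
  assumes [measurable]: "f \<in> borel_measurable M"
  shows "(\<lambda>x. rate (f x) j) \<in> borel_measurable M"
  unfolding rate_def by measurable

lemma f\<tau>_measurable [measurable (raw)]:
  assumes [measurable]: "f \<in> borel_measurable M" "h \<in> borel_measurable M"
  shows "(\<lambda>x. f\<tau> (f x) (h x)) \<in> borel_measurable M"
  unfolding f\<tau>_def by measurable

lemma fv_measurable [measurable (raw)]:
  assumes [measurable]: "f \<in> borel_measurable M" "h \<in> borel_measurable M"
  shows "(\<lambda>x. fv (f x) (h x)) \<in> borel_measurable M"
  unfolding fv_def by measurable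

lemma Sigma_entry: "S \<tau> $ c $ d = (transpose W ** W) $ c $ d + (if c = d then (case c of Inl _ \<Rightarrow> 0 | Inr k \<Rightarrow> \<tau> $ g k) else 0)"
  by (simp add: Sigma_mat_def Dmat_def)

lemma Sigma_entry_measurable [measurable (raw)]:
  assumes [measurable]: "f \<in> borel_measurable M"
  shows "(\<lambda>x. S (f x) $ c $ d) \<in> borel_measurable M"
  unfolding Sigma_entry by (cases "c = d"; cases d) auto

text \<open>Where \<open>S \<tau>\<close> is singular \<open>matrix_inv\<close> is a junk value, but then the square root in
  the normalising constant kills the density.\<close>
lemma f\<eta>_measurable [measurable (raw)]:
  assumes [measurable]: "f \<in> borel_measurable M" "h \<in> borel_measurable M" "k \<in> borel_measurable M"
  shows "(\<lambda>x. ennreal (f\<eta> (f x) (h x) (k x))) \<in> borel_measurable M"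
proof -
  define u where "u = (\<lambda>x. transpose W *v h x)"
  define m where "m = (\<lambda>x l. det (\<chi> i j. if j = l then u x $ i else S (f x) $ i $ j) / det (S (f x)))"
  define D where "D = (\<lambda>x. det (S (f x)))"
  have [measurable]: "D \<in> borel_measurable M"
    unfolding D_def by (rule borel_measurable_det) measurable
  have u: "(\<lambda>x. u x $ i) \<in> borel_measurable M" for i
    unfolding u_def matrix_vector_mult_def by simp
  have Sm: "(\<lambda>x. S (f x) $ i $ j) \<in> borel_measurable M" for i j by measurable
  have [measurable]: "(\<lambda>x. m x l) \<in> borel_measurable M" for l
  proof -
    have "(\<lambda>x. det (\<chi> i j. if j = l then u x $ i else S (f x) $ i $ j)) \<in> borel_measurable M"
    proof (rule borel_measurable_det)
      fix i j
      show "(\<lambda>x. (\<chi> i j. if j = l then u x $ i else S (f x) $ i $ j) $ i $ j) \<in> borel_measurable M"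
        using u[of i] Sm[of i j] by (cases "j = l") simp_all
    qed
    moreover have "(\<lambda>x. det (S (f x))) \<in> borel_measurable M" by (rule borel_measurable_det) measurable
    ultimately show ?thesis unfolding m_def by (rule borel_measurable_divide)
  qed
  have "ennreal (f\<eta> (f x) (h x) (k x)) = (if 0 < D x then ennreal (sqrt (D x / (2 * pi) ^ CARD('p + 'q)) *
      exp (- (\<Sum>i\<in>UNIV. \<Sum>j\<in>UNIV. (k x $ i - m x i) * (S (f x) $ i $ j * (k x $ j - m x j))) / 2)) else 0)" for x
  proof (cases "0 < D x")
    case True
    then have "mean (f x) (h x) $ l = m x l" for l
      unfolding mean_def m_def D_def u_def by (intro matrix_inv_cramer) auto
    then show ?thesis using True
      by (simp add: f\<eta>_def mvn_prec_pdf_def D_def inner_vec_def matrix_vector_mult_def sum_distrib_left)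
  next
    case False
    then have "sqrt (D x / (2 * pi) ^ CARD('p + 'q)) \<le> 0" by (simp add: divide_nonpos_pos)
    then have "f\<eta> (f x) (h x) (k x) \<le> 0"
      unfolding f\<eta>_def mvn_prec_pdf_def D_def by (intro mult_nonpos_nonneg) auto
    then show ?thesis using False by (simp add: ennreal_neg)
  qed
  then show ?thesis by (simp only:) measurable
qed

text \<open>The quantitative form of (A1): it converts every bound on \<open>W *v \<eta>\<close>
  into one on \<eta>.\<close>

lemma W_bounded_below: "\<exists>\<kappa>>0. \<forall>x. \<kappa> * norm x \<le> norm (W *v x)"
proof -
  have "inj ((*v) W)" using A1 full_rank_injective by blast
  then show ?thesis using linear_inj_bounded_below_pos[OF matrix_vector_mul_linear, of W] by metis
qed

lemma quadratic_Sigma: "x \<bullet> (S \<tau> *v x) = (norm (W *v x))\<^sup>2 + (\<Sum>k\<in>UNIV. \<tau> $ g k * (x $ Inr k)\<^sup>2)"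
proof -
  have "x \<bullet> ((transpose W ** W) *v x) = (norm (W *v x))\<^sup>2"
    unfolding matrix_vector_mul_assoc[symmetric] transpose_matrix_vector power2_norm_eq_inner
    by (metis dot_lmul_matrix inner_commute)
  moreover have "x \<bullet> (Dmat g \<tau> *v x) = (\<Sum>k\<in>UNIV. \<tau> $ g k * (x $ Inr k)\<^sup>2)"
  proof -
    have "x \<bullet> (Dmat g \<tau> *v x) = (\<Sum>c\<in>UNIV. (case c of Inl _ \<Rightarrow> 0 | Inr k \<Rightarrow> \<tau> $ g k) * (x $ c)\<^sup>2)"
      by (subst quadratic_form_diag) (auto simp: Dmat_def)
    also have "\<dots> = (\<Sum>k\<in>UNIV. \<tau> $ g k * (x $ Inr k)\<^sup>2)"
      unfolding UNIV_Plus_UNIV[symmetric] by (subst sum.Plus) auto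
    finally show ?thesis .
  qed
  ultimately show ?thesis by (simp add: Sigma_mat_def matrix_vector_mult_add_rdistrib inner_add_right)
qed

lemma Sigma_pos_def:
  assumes "\<And>j. 0 < \<tau> $ j"
  shows "pos_def (S \<tau>)"
  unfolding pos_def_def
proof (intro conjI allI impI)
  have "transpose (Dmat g \<tau>) = (Dmat g \<tau> :: real^('p + 'q)^('p + 'q))" by (auto simp: Dmat_def transpose_def vec_eq_iff)
  moreover have "transpose (transpose W ** W) = transpose W ** W" by (simp add: matrix_transpose_mul)
  ultimately show "transpose (S \<tau>) = S \<tau>"
    unfolding Sigma_mat_def transpose_def by (simp add: vec_eq_iff)
  fix x :: "real^('p + 'q)" assume "x \<noteq> 0"
  obtain \<kappa> where "0 < \<kappa>" "\<And>x. \<kappa> * norm x \<le> norm (W *v x)" using W_bounded_below by blast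
  with \<open>x \<noteq> 0\<close> have "0 < norm (W *v x)" by (metis less_le_trans mult_pos_pos zero_less_norm_iff)
  then show "0 < x \<bullet> (S \<tau> *v x)" unfolding quadratic_Sigma
    using assms by (intro add_pos_nonneg sum_nonneg) (auto simp: less_imp_le)
qed

lemma f\<tau>_nonneg: "0 \<le> f\<tau> \<eta> \<tau>"
  unfolding f\<tau>_def by (intro prod_nonneg) (auto intro!: gamma_pdf_nonneg \<alpha>_pos)

lemma f\<tau>_zero: "\<not> (\<forall>j. 0 < \<tau> $ j) \<Longrightarrow> f\<tau> \<eta> \<tau> = 0"
  unfolding f\<tau>_def by (auto simp: gamma_pdf_def)

lemma fv_nonneg: "0 \<le> fv \<eta> v"
  unfolding fv_def by (intro prod_nonneg) (auto intro: tn_pdf_nonneg)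

lemma nn_integral_f\<tau>: "(\<integral>\<^sup>+\<tau>. ennreal (f\<tau> \<eta> \<tau>) \<partial>lborel) = 1"
proof -
  have "(\<integral>\<^sup>+\<tau>. ennreal (f\<tau> \<eta> \<tau>) \<partial>lborel) = (\<integral>\<^sup>+\<tau>. (\<Prod>j\<in>UNIV. ennreal (if 0 < rate \<eta> j then gamma_pdf (\<alpha> j) (rate \<eta> j) (\<tau> $ j) else gamma_pdf 1 1 (\<tau> $ j))) \<partial>lborel)"
    unfolding f\<tau>_def by (subst prod_ennreal) (auto intro!: gamma_pdf_nonneg \<alpha>_pos)
  also have "\<dots> = (\<Prod>j\<in>UNIV. \<integral>\<^sup>+t. ennreal (if 0 < rate \<eta> j then gamma_pdf (\<alpha> j) (rate \<eta> j) t else gamma_pdf 1 1 t) \<partial>lborel)"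
    by (rule nn_integral_lborel_vec_prod) measurable
  also have "\<dots> = 1"
  proof (intro prod.neutral ballI)
    fix j
    show "(\<integral>\<^sup>+t. ennreal (if 0 < rate \<eta> j then gamma_pdf (\<alpha> j) (rate \<eta> j) t else gamma_pdf 1 1 t) \<partial>lborel) = 1"
      by (cases "0 < rate \<eta> j") (auto simp: nn_integral_gamma_pdf \<alpha>_pos)
  qed
  finally show ?thesis .
qed

lemma nn_integral_fv: "(\<integral>\<^sup>+v. ennreal (fv \<eta> v) \<partial>lborel) = 1"
proof -
  have "(\<integral>\<^sup>+v. ennreal (fv \<eta> v) \<partial>lborel) = (\<integral>\<^sup>+v. (\<Prod>i\<in>UNIV. ennreal (tn_pdf ((W $ i) \<bullet> \<eta>) (y i) (v $ i))) \<partial>lborel)"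
    unfolding fv_def by (subst prod_ennreal) (auto intro!: tn_pdf_nonneg)
  also have "\<dots> = (\<Prod>i\<in>UNIV. \<integral>\<^sup>+t. ennreal (tn_pdf ((W $ i) \<bullet> \<eta>) (y i) t) \<partial>lborel)"
    by (rule nn_integral_lborel_vec_prod) measurable
  also have "\<dots> = 1" by (simp add: nn_integral_tn_pdf)
  finally show ?thesis .
qed

lemma nn_integral_f\<eta>: "(\<And>j. 0 < \<tau> $ j) \<Longrightarrow> (\<integral>\<^sup>+x. ennreal (f\<eta> \<tau> v x) \<partial>lborel) = 1"
  unfolding f\<eta>_def by (intro nn_integral_mvn_prec_pdf Sigma_pos_def)

text \<open>Even where the precision matrix is singular and \<open>mean\<close> is arbitrary, the
  mean enters only as a translation. Whether \<open>eta_dist\<close> has mass at most 1 therefore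
  depends on \<tau> alone.\<close>

lemma nn_integral_f\<eta>_shift: "(\<integral>\<^sup>+x. ennreal (f\<eta> \<tau> v x) \<partial>lborel) = (\<integral>\<^sup>+x. ennreal (f\<eta> \<tau> 0 x) \<partial>lborel)"
proof -
  have "(\<integral>\<^sup>+x. ennreal (f\<eta> \<tau> v x) \<partial>lborel) = (\<integral>\<^sup>+x. ennreal (f\<eta> \<tau> v ((mean \<tau> v - mean \<tau> 0) + x)) \<partial>lborel)"
    by (rule nn_integral_lborel_shift[symmetric]) measurable
  also have "\<dots> = (\<integral>\<^sup>+x. ennreal (f\<eta> \<tau> 0 x) \<partial>lborel)"
    by (simp add: f\<eta>_def mvn_prec_pdf_def algebra_simps)
  finally show ?thesis .
qed

lemma tau_dist_measurable: "tau_dist g a b \<in> (borel :: (real^('p + 'q)) measure) \<rightarrow>\<^sub>M subprob_algebra borel"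
  unfolding tau_dist_eq[abs_def] by (rule density_kernel_measurable) (auto simp: nn_integral_f\<tau>)

lemma v_dist_measurable: "v_dist W y \<in> borel \<rightarrow>\<^sub>M subprob_algebra borel"
  unfolding v_dist_eq[abs_def] by (rule density_kernel_measurable) (auto simp: nn_integral_fv)

definition mass_ok :: "real^'r \<Rightarrow> bool" where
  "mass_ok \<tau> \<longleftrightarrow> (\<integral>\<^sup>+x. ennreal (f\<eta> \<tau> 0 x) \<partial>lborel) \<le> 1"

lemma mass_ok_pos: "(\<And>j. 0 < \<tau> $ j) \<Longrightarrow> mass_ok \<tau>"
  by (simp add: mass_ok_def nn_integral_f\<eta>)

lemma eta_dist_measurable:
  assumes "mass_ok \<tau>"
  shows "eta_dist W g \<tau> \<in> borel \<rightarrow>\<^sub>M subprob_algebra borel"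
  unfolding eta_dist_eq[abs_def]
proof (rule density_kernel_measurable)
  show "(\<lambda>(v, x). ennreal (f\<eta> \<tau> v x)) \<in> borel_measurable (borel \<Otimes>\<^sub>M borel)"
    unfolding case_prod_beta by (intro f\<eta>_measurable measurable_const measurable_fst measurable_snd) simp
  show "(\<integral>\<^sup>+x. ennreal (f\<eta> \<tau> v x) \<partial>lborel) \<le> 1" for v
    using assms unfolding mass_ok_def nn_integral_f\<eta>_shift[of \<tau> v] .
qed

lemma v_dist_sets [simp]: "sets (v_dist W y \<eta>) = sets borel" "space (v_dist W y \<eta>) = UNIV"
  by (simp_all add: v_dist_eq)

text \<open>For \<open>\<tau>\<close> outside the positive orthant \<open>eta_dist\<close> may have infinite mass, in which case
  the inner \<open>bind\<close> degenerates to the null measure; the outer integrand is still measurable.\<close>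
lemma inner_degenerate:
  assumes "\<not> mass_ok \<tau>"
  shows "sets (v_dist W y \<eta> \<bind> eta_dist W g \<tau>) = sets borel"
    and "A \<in> sets borel \<Longrightarrow> emeasure (v_dist W y \<eta> \<bind> eta_dist W g \<tau>) A = 0"
proof -
  have "\<not> subprob_space (eta_dist W g \<tau> v)" for v
  proof
    assume "subprob_space (eta_dist W g \<tau> v)"
    from subprob_space.emeasure_space_le_1[OF this] assms show False
      by (simp add: eta_dist_eq emeasure_density mass_ok_def nn_integral_f\<eta>_shift[of \<tau> v])
  qed
  then show "sets (v_dist W y \<eta> \<bind> eta_dist W g \<tau>) = sets borel"
    and "A \<in> sets borel \<Longrightarrow> emeasure (v_dist W y \<eta> \<bind> eta_dist W g \<tau>) A = 0"
    using bind_outside_subprob[of "v_dist W y \<eta>" "eta_dist W g \<tau>" borel] by (auto simp: eta_dist_eq)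
qed

lemma inner_emeasure:
  assumes [measurable]: "A \<in> sets borel"
  shows "emeasure (v_dist W y \<eta> \<bind> eta_dist W g \<tau>) A =
      (if mass_ok \<tau> then \<integral>\<^sup>+v. ennreal (fv \<eta> v) * (\<integral>\<^sup>+x. ennreal (f\<eta> \<tau> v x) * indicator A x \<partial>lborel) \<partial>lborel else 0)"
proof (cases "mass_ok \<tau>")
  case True
  have "emeasure (v_dist W y \<eta> \<bind> eta_dist W g \<tau>) A = (\<integral>\<^sup>+v. emeasure (eta_dist W g \<tau> v) A \<partial>v_dist W y \<eta>)"
    using eta_dist_measurable[OF True] by (intro emeasure_bind[where N = borel]) (auto cong: measurable_cong_sets)
  also have "\<dots> = (\<integral>\<^sup>+v. ennreal (fv \<eta> v) * (\<integral>\<^sup>+x. ennreal (f\<eta> \<tau> v x) * indicator A x \<partial>lborel) \<partial>lborel)"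
    unfolding v_dist_eq eta_dist_eq by (simp add: nn_integral_density emeasure_density)
  finally show ?thesis using True by simp
qed (simp add: inner_degenerate)

text \<open>For each \<tau> either all values of the inner kernel are subprobability measures or
  none is, and the condition that decides is measurable in \<tau>; the mass of a set is thus a
  measurable case distinction between an iterated integral and 0.\<close>

lemma inner_measurable:
  "(\<lambda>(\<eta>, \<tau>). v_dist W y \<eta> \<bind> eta_dist W g \<tau>) \<in> borel \<Otimes>\<^sub>M borel \<rightarrow>\<^sub>M subprob_algebra borel"
proof (rule measurable_subprob_algebra)
  have good: "v_dist W y \<eta> \<bind> eta_dist W g \<tau> \<in> space (subprob_algebra borel)" if "mass_ok \<tau>" for \<eta> \<tau>
    using measurable_space[OF measurable_bind2[OF v_dist_measurable eta_dist_measurable[OF that]], of \<eta>] by simp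
  fix p :: "(real^('p + 'q)) \<times> (real^'r)"
  obtain \<eta> \<tau> where p: "p = (\<eta>, \<tau>)" by force
  have s: "sets (v_dist W y \<eta> \<bind> eta_dist W g \<tau>) = sets borel"
    using good[of \<tau> \<eta>] inner_degenerate(1)[of \<tau> \<eta>] by (cases "mass_ok \<tau>") (auto simp: space_subprob_algebra)
  show "sets (case p of (\<eta>, \<tau>) \<Rightarrow> v_dist W y \<eta> \<bind> eta_dist W g \<tau>) = sets borel" using s by (simp add: p)
  have "space (v_dist W y \<eta> \<bind> eta_dist W g \<tau>) = UNIV" using sets_eq_imp_space_eq[OF s] by simp
  then show "subprob_space (case p of (\<eta>, \<tau>) \<Rightarrow> v_dist W y \<eta> \<bind> eta_dist W g \<tau>)"
    using good[of \<tau> \<eta>] inner_degenerate(2)[of \<tau> UNIV \<eta>] by (cases "mass_ok \<tau>") (auto simp: p space_subprob_algebra intro!: subprob_spaceI)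
next
  fix A :: "(real^('p + 'q)) set" assume A [measurable]: "A \<in> sets borel"
  have "(\<lambda>p. if (\<integral>\<^sup>+x. ennreal (f\<eta> (snd p) 0 x) \<partial>lborel) \<le> 1 then \<integral>\<^sup>+v. ennreal (fv (fst p) v) * (\<integral>\<^sup>+x. ennreal (f\<eta> (snd p) v x) * indicator A x \<partial>lborel) \<partial>lborel else 0)
      \<in> borel_measurable ((borel :: (real^('p + 'q)) measure) \<Otimes>\<^sub>M (borel :: (real^'r) measure))"
    by measurable
  then show "(\<lambda>p. emeasure (case p of (\<eta>, \<tau>) \<Rightarrow> v_dist W y \<eta> \<bind> eta_dist W g \<tau>) A) \<in> borel_measurable (borel \<Otimes>\<^sub>M borel)"
    by (simp add: case_prod_beta inner_emeasure mass_ok_def)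
qed

lemma gibbs_kernel_eq: "gibbs \<eta> = tau_dist g a b \<eta> \<bind> (\<lambda>\<tau>. v_dist W y \<eta> \<bind> eta_dist W g \<tau>)"
  by (simp add: gibbs_kernel_def)

lemma gibbs_measurable: "gibbs \<in> borel \<rightarrow>\<^sub>M subprob_algebra borel"
  unfolding gibbs_kernel_eq[abs_def]
  by (rule measurable_bind[OF tau_dist_measurable]) (use inner_measurable in \<open>simp add: case_prod_beta\<close>)

text \<open>The density of \<tau> vanishes outside the positive orthant, so the degenerate
  compositions never contribute; inside it the draws unfold into densities.\<close>

lemma nn_integral_gibbs:
  assumes f [measurable]: "f \<in> borel_measurable borel"
  shows "(\<integral>\<^sup>+x. f x \<partial>gibbs \<eta>) =
    (\<integral>\<^sup>+\<tau>. ennreal (f\<tau> \<eta> \<tau>) * (\<integral>\<^sup>+v. ennreal (fv \<eta> v) * (\<integral>\<^sup>+x. ennreal (f\<eta> \<tau> v x) * f x \<partial>lborel) \<partial>lborel) \<partial>lborel)"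
proof -
  have im: "(\<lambda>\<tau>. v_dist W y \<eta> \<bind> eta_dist W g \<tau>) \<in> borel \<rightarrow>\<^sub>M subprob_algebra borel"
    using measurable_compose[OF _ inner_measurable, of "\<lambda>\<tau>. (\<eta>, \<tau>)" borel] by simp
  have "(\<integral>\<^sup>+x. f x \<partial>gibbs \<eta>) = (\<integral>\<^sup>+\<tau>. \<integral>\<^sup>+x. f x \<partial>(v_dist W y \<eta> \<bind> eta_dist W g \<tau>) \<partial>tau_dist g a b \<eta>)"
    unfolding gibbs_kernel_eq using im by (intro nn_integral_bind[OF f]) (simp add: tau_dist_eq cong: measurable_cong_sets)
  also have "\<dots> = (\<integral>\<^sup>+\<tau>. ennreal (f\<tau> \<eta> \<tau>) * (\<integral>\<^sup>+x. f x \<partial>(v_dist W y \<eta> \<bind> eta_dist W g \<tau>)) \<partial>lborel)"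
    unfolding tau_dist_eq
    by (rule nn_integral_density) (use measurable_compose[OF im nn_integral_measurable_subprob_algebra[OF f]] in auto)
  also have "\<dots> = (\<integral>\<^sup>+\<tau>. ennreal (f\<tau> \<eta> \<tau>) * (\<integral>\<^sup>+v. ennreal (fv \<eta> v) * (\<integral>\<^sup>+x. ennreal (f\<eta> \<tau> v x) * f x \<partial>lborel) \<partial>lborel) \<partial>lborel)"
  proof (rule nn_integral_cong)
    fix \<tau> :: "real^'r"
    show "ennreal (f\<tau> \<eta> \<tau>) * (\<integral>\<^sup>+x. f x \<partial>(v_dist W y \<eta> \<bind> eta_dist W g \<tau>)) =
      ennreal (f\<tau> \<eta> \<tau>) * (\<integral>\<^sup>+v. ennreal (fv \<eta> v) * (\<integral>\<^sup>+x. ennreal (f\<eta> \<tau> v x) * f x \<partial>lborel) \<partial>lborel)"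
    proof (cases "\<forall>j. 0 < \<tau> $ j")
      case True
      then have "eta_dist W g \<tau> \<in> borel \<rightarrow>\<^sub>M subprob_algebra borel" by (intro eta_dist_measurable mass_ok_pos) auto
      then have "(\<integral>\<^sup>+x. f x \<partial>(v_dist W y \<eta> \<bind> eta_dist W g \<tau>)) = (\<integral>\<^sup>+v. \<integral>\<^sup>+x. f x \<partial>eta_dist W g \<tau> v \<partial>v_dist W y \<eta>)"
        by (intro nn_integral_bind[OF f]) (simp cong: measurable_cong_sets)
      also have "\<dots> = (\<integral>\<^sup>+v. ennreal (fv \<eta> v) * (\<integral>\<^sup>+x. ennreal (f\<eta> \<tau> v x) * f x \<partial>lborel) \<partial>lborel)"
        unfolding v_dist_eq eta_dist_eq by (simp add: nn_integral_density)
      finally show ?thesis by simp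
    qed (simp add: f\<tau>_zero)
  qed
  finally show ?thesis .
qed

lemma sets_gibbs [simp]: "sets (gibbs \<eta>) = sets borel"
  using sets_kernel[OF gibbs_measurable] by simp

lemma prob_space_gibbs: "prob_space (gibbs \<eta>)"
proof
  have "emeasure (gibbs \<eta>) (space (gibbs \<eta>)) = (\<integral>\<^sup>+x. 1 \<partial>gibbs \<eta>)"
    by simp
  also have "\<dots> = (\<integral>\<^sup>+\<tau>. ennreal (f\<tau> \<eta> \<tau>) * (\<integral>\<^sup>+v. ennreal (fv \<eta> v) * (\<integral>\<^sup>+x. ennreal (f\<eta> \<tau> v x) * 1 \<partial>lborel) \<partial>lborel) \<partial>lborel)"
    by (rule nn_integral_gibbs) simp
  also have "\<dots> = (\<integral>\<^sup>+\<tau>. ennreal (f\<tau> \<eta> \<tau>) \<partial>lborel)"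
  proof (rule nn_integral_cong)
    fix \<tau> :: "real^'r"
    show "ennreal (f\<tau> \<eta> \<tau>) * (\<integral>\<^sup>+v. ennreal (fv \<eta> v) * (\<integral>\<^sup>+x. ennreal (f\<eta> \<tau> v x) * 1 \<partial>lborel) \<partial>lborel) = ennreal (f\<tau> \<eta> \<tau>)"
      by (cases "\<forall>j. 0 < \<tau> $ j") (auto simp: nn_integral_f\<eta> nn_integral_fv f\<tau>_zero)
  qed
  also have "\<dots> = 1" by (rule nn_integral_f\<tau>)
  finally show "emeasure (gibbs \<eta>) (space (gibbs \<eta>)) = 1" .
qed

end

section \<open>Invariance of the posterior\<close>

text \<open>Each line in direction \<open>k\<close> meets the hyperplane in one point.\<close>

lemma AE_lborel_vec_nth_neq_0: "AE x in (lborel :: (real^'n::finite) measure). x $ k \<noteq> 0"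
proof -
  have z: "(\<integral>\<^sup>+t. indicator {z. z $ k = 0} (x + t *\<^sub>R axis k 1) \<partial>lborel) = (0::ennreal)" for x :: "real^'n"
  proof -
    have "(\<integral>\<^sup>+t. indicator {z. z $ k = 0} (x + t *\<^sub>R axis k 1) \<partial>lborel) = (\<integral>\<^sup>+t. indicator {- x $ k} t \<partial>lborel)"
      by (intro nn_integral_cong) (auto simp: indicator_def axis_def)
    then show ?thesis by simp
  qed
  have m: "{z :: real^'n. z $ k = 0} \<in> sets borel" by measurable
  have "emeasure lborel {z :: real^'n. z $ k = 0} = (\<integral>\<^sup>+x. indicator {z. z $ k = 0} x \<partial>(lborel :: (real^'n) measure))"
    using m by simp
  also have "\<dots> = 0"
    using m by (subst nn_integral_lborel_lines[where k = k]) (simp_all add: z)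
  finally show ?thesis using m by (subst AE_iff_measurable[where N = "{z. z $ k = 0}"]) auto
qed

context probit_lmm
begin

section \<open>The augmented density and its two factorizations\<close>

definition tn0 :: "'n \<Rightarrow> real \<Rightarrow> real \<Rightarrow> real" where
  "tn0 i \<mu> v = (if y i = 1 then (if 0 < v then std_normal_density (v - \<mu>) else 0) else (if v \<le> 0 then std_normal_density (v - \<mu>) else 0))"
definition lik :: "'n \<Rightarrow> real \<Rightarrow> real" where
  "lik i \<mu> = (if y i = 1 then Phi \<mu> else 1 - Phi \<mu>)"
definition prior :: "real^('p + 'q) \<Rightarrow> real^'r \<Rightarrow> 'r \<Rightarrow> real" where
  "prior \<eta> \<tau> j = (if 0 < \<tau> $ j then (\<tau> $ j / (2 * pi)) powr (real (qdim g j) / 2) * exp (- \<tau> $ j * usq g \<eta> j / 2)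
         * exp (- b j * \<tau> $ j) * (\<tau> $ j) powr (a j - 1) else 0)"
text \<open>The unnormalised joint density of the data augmentation: integrating out
  \<open>v\<close> returns the posterior, conditioning on \<eta> gives step (1) of the sampler, and
  conditioning on \<open>\<tau>\<close> and \<open>v\<close> gives step (2).\<close>

definition aug :: "real^('p + 'q) \<Rightarrow> real^'r \<Rightarrow> real^'n \<Rightarrow> real" where
  "aug \<eta> \<tau> v = (\<Prod>i\<in>UNIV. tn0 i ((W $ i) \<bullet> \<eta>) (v $ i)) * (\<Prod>j\<in>UNIV. prior \<eta> \<tau> j)"

lemma joint_post_eq: "joint_post X Z g y a b \<eta> \<tau> = (\<Prod>i\<in>UNIV. lik i ((W $ i) \<bullet> \<eta>)) * (\<Prod>j\<in>UNIV. prior \<eta> \<tau> j)"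
  unfolding joint_post_def lik_def prior_def ..

lemma lik_pos: "0 < lik i \<mu>"
  using Phi_pos[of \<mu>] Phi_lt_1[of \<mu>] by (auto simp: lik_def)

lemma tn0_eq: "tn0 i \<mu> v = lik i \<mu> * tn_pdf \<mu> (y i) v"
  using Phi_pos[of \<mu>] Phi_lt_1[of \<mu>] by (auto simp: lik_def tn0_def tn_pdf_def)

lemma tn0_nonneg: "0 \<le> tn0 i \<mu> v"
  by (auto simp: tn0_def normal_density_nonneg)

lemma prior_nonneg: "0 \<le> prior \<eta> \<tau> j"
  by (auto simp: prior_def)

lemma tn0_measurable [measurable (raw)]:
  assumes [measurable]: "f \<in> borel_measurable M" "h \<in> borel_measurable M"
  shows "(\<lambda>x. tn0 i (f x) (h x)) \<in> borel_measurable M"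
  unfolding tn0_def std_normal_density_def by measurable

lemma lik_measurable [measurable (raw)]:
  assumes [measurable]: "f \<in> borel_measurable M"
  shows "(\<lambda>x. lik i (f x)) \<in> borel_measurable M"
  unfolding lik_def by measurable

lemma prior_measurable [measurable (raw)]:
  assumes [measurable]: "f \<in> borel_measurable M" "h \<in> borel_measurable M"
  shows "(\<lambda>x. prior (f x) (h x) j) \<in> borel_measurable M"
  unfolding prior_def by measurable

lemma aug_measurable [measurable (raw)]:
  assumes [measurable]: "f \<in> borel_measurable M" "h \<in> borel_measurable M" "k \<in> borel_measurable M"
  shows "(\<lambda>x. aug (f x) (h x) (k x)) \<in> borel_measurable M"
  unfolding aug_def by measurable

lemma joint_post_measurable [measurable (raw)]:
  assumes [measurable]: "f \<in> borel_measurable M" "h \<in> borel_measurable M"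
  shows "(\<lambda>x. joint_post X Z g y a b (f x) (h x)) \<in> borel_measurable M"
  unfolding joint_post_eq by measurable

lemma post_eta_measurable [measurable]: "post \<in> borel_measurable borel"
  unfolding post_eta_def[abs_def] by measurable

lemma nn_integral_aug_v: "(\<integral>\<^sup>+v. ennreal (aug \<eta> \<tau> v) \<partial>lborel) = ennreal (joint_post X Z g y a b \<eta> \<tau>)"
proof -
  have "(\<integral>\<^sup>+v. ennreal (aug \<eta> \<tau> v) \<partial>lborel) = (\<integral>\<^sup>+v. ennreal (\<Prod>j\<in>UNIV. prior \<eta> \<tau> j) * (ennreal (\<Prod>i\<in>UNIV. lik i ((W $ i) \<bullet> \<eta>)) * ennreal (fv \<eta> v)) \<partial>lborel)"
    unfolding aug_def fv_def tn0_eq prod.distrib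
    by (intro nn_integral_cong)
       (simp add: ennreal_mult'[symmetric] prod_nonneg prior_nonneg lik_pos less_imp_le mult_ac)
  also have "\<dots> = ennreal (\<Prod>j\<in>UNIV. prior \<eta> \<tau> j) * (ennreal (\<Prod>i\<in>UNIV. lik i ((W $ i) \<bullet> \<eta>)) * 1)"
    by (simp add: nn_integral_cmult nn_integral_fv)
  also have "\<dots> = ennreal (joint_post X Z g y a b \<eta> \<tau>)"
    unfolding joint_post_eq
    by (simp add: ennreal_mult'[symmetric] prod_nonneg prior_nonneg lik_pos less_imp_le mult_ac)
  finally show ?thesis .
qed

text \<open>For positive rate, the integral of \<open>prior\<close> over the precision of block
  \<open>j\<close>, that is, the marginal weight of that block of random effects.\<close>

definition G :: "real^('p + 'q) \<Rightarrow> 'r \<Rightarrow> real" where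
  "G \<eta> j = (2 * pi) powr (- real (qdim g j) / 2) * Gamma (\<alpha> j) * rate \<eta> j powr (- \<alpha> j)"

text \<open>Gamma conjugacy. At rate 0 the prior factor is a pure power of the precision and has no
  normalising constant, hence the hypothesis.\<close>

lemma prior_eq:
  assumes r: "0 < rate \<eta> j"
  shows "prior \<eta> \<tau> j = G \<eta> j * gamma_pdf (\<alpha> j) (rate \<eta> j) (\<tau> $ j)"
proof (cases "0 < \<tau> $ j")
  case True
  let ?t = "\<tau> $ j" and ?q = "real (qdim g j) / 2"
  have 1: "(?t / (2 * pi)) powr ?q = ?t powr ?q * (2 * pi) powr (- ?q)"
    using True by (simp add: powr_divide powr_minus_divide)
  have 2: "exp (- ?t * usq g \<eta> j / 2) * exp (- b j * ?t) = exp (- rate \<eta> j * ?t)"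
    unfolding rate_def by (simp add: mult_exp_exp algebra_simps)
  have 3: "?t powr ?q * ?t powr (a j - 1) = ?t powr (\<alpha> j - 1)"
    using True by (simp add: powr_add[symmetric] \<alpha>_def algebra_simps)
  have 4: "rate \<eta> j powr (- \<alpha> j) * rate \<eta> j powr \<alpha> j = 1"
    using r by (simp add: powr_add[symmetric])
  have 5: "Gamma (\<alpha> j) \<noteq> 0" using Gamma_real_pos[OF \<alpha>_pos] by (metis less_irrefl)
  have "prior \<eta> \<tau> j = (2 * pi) powr (- ?q) * ((?t powr ?q * ?t powr (a j - 1)) * (exp (- ?t * usq g \<eta> j / 2) * exp (- b j * ?t)))"
    using True unfolding prior_def 1 by (simp add: mult_ac)
  also have "\<dots> = (2 * pi) powr (- ?q) * (?t powr (\<alpha> j - 1) * exp (- rate \<eta> j * ?t))" unfolding 2 3 ..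
  also have "\<dots> = (2 * pi) powr (- ?q) * Gamma (\<alpha> j) * (rate \<eta> j powr (- \<alpha> j) * rate \<eta> j powr \<alpha> j) * ?t powr (\<alpha> j - 1) * exp (- rate \<eta> j * ?t) / Gamma (\<alpha> j)"
    unfolding 4 using 5 by simp
  also have "\<dots> = G \<eta> j * gamma_pdf (\<alpha> j) (rate \<eta> j) ?t"
    unfolding G_def gamma_pdf_def using True by (simp add: mult_ac)
  finally show ?thesis .
qed (simp add: prior_def gamma_pdf_def)

lemma G_pos: "0 < rate \<eta> j \<Longrightarrow> 0 < G \<eta> j"
  unfolding G_def using Gamma_real_pos[OF \<alpha>_pos] by simp

lemma joint_post_f\<tau>:
  assumes "\<And>j. 0 < rate \<eta> j"
  shows "joint_post X Z g y a b \<eta> \<tau> = (\<Prod>i\<in>UNIV. lik i ((W $ i) \<bullet> \<eta>)) * (\<Prod>j\<in>UNIV. G \<eta> j) * f\<tau> \<eta> \<tau>"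
  unfolding joint_post_eq f\<tau>_def using assms by (simp add: prior_eq prod.distrib)

lemma post_eta_eq:
  assumes r: "\<And>j. 0 < rate \<eta> j"
  shows "post \<eta> = ennreal ((\<Prod>i\<in>UNIV. lik i ((W $ i) \<bullet> \<eta>)) * (\<Prod>j\<in>UNIV. G \<eta> j))"
proof -
  let ?c = "(\<Prod>i\<in>UNIV. lik i ((W $ i) \<bullet> \<eta>)) * (\<Prod>j\<in>UNIV. G \<eta> j)"
  have c: "0 \<le> ?c" using G_pos[OF r] lik_pos by (intro mult_nonneg_nonneg prod_nonneg) (auto intro: less_imp_le)
  have "post \<eta> = (\<integral>\<^sup>+\<tau>. ennreal ?c * ennreal (f\<tau> \<eta> \<tau>) \<partial>lborel)"
    unfolding post_eta_def joint_post_f\<tau>[OF r] using c by (simp add: ennreal_mult')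
  also have "\<dots> = ennreal ?c" by (simp add: nn_integral_cmult nn_integral_f\<tau>)
  finally show ?thesis .
qed

lemma aug_factor_eta:
  assumes r: "\<And>j. 0 < rate \<eta> j"
  shows "ennreal (aug \<eta> \<tau> v) = post \<eta> * (ennreal (f\<tau> \<eta> \<tau>) * ennreal (fv \<eta> v))"
proof -
  have "aug \<eta> \<tau> v = ((\<Prod>i\<in>UNIV. lik i ((W $ i) \<bullet> \<eta>)) * (\<Prod>j\<in>UNIV. G \<eta> j)) * (f\<tau> \<eta> \<tau> * fv \<eta> v)"
    unfolding aug_def f\<tau>_def fv_def tn0_eq using r by (simp add: prior_eq prod.distrib mult_ac)
  moreover have "0 \<le> (\<Prod>i\<in>UNIV. lik i ((W $ i) \<bullet> \<eta>)) * (\<Prod>j\<in>UNIV. G \<eta> j)"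
    using G_pos[OF r] lik_pos by (intro mult_nonneg_nonneg prod_nonneg) (auto intro: less_imp_le)
  ultimately show ?thesis
    unfolding post_eta_eq[OF r] using f\<tau>_nonneg fv_nonneg by (simp add: ennreal_mult'[symmetric] mult_nonneg_nonneg)
qed

lemma sum_groups: "(\<Sum>j\<in>UNIV. \<Sum>k\<in>{k. g k = j}. h j k) = (\<Sum>k\<in>UNIV. h (g k) k)"
proof -
  have "(\<Sum>j\<in>UNIV. \<Sum>k\<in>{k. g k = j}. h j k) = (\<Sum>j\<in>UNIV. \<Sum>k\<in>{k \<in> UNIV. g k = j}. h (g k) k)"
    by (intro sum.cong) auto
  also have "\<dots> = (\<Sum>k\<in>UNIV. h (g k) k)" by (rule sum.group) auto
  finally show ?thesis .
qed

lemma mean_normal_eq: "(\<And>j. 0 < \<tau> $ j) \<Longrightarrow> S \<tau> *v mean \<tau> v = transpose W *v v"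
  unfolding mean_def by (rule pos_def_matrix_inv[OF Sigma_pos_def])

lemma complete_square:
  assumes t: "\<And>j. 0 < \<tau> $ j"
  shows "(\<Sum>i\<in>UNIV. (v $ i - (W $ i) \<bullet> \<eta>)\<^sup>2) + (\<Sum>j\<in>UNIV. \<tau> $ j * usq g \<eta> j)
    = (\<eta> - mean \<tau> v) \<bullet> (S \<tau> *v (\<eta> - mean \<tau> v)) + (v \<bullet> v - mean \<tau> v \<bullet> (S \<tau> *v mean \<tau> v))"
proof -
  let ?m = "mean \<tau> v"
  have P: "pos_def (S \<tau>)" by (rule Sigma_pos_def[OF t])
  have u: "(\<Sum>j\<in>UNIV. \<tau> $ j * usq g \<eta> j) = (\<Sum>k\<in>UNIV. \<tau> $ g k * (\<eta> $ Inr k)\<^sup>2)"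
    unfolding usq_def sum_distrib_left sum_groups ..
  have "(\<Sum>i\<in>UNIV. (v $ i - (W $ i) \<bullet> \<eta>)\<^sup>2) = (v - W *v \<eta>) \<bullet> (v - W *v \<eta>)"
    by (simp add: inner_vec_def[where x = "v - W *v \<eta>"] matrix_vector_mul_component power2_eq_square)
  also have "\<dots> = v \<bullet> v - 2 * ((W *v \<eta>) \<bullet> v) + (norm (W *v \<eta>))\<^sup>2"
    by (simp add: inner_diff_left inner_diff_right inner_commute power2_norm_eq_inner)
  also have "(W *v \<eta>) \<bullet> v = \<eta> \<bullet> (S \<tau> *v ?m)"
    unfolding mean_normal_eq[OF t] transpose_matrix_vector by (metis dot_lmul_matrix inner_commute)
  finally have "(\<Sum>i\<in>UNIV. (v $ i - (W $ i) \<bullet> \<eta>)\<^sup>2) + (\<Sum>j\<in>UNIV. \<tau> $ j * usq g \<eta> j) = v \<bullet> v - 2 * (\<eta> \<bullet> (S \<tau> *v ?m)) + \<eta> \<bullet> (S \<tau> *v \<eta>)"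
    unfolding u quadratic_Sigma by simp
  moreover have "?m \<bullet> (S \<tau> *v \<eta>) = \<eta> \<bullet> (S \<tau> *v ?m)"
    using pos_def_sym[OF P, of ?m \<eta>] by (simp add: inner_commute)
  ultimately show ?thesis
    by (simp add: matrix_vector_mult_diff_distrib inner_diff_left inner_diff_right)
qed

text \<open>Completing the square isolates \<eta>; everything else, including the sign indicators of
  the truncation, goes into \<open>h\<close>.\<close>

lemma aug_factor_conditional:
  assumes t: "\<And>j. 0 < \<tau> $ j"
  shows "\<exists>h\<ge>0. \<forall>\<eta>. aug \<eta> \<tau> v = h * f\<eta> \<tau> v \<eta>"
proof -
  let ?m = "mean \<tau> v"
  define ok where "ok = (\<lambda>i. if y i = 1 then (if 0 < v $ i then 1 else 0) else (if v $ i \<le> 0 then 1 else 0 :: real))"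
  define c where "c = (\<Prod>i\<in>UNIV. ok i / sqrt (2 * pi)) * (\<Prod>j\<in>UNIV. (\<tau> $ j / (2 * pi)) powr (real (qdim g j) / 2) * exp (- b j * \<tau> $ j) * (\<tau> $ j) powr (a j - 1))"
  define d where "d = sqrt (det (S \<tau>) / (2 * pi) ^ CARD('p + 'q))"
  define h where "h = c * exp (- (v \<bullet> v - ?m \<bullet> (S \<tau> *v ?m)) / 2) / d"
  have d: "0 < d" unfolding d_def using pos_def_det[OF Sigma_pos_def[OF t]] by simp
  have c: "0 \<le> c" unfolding c_def by (intro mult_nonneg_nonneg prod_nonneg) (auto simp: ok_def)
  have "aug \<eta> \<tau> v = h * f\<eta> \<tau> v \<eta>" for \<eta>
  proof -
    have tn: "tn0 i \<mu> (v $ i) = ok i / sqrt (2 * pi) * exp (- (v $ i - \<mu>)\<^sup>2 / 2)" for i \<mu>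
      by (auto simp: tn0_def ok_def std_normal_density_def)
    have pr: "prior \<eta> \<tau> j = ((\<tau> $ j / (2 * pi)) powr (real (qdim g j) / 2) * exp (- b j * \<tau> $ j) * (\<tau> $ j) powr (a j - 1)) * exp (- (\<tau> $ j * usq g \<eta> j) / 2)" for j
      using t[of j] by (simp add: prior_def mult_ac)
    have "aug \<eta> \<tau> v = c * (exp (\<Sum>i\<in>UNIV. - (v $ i - (W $ i) \<bullet> \<eta>)\<^sup>2 / 2) * exp (\<Sum>j\<in>UNIV. - (\<tau> $ j * usq g \<eta> j) / 2))"
      unfolding aug_def tn pr prod.distrib c_def by (simp add: exp_sum mult_ac)
    also have "\<dots> = c * exp (- ((\<Sum>i\<in>UNIV. (v $ i - (W $ i) \<bullet> \<eta>)\<^sup>2) + (\<Sum>j\<in>UNIV. \<tau> $ j * usq g \<eta> j)) / 2)"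
      by (simp add: mult_exp_exp sum_divide_distrib[symmetric] sum_negf add_divide_distrib diff_divide_distrib)
    also have "\<dots> = c * (exp (- (v \<bullet> v - ?m \<bullet> (S \<tau> *v ?m)) / 2) * exp (- ((\<eta> - ?m) \<bullet> (S \<tau> *v (\<eta> - ?m))) / 2))"
      unfolding complete_square[OF t] mult_exp_exp by (simp add: field_simps)
    also have "\<dots> = h * f\<eta> \<tau> v \<eta>"
      using d unfolding h_def f\<eta>_def mvn_prec_pdf_def d_def[symmetric] by simp
    finally show ?thesis .
  qed
  moreover have "0 \<le> h" using c d by (simp add: h_def)
  ultimately show ?thesis by blast
qed

text \<open>Since \<open>f\<eta>\<close> has mass 1, integrating the factorization over \<eta>
  identifies the factor free of \<eta> without its formula. Outside the positive orthant both sides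
  vanish.\<close>

lemma aug_conditional:
  "ennreal (aug x \<tau> v) = (\<integral>\<^sup>+\<eta>. ennreal (aug \<eta> \<tau> v) \<partial>lborel) * ennreal (f\<eta> \<tau> v x)"
proof (cases "\<forall>j. 0 < \<tau> $ j")
  case True
  then obtain h where h: "0 \<le> h" "\<And>\<eta>. aug \<eta> \<tau> v = h * f\<eta> \<tau> v \<eta>"
    using aug_factor_conditional[of \<tau> v] by auto
  have "(\<integral>\<^sup>+\<eta>. ennreal (aug \<eta> \<tau> v) \<partial>lborel) = (\<integral>\<^sup>+\<eta>. ennreal h * ennreal (f\<eta> \<tau> v \<eta>) \<partial>lborel)"
    unfolding h(2) using h(1) by (simp add: ennreal_mult')
  also have "\<dots> = ennreal h" using True by (subst nn_integral_cmult) (auto simp: nn_integral_f\<eta>)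
  finally show ?thesis using h by (simp add: ennreal_mult')
next
  case False
  then have "aug \<eta> \<tau> v = 0" for \<eta> by (auto simp: aug_def prior_def)
  then show ?thesis by simp
qed

lemma AE_rate_pos: "AE \<eta> in lborel. (\<forall>k. \<eta> $ Inr k \<noteq> 0) \<and> (\<forall>j. 0 < rate \<eta> j)"
proof -
  have "AE \<eta> in (lborel :: (real^('p + 'q)) measure). \<forall>k. \<eta> $ Inr k \<noteq> 0"
    by (rule AE_all_countable[THEN iffD2]) (auto intro: AE_lborel_vec_nth_neq_0)
  then show ?thesis
  proof (rule eventually_mono)
    fix \<eta> :: "real^('p + 'q)" assume nz: "\<forall>k. \<eta> $ Inr k \<noteq> 0"
    have "0 < usq g \<eta> j" for j
    proof -
      obtain k where "g k = j" using blocks by (metis surjD)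
      then show ?thesis unfolding usq_def using nz by (intro sum_pos) auto
    qed
    moreover have "0 \<le> b j" for j using hyp_ab[rule_format, of j] by auto
    ultimately show "(\<forall>k. \<eta> $ Inr k \<noteq> 0) \<and> (\<forall>j. 0 < rate \<eta> j)"
      using nz by (auto simp: rate_def intro!: add_nonneg_pos)
  qed
qed

text \<open>Read one way, \<open>aug\<close> is \<open>post\<close> times the law of step (1); after
  exchanging the integrals it is the marginal of \<open>\<tau>\<close> and \<open>v\<close> times
  the law of step (2). The first reading fails at states with rate 0, which form a null set.\<close>

lemma post_eta_invariance:
  assumes A [measurable]: "A \<in> sets borel"
  shows "(\<integral>\<^sup>+\<eta>. post \<eta> * emeasure (gibbs \<eta>) A \<partial>lborel) = (\<integral>\<^sup>+\<eta>. post \<eta> * indicator A \<eta> \<partial>lborel)"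
proof -
  define Q where "Q = (\<lambda>\<tau> v. \<integral>\<^sup>+x. ennreal (f\<eta> \<tau> v x) * indicator A x \<partial>lborel)"
  have [measurable (raw)]: "(\<lambda>x. Q (f x) (h x)) \<in> borel_measurable M" if [measurable]: "f \<in> borel_measurable M" "h \<in> borel_measurable M" for f h and M :: "'z measure"
    unfolding Q_def by measurable
  have Km: "emeasure (gibbs \<eta>) A = (\<integral>\<^sup>+\<tau>. ennreal (f\<tau> \<eta> \<tau>) * (\<integral>\<^sup>+v. ennreal (fv \<eta> v) * Q \<tau> v \<partial>lborel) \<partial>lborel)" for \<eta>
    using nn_integral_gibbs[of "indicator A" \<eta>] A unfolding Q_def by simp
  have "(\<integral>\<^sup>+\<eta>. post \<eta> * emeasure (gibbs \<eta>) A \<partial>lborel)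
     = (\<integral>\<^sup>+\<eta>. \<integral>\<^sup>+\<tau>. \<integral>\<^sup>+v. ennreal (aug \<eta> \<tau> v) * Q \<tau> v \<partial>lborel \<partial>lborel \<partial>lborel)"
  proof (intro nn_integral_cong_AE eventually_mono[OF AE_rate_pos])
    fix \<eta> :: "real^('p + 'q)" assume "(\<forall>k. \<eta> $ Inr k \<noteq> 0) \<and> (\<forall>j. 0 < rate \<eta> j)"
    then have r: "\<And>j. 0 < rate \<eta> j" by simp
    show "post \<eta> * emeasure (gibbs \<eta>) A = (\<integral>\<^sup>+\<tau>. \<integral>\<^sup>+v. ennreal (aug \<eta> \<tau> v) * Q \<tau> v \<partial>lborel \<partial>lborel)"
      unfolding Km aug_factor_eta[OF r] by (simp add: nn_integral_cmult mult.assoc)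
  qed
  also have "\<dots> = (\<integral>\<^sup>+\<tau>. \<integral>\<^sup>+\<eta>. \<integral>\<^sup>+v. ennreal (aug \<eta> \<tau> v) * Q \<tau> v \<partial>lborel \<partial>lborel \<partial>lborel)"
    by (rule lborel_pair.Fubini') measurable
  also have "\<dots> = (\<integral>\<^sup>+\<tau>. \<integral>\<^sup>+v. \<integral>\<^sup>+\<eta>. ennreal (aug \<eta> \<tau> v) * Q \<tau> v \<partial>lborel \<partial>lborel \<partial>lborel)"
    by (rule nn_integral_cong, rule lborel_pair.Fubini') measurable
  also have "\<dots> = (\<integral>\<^sup>+\<tau>. \<integral>\<^sup>+v. \<integral>\<^sup>+x. ennreal (aug x \<tau> v) * indicator A x \<partial>lborel \<partial>lborel \<partial>lborel)"
  proof (rule nn_integral_cong, rule nn_integral_cong)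
    fix \<tau> :: "real^'r" and v :: "real^'n"
    have "(\<integral>\<^sup>+\<eta>. ennreal (aug \<eta> \<tau> v) * Q \<tau> v \<partial>lborel) = (\<integral>\<^sup>+\<eta>. ennreal (aug \<eta> \<tau> v) \<partial>lborel) * Q \<tau> v"
      by (rule nn_integral_multc) measurable
    also have "\<dots> = (\<integral>\<^sup>+x. (\<integral>\<^sup>+\<eta>. ennreal (aug \<eta> \<tau> v) \<partial>lborel) * (ennreal (f\<eta> \<tau> v x) * indicator A x) \<partial>lborel)"
      unfolding Q_def by (rule nn_integral_cmult[symmetric]) measurable
    also have "\<dots> = (\<integral>\<^sup>+x. ennreal (aug x \<tau> v) * indicator A x \<partial>lborel)"
      unfolding mult.assoc[symmetric] aug_conditional[symmetric] ..
    finally show "(\<integral>\<^sup>+\<eta>. ennreal (aug \<eta> \<tau> v) * Q \<tau> v \<partial>lborel) = (\<integral>\<^sup>+x. ennreal (aug x \<tau> v) * indicator A x \<partial>lborel)" .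
  qed
  also have "\<dots> = (\<integral>\<^sup>+\<tau>. \<integral>\<^sup>+x. \<integral>\<^sup>+v. ennreal (aug x \<tau> v) * indicator A x \<partial>lborel \<partial>lborel \<partial>lborel)"
    by (rule nn_integral_cong, rule lborel_pair.Fubini') measurable
  also have "\<dots> = (\<integral>\<^sup>+x. \<integral>\<^sup>+\<tau>. \<integral>\<^sup>+v. ennreal (aug x \<tau> v) * indicator A x \<partial>lborel \<partial>lborel \<partial>lborel)"
    by (rule lborel_pair.Fubini') measurable
  also have "\<dots> = (\<integral>\<^sup>+\<eta>. post \<eta> * indicator A \<eta> \<partial>lborel)"
    unfolding post_eta_def by (simp add: nn_integral_multc nn_integral_aug_v)
  finally show ?thesis .
qed

end

section \<open>Properness of the posterior\<close>

lemma ennreal_prod_less_top: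
  fixes h :: "'z \<Rightarrow> ennreal"
  assumes "\<And>d. h d < \<infinity>"
  shows "(\<Prod>d\<in>A. h d) < \<infinity>"
  using assms by (induction A rule: infinite_finite_induct) (auto simp: ennreal_mult_less_top)

context probit_lmm
begin

section \<open>Balance of the signed linear predictor and decay of the likelihood\<close>

abbreviation "pos_part \<eta> i \<equiv> max ((2 * y i - 1) * ((W $ i) \<bullet> \<eta>)) 0"
abbreviation "neg_part \<eta> i \<equiv> max (- ((2 * y i - 1) * ((W $ i) \<bullet> \<eta>))) 0"

lemma norm_W_parts: "(norm (W *v \<eta>))\<^sup>2 = (\<Sum>i\<in>UNIV. (pos_part \<eta> i)\<^sup>2) + (\<Sum>i\<in>UNIV. (neg_part \<eta> i)\<^sup>2)"
proof -
  have "((W *v \<eta>) $ i)\<^sup>2 = (pos_part \<eta> i)\<^sup>2 + (neg_part \<eta> i)\<^sup>2" for i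
    using y01[rule_format, of i] by (auto simp: matrix_vector_mul_component max_def)
  then show ?thesis
    by (simp add: power2_norm_eq_inner inner_vec_def power2_eq_square[symmetric] sum.distrib)
qed

text \<open>By (A2) the positive and negative parts of the signed linear predictor balance under the
  positive weights \<open>e\<close>, so neither can carry almost all of \<open>W \<eta>\<close>.\<close>
lemma pos_part_contraction:
  "\<exists>\<rho>. 0 \<le> \<rho> \<and> \<rho> < 1 \<and> (\<forall>\<eta>. (\<Sum>i\<in>UNIV. (pos_part \<eta> i)\<^sup>2) \<le> \<rho> * (norm (W *v \<eta>))\<^sup>2)"
proof -
  obtain e :: "real^'n" where e: "\<And>i. 0 < e $ i" and We: "e v* Wstar X Z y = 0" using A2 by auto
  define m where "m = Min (range (\<lambda>i. e $ i))"
  have m: "0 < m" "m \<le> e $ i" for i unfolding m_def using e by auto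
  \<comment> \<open>With \<open>m\<close> the smallest weight, balance and Cauchy-Schwarz bound the
    squared positive parts by \<open>C\<close> times the squared negative parts; as a share of the
    total this becomes \<open>C / (1 + C)\<close>.\<close>
  define C where "C = (\<Sum>i\<in>UNIV. (e $ i)\<^sup>2) / m\<^sup>2"
  have C: "0 \<le> C" unfolding C_def by (intro divide_nonneg_nonneg sum_nonneg) auto
  have "(\<Sum>i\<in>UNIV. (pos_part \<eta> i)\<^sup>2) \<le> C / (1 + C) * (norm (W *v \<eta>))\<^sup>2" for \<eta>
  proof -
    let ?P = "\<Sum>i\<in>UNIV. (pos_part \<eta> i)\<^sup>2" and ?N = "\<Sum>i\<in>UNIV. (neg_part \<eta> i)\<^sup>2"
    have "0 = (e v* Wstar X Z y) \<bullet> \<eta>" by (simp add: We)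
    also have "\<dots> = (\<Sum>i\<in>UNIV. e $ i * ((1 - 2 * y i) * ((W $ i) \<bullet> \<eta>)))"
      unfolding dot_lmul_matrix by (simp add: inner_vec_def[where x = e] matrix_vector_mul_component Wstar_def)
    also have "\<dots> = (\<Sum>i\<in>UNIV. e $ i * neg_part \<eta> i) - (\<Sum>i\<in>UNIV. e $ i * pos_part \<eta> i)"
      unfolding sum_subtractf[symmetric] by (intro sum.cong) (auto simp: max_def algebra_simps)
    finally have bal: "(\<Sum>i\<in>UNIV. e $ i * pos_part \<eta> i) = (\<Sum>i\<in>UNIV. e $ i * neg_part \<eta> i)" by simp
    have "m\<^sup>2 * ?P = (\<Sum>i\<in>UNIV. (m * pos_part \<eta> i)\<^sup>2)" by (simp add: sum_distrib_left power_mult_distrib)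
    also have "\<dots> \<le> (\<Sum>i\<in>UNIV. (e $ i * pos_part \<eta> i)\<^sup>2)"
      using m by (intro sum_mono power_mono mult_right_mono mult_nonneg_nonneg) (auto intro: less_imp_le)
    also have "\<dots> \<le> (\<Sum>i\<in>UNIV. e $ i * pos_part \<eta> i)\<^sup>2"
    proof -
      let ?x = "\<lambda>i. e $ i * pos_part \<eta> i"
      have x: "0 \<le> ?x i" for i using e by (simp add: less_imp_le)
      have "(\<Sum>i\<in>UNIV. (?x i)\<^sup>2) \<le> (\<Sum>i\<in>UNIV. ?x i * sum ?x UNIV)"
        unfolding power2_eq_square using x by (intro sum_mono mult_left_mono member_le_sum) auto
      then show ?thesis by (simp only: sum_distrib_right[symmetric] power2_eq_square)
    qed
    also have "\<dots> = (\<Sum>i\<in>UNIV. e $ i * neg_part \<eta> i)\<^sup>2" unfolding bal ..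
    also have "\<dots> \<le> (\<Sum>i\<in>UNIV. (e $ i)\<^sup>2) * ?N" by (rule Cauchy_Schwarz_ineq_sum)
    finally have "?P \<le> C * ?N" using m by (simp add: C_def field_simps)
    then have "?P * (1 + C) \<le> C * (?P + ?N)" by (simp add: algebra_simps)
    then show ?thesis using C unfolding norm_W_parts by (simp add: field_simps)
  qed
  then show ?thesis using C by (intro exI[of _ "C / (1 + C)"]) (auto simp: field_simps)
qed

lemma lik_le: "lik i ((W $ i) \<bullet> \<eta>) \<le> exp (- (neg_part \<eta> i)\<^sup>2 / 2)"
proof -
  let ?s = "(2 * y i - 1) * ((W $ i) \<bullet> \<eta>)"
  have "lik i ((W $ i) \<bullet> \<eta>) = Phi ?s"
    using y01[rule_format, of i] by (auto simp: lik_def Phi_minus)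
  also have "\<dots> \<le> exp (- (neg_part \<eta> i)\<^sup>2 / 2)"
    using Phi_tail[of "- ?s"] Phi_le_1[of ?s] by (cases "?s \<le> 0") (auto simp: max_def)
  finally show ?thesis .
qed

lemma likelihood_bound:
  "\<exists>\<epsilon>>0. \<forall>\<eta>. (\<Prod>i\<in>UNIV. lik i ((W $ i) \<bullet> \<eta>)) \<le> exp (- \<epsilon> * (norm \<eta>)\<^sup>2)"
proof -
  obtain \<kappa> where \<kappa>: "0 < \<kappa>" "\<And>x. \<kappa> * norm x \<le> norm (W *v x)" using W_bounded_below by blast
  obtain \<rho> where \<rho>: "0 \<le> \<rho>" "\<rho> < 1" "\<And>\<eta>. (\<Sum>i\<in>UNIV. (pos_part \<eta> i)\<^sup>2) \<le> \<rho> * (norm (W *v \<eta>))\<^sup>2"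
    using pos_part_contraction by blast
  \<comment> \<open>The negative parts carry at least the share \<open>1 - \<rho>\<close>, each
    likelihood factor contributes half a square to the exponent, and \<open>\<kappa>\<close> passes
    from \<open>W *v \<eta>\<close> to \<eta>.\<close>
  define \<epsilon> where "\<epsilon> = (1 - \<rho>) * \<kappa>\<^sup>2 / 2"
  have "(\<Prod>i\<in>UNIV. lik i ((W $ i) \<bullet> \<eta>)) \<le> exp (- \<epsilon> * (norm \<eta>)\<^sup>2)" for \<eta>
  proof -
    have "(\<Prod>i\<in>UNIV. lik i ((W $ i) \<bullet> \<eta>)) \<le> (\<Prod>i\<in>UNIV. exp (- (neg_part \<eta> i)\<^sup>2 / 2))"
      using lik_pos lik_le by (intro prod_mono) (auto simp: less_imp_le)
    also have "\<dots> = exp (- (\<Sum>i\<in>UNIV. (neg_part \<eta> i)\<^sup>2) / 2)"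
      by (simp add: exp_sum[symmetric] sum_negf sum_divide_distrib)
    also have "\<dots> \<le> exp (- \<epsilon> * (norm \<eta>)\<^sup>2)"
    proof -
      have "(\<kappa> * norm \<eta>)\<^sup>2 \<le> (norm (W *v \<eta>))\<^sup>2" using \<kappa> by (intro power_mono) auto
      then have "(1 - \<rho>) * (\<kappa> * norm \<eta>)\<^sup>2 \<le> (1 - \<rho>) * (norm (W *v \<eta>))\<^sup>2" using \<rho> by (intro mult_left_mono) auto
      also have "\<dots> \<le> (\<Sum>i\<in>UNIV. (neg_part \<eta> i)\<^sup>2)"
        using \<rho>(3)[of \<eta>] norm_W_parts[of \<eta>] by (simp add: algebra_simps)
      finally show ?thesis by (simp add: \<epsilon>_def power_mult_distrib)
    qed
    finally show ?thesis .
  qed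
  moreover have "0 < \<epsilon>" using \<rho> \<kappa> by (simp add: \<epsilon>_def)
  ultimately show ?thesis by blast
qed

lemma qdim_pos: "0 < qdim g j"
proof -
  obtain k where "g k = j" using blocks by (metis surjD)
  then show ?thesis by (auto simp: qdim_def card_gt_0_iff)
qed

text \<open>The exponent \<alpha> of \<open>usq\<close> is spread evenly over the coordinates of the
  block and doubled because \<open>usq\<close> is quadratic. The value is
  \<open>1 + 2 * a_j / q_j\<close>, which is below the one-dimensional integrability limit 1 exactly
  when \<open>a_j < 0\<close>.\<close>

definition sing :: "'p + 'q \<Rightarrow> real" where
  "sing c = (case c of Inl _ \<Rightarrow> 0 | Inr k \<Rightarrow> if b (g k) = 0 then 2 * \<alpha> (g k) / real (qdim g (g k)) else 0)"

lemma sing_bounds: "0 \<le> sing c" "sing c < 1"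
proof -
  show "0 \<le> sing c" using \<alpha>_pos by (auto simp: sing_def less_imp_le split: sum.splits)
  show "sing c < 1"
    using hyp_ab qdim_pos by (auto simp: sing_def \<alpha>_def field_simps split: sum.splits)
qed

text \<open>Since \<open>usq \<ge> u\<^sub>k\<^sup>2\<close> for every coordinate of the block, the singular factor
  splits into integrable one-dimensional singularities.\<close>
lemma rate_powr_bound:
  assumes nz: "\<And>k. \<eta> $ Inr k \<noteq> 0"
  shows "rate \<eta> j powr (- \<alpha> j) \<le> (if b j = 0 then 2 powr \<alpha> j else b j powr (- \<alpha> j)) * (\<Prod>k\<in>{k. g k = j}. \<bar>\<eta> $ Inr k\<bar> powr (- sing (Inr k)))"
proof (cases "b j = 0")
  case False
  then have bj: "0 < b j" using hyp_ab[rule_format, of j] by auto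
  have "(\<Prod>k\<in>{k. g k = j}. \<bar>\<eta> $ Inr k\<bar> powr (- sing (Inr k))) = 1"
    using False nz by (intro prod.neutral) (auto simp: sing_def)
  moreover have "rate \<eta> j powr (- \<alpha> j) \<le> b j powr (- \<alpha> j)"
    using bj \<alpha>_pos[of j] usq_nonneg[of \<eta> j] by (intro powr_mono2') (auto simp: rate_def less_imp_le)
  ultimately show ?thesis using False by simp
next
  case True
  let ?B = "{k. g k = j}" and ?q = "real (qdim g j)"
  have q: "0 < ?q" using qdim_pos by simp
  have u: "0 < usq g \<eta> j"
  proof -
    obtain k where "g k = j" using blocks by (metis surjD)
    then show ?thesis unfolding usq_def using nz by (intro sum_pos) auto
  qed
  have "rate \<eta> j powr (- \<alpha> j) = 2 powr \<alpha> j * usq g \<eta> j powr (- \<alpha> j)"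
    using True u by (simp add: rate_def powr_divide powr_minus_divide)
  also have "usq g \<eta> j powr (- \<alpha> j) = (\<Prod>k\<in>?B. usq g \<eta> j powr (- \<alpha> j / ?q))"
    using u q by (simp add: qdim_def[symmetric] powr_realpow[symmetric] powr_powr)
  also have "\<dots> \<le> (\<Prod>k\<in>?B. \<bar>\<eta> $ Inr k\<bar> powr (- sing (Inr k)))"
  proof (intro prod_mono conjI)
    fix k assume k: "k \<in> ?B"
    have "(\<eta> $ Inr k)\<^sup>2 \<le> usq g \<eta> j" unfolding usq_def using k by (intro member_le_sum[of k]) auto
    then have "usq g \<eta> j powr (- \<alpha> j / ?q) \<le> ((\<eta> $ Inr k)\<^sup>2) powr (- \<alpha> j / ?q)"
      using nz[of k] \<alpha>_pos[of j] q by (intro powr_mono2') (auto simp: less_imp_le divide_nonneg_pos)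
    also have "\<dots> = \<bar>\<eta> $ Inr k\<bar> powr (- sing (Inr k))"
    proof -
      have "(\<eta> $ Inr k)\<^sup>2 = \<bar>\<eta> $ Inr k\<bar> powr 2" using nz[of k] by (simp add: powr_numeral)
      then show ?thesis using k True unfolding powr_powr by (simp only: powr_powr) (simp add: sing_def)
    qed
    finally show "usq g \<eta> j powr (- \<alpha> j / ?q) \<le> \<bar>\<eta> $ Inr k\<bar> powr (- sing (Inr k))" .
  qed simp
  finally show ?thesis using True by simp
qed

lemma post_const_finite: "pconst < \<infinity>"
proof -
  obtain \<epsilon> where \<epsilon>: "0 < \<epsilon>" "\<And>\<eta>. (\<Prod>i\<in>UNIV. lik i ((W $ i) \<bullet> \<eta>)) \<le> exp (- \<epsilon> * (norm \<eta>)\<^sup>2)"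
    using likelihood_bound by blast
  define c where "c = (\<lambda>j. (2 * pi) powr (- real (qdim g j) / 2) * Gamma (\<alpha> j) * (if b j = 0 then 2 powr \<alpha> j else b j powr (- \<alpha> j)))"
  have c: "0 \<le> c j" for j unfolding c_def using Gamma_real_pos[OF \<alpha>_pos[of j]] by auto
  let ?h = "\<lambda>c t. \<bar>t\<bar> powr (- sing c) * exp (- \<epsilon> * t\<^sup>2)"
  \<comment> \<open>The fixed-effect coordinates must be nonzero as well: their exponent is 0, and
    the convention \<open>0 powr 0 = 0\<close> would make the whole product vanish.\<close>
  have bound: "post \<eta> \<le> ennreal (\<Prod>j\<in>UNIV. c j) * (\<Prod>d\<in>UNIV. ennreal (?h d (\<eta> $ d)))"
    if nz: "(\<forall>k. \<eta> $ Inr k \<noteq> 0) \<and> (\<forall>j. 0 < rate \<eta> j) \<and> (\<forall>k. \<eta> $ Inl k \<noteq> 0)" for \<eta>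
  proof -
    have r: "0 < rate \<eta> j" for j using nz by auto
    have "(\<Prod>j\<in>UNIV. G \<eta> j) \<le> (\<Prod>j\<in>UNIV. c j * (\<Prod>k\<in>{k. g k = j}. \<bar>\<eta> $ Inr k\<bar> powr (- sing (Inr k))))"
    proof (intro prod_mono conjI)
      fix j
      show "0 \<le> G \<eta> j" using G_pos[OF r] by (rule less_imp_le)
      have "G \<eta> j \<le> (2 * pi) powr (- real (qdim g j) / 2) * Gamma (\<alpha> j) * ((if b j = 0 then 2 powr \<alpha> j else b j powr (- \<alpha> j)) * (\<Prod>k\<in>{k. g k = j}. \<bar>\<eta> $ Inr k\<bar> powr (- sing (Inr k))))"
        unfolding G_def using rate_powr_bound[of \<eta> j] nz Gamma_real_pos[OF \<alpha>_pos[of j]]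
        by (intro mult_left_mono) (auto intro!: mult_nonneg_nonneg less_imp_le)
      then show "G \<eta> j \<le> c j * (\<Prod>k\<in>{k. g k = j}. \<bar>\<eta> $ Inr k\<bar> powr (- sing (Inr k)))"
        by (simp only: c_def mult.assoc)
    qed
    also have "\<dots> = (\<Prod>j\<in>UNIV. c j) * (\<Prod>k\<in>UNIV. \<bar>\<eta> $ Inr k\<bar> powr (- sing (Inr k)))"
    proof -
      have "(\<Prod>j\<in>UNIV. \<Prod>k\<in>{k \<in> UNIV. g k = j}. \<bar>\<eta> $ Inr k\<bar> powr (- sing (Inr k))) = (\<Prod>k\<in>UNIV. \<bar>\<eta> $ Inr k\<bar> powr (- sing (Inr k)))"
        by (rule prod.group) auto
      then show ?thesis by (simp add: prod.distrib)
    qed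
    also have "(\<Prod>k\<in>UNIV. \<bar>\<eta> $ Inr k\<bar> powr (- sing (Inr k))) = (\<Prod>d\<in>UNIV. \<bar>\<eta> $ d\<bar> powr (- sing d))"
    proof -
      have "(\<Prod>k\<in>UNIV. \<bar>\<eta> $ Inl k\<bar> powr (- sing (Inl k))) = 1"
        using nz by (intro prod.neutral) (auto simp: sing_def)
      then show ?thesis unfolding UNIV_Plus_UNIV[symmetric] by (subst prod.Plus) auto
    qed
    finally have Gb: "(\<Prod>j\<in>UNIV. G \<eta> j) \<le> (\<Prod>j\<in>UNIV. c j) * (\<Prod>d\<in>UNIV. \<bar>\<eta> $ d\<bar> powr (- sing d))" .
    have nrm: "exp (- \<epsilon> * (norm \<eta>)\<^sup>2) = (\<Prod>d\<in>UNIV. exp (- \<epsilon> * (\<eta> $ d)\<^sup>2))"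
      by (simp add: power2_norm_eq_inner inner_vec_def power2_eq_square[symmetric] exp_sum[symmetric] sum_distrib_left sum_negf)
    have "(\<Prod>i\<in>UNIV. lik i ((W $ i) \<bullet> \<eta>)) * (\<Prod>j\<in>UNIV. G \<eta> j) \<le> exp (- \<epsilon> * (norm \<eta>)\<^sup>2) * ((\<Prod>j\<in>UNIV. c j) * (\<Prod>d\<in>UNIV. \<bar>\<eta> $ d\<bar> powr (- sing d)))"
      using \<epsilon>(2)[of \<eta>] Gb G_pos[OF r] by (intro mult_mono prod_nonneg) (auto intro: less_imp_le)
    also have "\<dots> = (\<Prod>j\<in>UNIV. c j) * (\<Prod>d\<in>UNIV. ?h d (\<eta> $ d))"
      unfolding nrm prod.distrib by (simp only: mult_ac)
    finally show ?thesis unfolding post_eta_eq[OF r]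
      using c by (simp add: prod_ennreal ennreal_mult'[symmetric] prod_nonneg ennreal_leI)
  qed
  have AE: "AE \<eta> in lborel. (\<forall>k. \<eta> $ Inr k \<noteq> 0) \<and> (\<forall>j. 0 < rate \<eta> j) \<and> (\<forall>k. \<eta> $ Inl k \<noteq> 0)"
  proof -
    have "AE \<eta> in (lborel :: (real^('p + 'q)) measure). \<forall>k. \<eta> $ Inl k \<noteq> 0"
      by (rule AE_all_countable[THEN iffD2]) (auto intro: AE_lborel_vec_nth_neq_0)
    with AE_rate_pos show ?thesis by eventually_elim auto
  qed
  have "pconst \<le> (\<integral>\<^sup>+\<eta>. ennreal (\<Prod>j\<in>UNIV. c j) * (\<Prod>d\<in>UNIV. ennreal (?h d (\<eta> $ d))) \<partial>lborel)"
    unfolding post_const_def by (intro nn_integral_mono_AE eventually_mono[OF AE] bound)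
  also have "\<dots> = ennreal (\<Prod>j\<in>UNIV. c j) * (\<integral>\<^sup>+\<eta>. (\<Prod>d\<in>UNIV. ennreal (?h d (\<eta> $ d))) \<partial>(lborel :: (real^('p + 'q)) measure))"
    by (rule nn_integral_cmult) measurable
  also have "(\<integral>\<^sup>+\<eta>. (\<Prod>d\<in>UNIV. ennreal (?h d (\<eta> $ d))) \<partial>(lborel :: (real^('p + 'q)) measure)) = (\<Prod>d\<in>UNIV. \<integral>\<^sup>+t. ennreal (?h d t) \<partial>lborel)"
    by (rule nn_integral_lborel_vec_prod) measurable
  also have "ennreal (\<Prod>j\<in>UNIV. c j) * \<dots> < \<infinity>"
  proof -
    have "(\<integral>\<^sup>+t. ennreal (?h d t) \<partial>lborel) < \<infinity>" for d
      using sing_bounds[of d] \<epsilon>(1) by (intro nn_integral_singular_gaussian_finite)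
    then have "(\<Prod>d\<in>UNIV. \<integral>\<^sup>+t. ennreal (?h d t) \<partial>lborel) < \<infinity>"
      by (rule ennreal_prod_less_top)
    then show ?thesis by (simp add: ennreal_mult_less_top)
  qed
  finally show ?thesis .
qed

lemma post_const_pos: "0 < pconst"
proof (rule ccontr)
  assume "\<not> 0 < pconst"
  then have "(\<integral>\<^sup>+\<eta>. post \<eta> \<partial>lborel) = 0" by (simp add: post_const_def)
  then have "AE \<eta> in lborel. post \<eta> = 0" by (subst (asm) nn_integral_0_iff_AE) auto
  with AE_rate_pos have "AE \<eta> in (lborel :: (real^('p + 'q)) measure). False"
  proof eventually_elim
    case (elim \<eta>)
    then have r: "\<And>j. 0 < rate \<eta> j" by auto
    have "0 < (\<Prod>i\<in>UNIV. lik i ((W $ i) \<bullet> \<eta>)) * (\<Prod>j\<in>UNIV. G \<eta> j)"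
      using lik_pos G_pos[OF r] by (intro mult_pos_pos prod_pos) auto
    then show ?case using elim unfolding post_eta_eq[OF r] by (simp add: ennreal_eq_0_iff)
  qed
  then have "emeasure (lborel :: (real^('p + 'q)) measure) UNIV = 0"
    by (subst (asm) AE_iff_measurable[where N = UNIV]) auto
  then show False by simp
qed

lemma sets_posterior [simp]: "sets (Post) = sets borel"
  by (simp add: posterior_def)

lemma prob_space_posterior: "prob_space (Post)"
proof
  have "emeasure (Post) (space (Post)) = (\<integral>\<^sup>+\<eta>. post \<eta> / pconst \<partial>lborel)"
    unfolding posterior_def by (simp add: emeasure_density)
  also have "\<dots> = pconst / pconst"
    by (subst nn_integral_divide) (auto simp: post_const_def)
  also have "\<dots> = 1" using post_const_pos post_const_finite by (intro ennreal_divide_self) auto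
  finally show "emeasure (Post) (space (Post)) = 1" .
qed

lemma posterior_invariant: "Post \<bind> gibbs = Post"
proof (rule measure_eqI)
  have K: "gibbs \<in> Post \<rightarrow>\<^sub>M subprob_algebra borel"
    using gibbs_measurable by (simp cong: measurable_cong_sets)
  have ne: "space (Post) \<noteq> {}" by (simp add: posterior_def)
  show s: "sets (Post \<bind> gibbs) = sets (Post)"
    by (subst sets_bind[where N = borel]) (auto simp: ne)
  fix A assume "A \<in> sets (Post \<bind> gibbs)"
  then have A [measurable]: "A \<in> sets borel" unfolding s by simp
  have [measurable]: "(\<lambda>\<eta>. emeasure (gibbs \<eta>) A) \<in> borel_measurable borel"
    using gibbs_measurable A by (rule measurable_emeasure_kernel)
  have "emeasure (Post \<bind> gibbs) A = (\<integral>\<^sup>+\<eta>. emeasure (gibbs \<eta>) A \<partial>Post)"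
    by (rule emeasure_bind[OF ne K A])
  also have "\<dots> = (\<integral>\<^sup>+\<eta>. post \<eta> / pconst * emeasure (gibbs \<eta>) A \<partial>lborel)"
    unfolding posterior_def by (rule nn_integral_density) measurable
  also have "\<dots> = (\<integral>\<^sup>+\<eta>. (post \<eta> * emeasure (gibbs \<eta>) A) / pconst \<partial>lborel)"
    by (simp add: divide_ennreal_def mult_ac)
  also have "\<dots> = (\<integral>\<^sup>+\<eta>. post \<eta> * emeasure (gibbs \<eta>) A \<partial>lborel) / pconst"
    by (rule nn_integral_divide) measurable
  also have "\<dots> = (\<integral>\<^sup>+\<eta>. (post \<eta> * indicator A \<eta>) / pconst \<partial>lborel)"
    unfolding post_eta_invariance[OF A] by (rule nn_integral_divide[symmetric]) measurable
  also have "\<dots> = emeasure (Post) A"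
    unfolding posterior_def by (subst emeasure_density) (auto simp: divide_ennreal_def mult_ac)
  finally show "emeasure (Post \<bind> gibbs) A = emeasure (Post) A" .
qed

end

section \<open>Drift condition\<close>

lemma nn_integral_vec_prod_coordinate:
  fixes f :: "'n::finite \<Rightarrow> real \<Rightarrow> ennreal"
  assumes [measurable]: "\<And>i. f i \<in> borel_measurable borel" "h \<in> borel_measurable borel"
    and one: "\<And>i. (\<integral>\<^sup>+t. f i t \<partial>lborel) = 1"
  shows "(\<integral>\<^sup>+x. (\<Prod>i\<in>UNIV. f i (x $ i)) * h (x $ k) \<partial>(lborel :: (real^'n) measure)) = (\<integral>\<^sup>+t. f k t * h t \<partial>lborel)"
proof -
  define f' where "f' = (\<lambda>i t. if i = k then f k t * h t else f i t)"
  have [measurable]: "f' i \<in> borel_measurable borel" for i unfolding f'_def by (cases "i = k") auto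
  have "(\<Prod>i\<in>UNIV. f i (x $ i)) * h (x $ k) = (\<Prod>i\<in>UNIV. f' i (x $ i))" for x :: "real^'n"
  proof -
    have "(\<Prod>i\<in>UNIV. f' i (x $ i)) = f' k (x $ k) * (\<Prod>i\<in>UNIV - {k}. f' i (x $ i))" by (rule prod.remove) auto
    also have "(\<Prod>i\<in>UNIV - {k}. f' i (x $ i)) = (\<Prod>i\<in>UNIV - {k}. f i (x $ i))" by (intro prod.cong) (auto simp: f'_def)
    also have "f' k (x $ k) * \<dots> = (f k (x $ k) * (\<Prod>i\<in>UNIV - {k}. f i (x $ i))) * h (x $ k)" by (simp add: f'_def mult_ac)
    also have "f k (x $ k) * (\<Prod>i\<in>UNIV - {k}. f i (x $ i)) = (\<Prod>i\<in>UNIV. f i (x $ i))" by (rule prod.remove[symmetric]) auto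
    finally show ?thesis ..
  qed
  then have "(\<integral>\<^sup>+x. (\<Prod>i\<in>UNIV. f i (x $ i)) * h (x $ k) \<partial>(lborel :: (real^'n) measure)) = (\<Prod>i\<in>UNIV. \<integral>\<^sup>+t. f' i t \<partial>lborel)"
    by (simp add: nn_integral_lborel_vec_prod)
  also have "\<dots> = (\<integral>\<^sup>+t. f' k t \<partial>lborel) * (\<Prod>i\<in>UNIV - {k}. \<integral>\<^sup>+t. f' i t \<partial>lborel)" by (rule prod.remove) auto
  also have "(\<Prod>i\<in>UNIV - {k}. \<integral>\<^sup>+t. f' i t \<partial>lborel) = 1" by (intro prod.neutral) (auto simp: f'_def one)
  finally show ?thesis by (simp add: f'_def)
qed

text \<open>Writing \<open>u powr (- c)\<close> as a Gamma integral of \<open>exp (- t u)\<close> reduces the negative moment to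
  the Laplace transform.\<close>
lemma mvn_prec_pdf_negative_moment:
  fixes P :: "real^'d::finite^'d"
  assumes P: "pos_def P" and c: "0 < c" "c < real (card S) / 2" and bd: "\<And>k. k \<in> S \<Longrightarrow> P $ k $ k \<le> \<kappa>" and \<kappa>: "0 < \<kappa>"
  shows "(\<integral>\<^sup>+x. ennreal (mvn_prec_pdf P m x) * ennreal ((\<Sum>k\<in>S. (x $ k)\<^sup>2) powr (- c)) \<partial>lborel)
    \<le> ennreal ((\<kappa> / 2) powr c * Gamma (real (card S) / 2 - c) / Gamma (real (card S) / 2))"
proof -
  define u where "u = (\<lambda>x :: real^'d. \<Sum>k\<in>S. (x $ k)\<^sup>2)"
  have [measurable]: "u \<in> borel_measurable borel" unfolding u_def by measurable
  have u0: "0 \<le> u x" for x unfolding u_def by (intro sum_nonneg) auto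
  have gc: "0 < Gamma c" using c by (intro Gamma_real_pos)
  let ?k = "\<lambda>x t. if 0 < t then t powr (c - 1) * exp (- u x * t) else 0"
  \<comment> \<open>Only an inequality holds at \<open>u x = 0\<close>: the left side is 0 by the
    \<open>powr\<close> convention, while the integral diverges.\<close>
  have rep: "ennreal (u x powr (- c)) \<le> ennreal (1 / Gamma c) * (\<integral>\<^sup>+t. ennreal (?k x t) \<partial>lborel)" for x
  proof (cases "u x = 0")
    case False
    then have "0 < u x" using u0[of x] by simp
    with c(1) have "(\<integral>\<^sup>+t. ennreal (?k x t) \<partial>lborel) = ennreal (Gamma c / u x powr c)"
      by (rule nn_integral_gamma_kernel)
    moreover have "ennreal (1 / Gamma c) * ennreal (Gamma c / u x powr c) = ennreal (u x powr (- c))"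
      using gc by (simp add: ennreal_mult'[symmetric] powr_minus_divide)
    ultimately show ?thesis by (simp only: order_refl)
  qed simp
  have "(\<integral>\<^sup>+x. ennreal (mvn_prec_pdf P m x) * ennreal (u x powr (- c)) \<partial>lborel)
     \<le> (\<integral>\<^sup>+x. ennreal (mvn_prec_pdf P m x) * (ennreal (1 / Gamma c) * (\<integral>\<^sup>+t. ennreal (?k x t) \<partial>lborel)) \<partial>lborel)"
    by (intro nn_integral_mono mult_left_mono rep) auto
  also have "\<dots> = (\<integral>\<^sup>+x. ennreal (1 / Gamma c) * (\<integral>\<^sup>+t. ennreal (mvn_prec_pdf P m x) * ennreal (?k x t) \<partial>lborel) \<partial>lborel)"
    by (intro nn_integral_cong) (simp add: nn_integral_cmult mult_ac)
  also have "\<dots> = ennreal (1 / Gamma c) * (\<integral>\<^sup>+x. \<integral>\<^sup>+t. ennreal (mvn_prec_pdf P m x) * ennreal (?k x t) \<partial>lborel \<partial>lborel)"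
    by (rule nn_integral_cmult) measurable
  also have "(\<integral>\<^sup>+x. \<integral>\<^sup>+t. ennreal (mvn_prec_pdf P m x) * ennreal (?k x t) \<partial>lborel \<partial>lborel)
     = (\<integral>\<^sup>+t. \<integral>\<^sup>+x. ennreal (mvn_prec_pdf P m x) * ennreal (?k x t) \<partial>lborel \<partial>lborel)"
    by (rule lborel_pair.Fubini') measurable
  also have "\<dots> \<le> (\<integral>\<^sup>+t. ennreal (if 0 < t then t powr (c - 1) * (1 + 2 * t / \<kappa>) powr (- (real (card S) / 2)) else 0) \<partial>lborel)"
  proof (rule nn_integral_mono)
    fix t :: real
    show "(\<integral>\<^sup>+x. ennreal (mvn_prec_pdf P m x) * ennreal (?k x t) \<partial>lborel)
        \<le> ennreal (if 0 < t then t powr (c - 1) * (1 + 2 * t / \<kappa>) powr (- (real (card S) / 2)) else 0)"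
    proof (cases "0 < t")
      case True
      have "(\<integral>\<^sup>+x. ennreal (mvn_prec_pdf P m x) * ennreal (?k x t) \<partial>lborel)
          = (\<integral>\<^sup>+x. ennreal (t powr (c - 1)) * (ennreal (exp (- (t * (\<Sum>k\<in>S. (x $ k)\<^sup>2)))) * ennreal (mvn_prec_pdf P m x)) \<partial>lborel)"
        using True mvn_prec_pdf_nonneg[OF P]
        by (intro nn_integral_cong) (simp add: u_def ennreal_mult'[symmetric] mult_ac)
      also have "\<dots> = ennreal (t powr (c - 1)) * (\<integral>\<^sup>+x. ennreal (exp (- (t * (\<Sum>k\<in>S. (x $ k)\<^sup>2)))) * ennreal (mvn_prec_pdf P m x) \<partial>lborel)"
        by (rule nn_integral_cmult) measurable
      also have "\<dots> \<le> ennreal (t powr (c - 1)) * ennreal ((1 + 2 * t / \<kappa>) powr (- real (card S) / 2))"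
        using True bd \<kappa> by (intro mult_left_mono mvn_prec_pdf_laplace[OF P]) auto
      finally show ?thesis using True by (simp add: ennreal_mult'[symmetric])
    qed simp
  qed
  also have "\<dots> = ennreal ((\<kappa> / 2) powr c * Gamma c * Gamma (real (card S) / 2 - c) / Gamma (real (card S) / 2))"
    using c \<kappa> by (intro nn_integral_inverse_beta_kernel) auto
  finally have "(\<integral>\<^sup>+x. ennreal (mvn_prec_pdf P m x) * ennreal (u x powr (- c)) \<partial>lborel)
     \<le> ennreal (1 / Gamma c) * ennreal ((\<kappa> / 2) powr c * Gamma c * Gamma (real (card S) / 2 - c) / Gamma (real (card S) / 2))"
    by (simp add: mult_left_mono)
  also have "\<dots> = ennreal ((\<kappa> / 2) powr c * Gamma (real (card S) / 2 - c) / Gamma (real (card S) / 2))"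
    using gc by (simp add: ennreal_mult'[symmetric])
  finally show ?thesis unfolding u_def .
qed

text \<open>A number in the unit interval does not decrease when raised to a power at most 1; apply
  this to the fractions \<open>x / (x + y)\<close> and \<open>y / (x + y)\<close>, which sum to
  1.\<close>

lemma powr_add_le:
  fixes x y c :: real
  assumes "0 < x" "0 < y" "0 < c" "c \<le> 1"
  shows "(x + y) powr c \<le> x powr c + y powr c"
proof -
  have *: "z / (x + y) \<le> (z / (x + y)) powr c" if "0 < z" "z \<le> x + y" for z
    using that assms powr_mono'[of c 1 "z / (x + y)"] by simp
  have "1 = x / (x + y) + y / (x + y)" using assms by (simp add: add_divide_distrib[symmetric])
  also have "\<dots> \<le> (x / (x + y)) powr c + (y / (x + y)) powr c" using *[of x] *[of y] assms by auto
  also have "\<dots> = (x powr c + y powr c) / (x + y) powr c" using assms by (simp add: powr_divide add_divide_distrib)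
  finally show ?thesis using assms by (simp add: field_simps)
qed

context probit_lmm
begin

text \<open>The cross term between mean and fluctuation is absorbed by Young's inequality with
  weight \<delta>, which keeps the coefficient of the squared norm of \<open>v\<close> as close to 1
  as the drift requires. No \<tau> appears in the bound because the penalty in
  \<open>S \<tau>\<close> only adds to the quadratic form.\<close>

lemma f\<eta>_norm_moment:
  assumes t: "\<And>j. 0 < \<tau> $ j" and \<delta>: "0 < \<delta>"
  shows "(\<integral>\<^sup>+x. ennreal (f\<eta> \<tau> v x) * ennreal ((norm (W *v x))\<^sup>2) \<partial>lborel)
    \<le> ennreal ((1 + \<delta>) * (norm v)\<^sup>2 + (1 + 1 / \<delta>) * (4 * sqrt (2 ^ CARD('p + 'q))))"
proof -
  let ?m = "mean \<tau> v"
  have P: "pos_def (S \<tau>)" by (rule Sigma_pos_def[OF t])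
  have le: "(norm (W *v x))\<^sup>2 \<le> x \<bullet> (S \<tau> *v x)" for x
    unfolding quadratic_Sigma using t by (simp add: sum_nonneg less_imp_le)
  have "(norm (W *v ?m))\<^sup>2 \<le> ?m \<bullet> (S \<tau> *v ?m)" by (rule le)
  also have "\<dots> = (W *v ?m) \<bullet> v"
    unfolding mean_normal_eq[OF t] transpose_matrix_vector by (metis dot_lmul_matrix inner_commute)
  also have "\<dots> \<le> norm (W *v ?m) * norm v" by (rule norm_cauchy_schwarz)
  finally have "norm (W *v ?m) \<le> norm v"
    by (cases "norm (W *v ?m) = 0") (auto simp: power2_eq_square)
  then have wm: "(norm (W *v ?m))\<^sup>2 \<le> (norm v)\<^sup>2" by (intro power_mono) auto
  have pt: "(norm (W *v x))\<^sup>2 \<le> (1 + \<delta>) * (norm v)\<^sup>2 + (1 + 1 / \<delta>) * ((x - ?m) \<bullet> (S \<tau> *v (x - ?m)))" for x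
  proof -
    let ?p = "norm (W *v ?m)" and ?r = "norm (W *v (x - ?m))"
    have "W *v x = W *v ?m + W *v (x - ?m)" by (simp add: matrix_vector_mult_diff_distrib)
    then have "norm (W *v x) \<le> ?p + ?r" by (metis norm_triangle_ineq)
    then have "(norm (W *v x))\<^sup>2 \<le> (?p + ?r)\<^sup>2" by (intro power_mono) auto
    also have "\<dots> \<le> (1 + \<delta>) * ?p\<^sup>2 + (1 + 1 / \<delta>) * ?r\<^sup>2"
    proof -
      have "0 \<le> (\<delta> * ?p - ?r)\<^sup>2 / \<delta>" using \<delta> by simp
      also have "\<dots> = \<delta> * ?p\<^sup>2 - 2 * ?p * ?r + ?r\<^sup>2 / \<delta>" using \<delta> by (simp add: power2_eq_square field_simps)
      finally show ?thesis by (simp add: power2_sum algebra_simps)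
    qed
    also have "\<dots> \<le> (1 + \<delta>) * (norm v)\<^sup>2 + (1 + 1 / \<delta>) * ((x - ?m) \<bullet> (S \<tau> *v (x - ?m)))"
      using wm le[of "x - ?m"] \<delta> by (intro add_mono mult_left_mono) auto
    finally show ?thesis .
  qed
  have "(\<integral>\<^sup>+x. ennreal (f\<eta> \<tau> v x) * ennreal ((norm (W *v x))\<^sup>2) \<partial>lborel)
     \<le> (\<integral>\<^sup>+x. ennreal ((1 + \<delta>) * (norm v)\<^sup>2) * ennreal (mvn_prec_pdf (S \<tau>) ?m x)
        + ennreal (1 + 1 / \<delta>) * (ennreal ((x - ?m) \<bullet> (S \<tau> *v (x - ?m))) * ennreal (mvn_prec_pdf (S \<tau>) ?m x)) \<partial>lborel)"
  proof (rule nn_integral_mono)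
    fix x
    have q: "0 \<le> (x - ?m) \<bullet> (S \<tau> *v (x - ?m))" by (rule pos_def_nonneg[OF P])
    have d: "0 \<le> mvn_prec_pdf (S \<tau>) ?m x" by (rule mvn_prec_pdf_nonneg[OF P])
    have "mvn_prec_pdf (S \<tau>) ?m x * (norm (W *v x))\<^sup>2 \<le> (1 + \<delta>) * (norm v)\<^sup>2 * mvn_prec_pdf (S \<tau>) ?m x + (1 + 1 / \<delta>) * ((x - ?m) \<bullet> (S \<tau> *v (x - ?m)) * mvn_prec_pdf (S \<tau>) ?m x)"
      using mult_left_mono[OF pt[of x] d] by (simp add: algebra_simps)
    then show "ennreal (f\<eta> \<tau> v x) * ennreal ((norm (W *v x))\<^sup>2) \<le> ennreal ((1 + \<delta>) * (norm v)\<^sup>2) * ennreal (mvn_prec_pdf (S \<tau>) ?m x)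
        + ennreal (1 + 1 / \<delta>) * (ennreal ((x - ?m) \<bullet> (S \<tau> *v (x - ?m))) * ennreal (mvn_prec_pdf (S \<tau>) ?m x))"
      unfolding f\<eta>_def using q d \<delta>
      by (simp add: ennreal_mult'[symmetric] ennreal_plus[symmetric] ennreal_leI del: ennreal_plus)
  qed
  also have "\<dots> = ennreal ((1 + \<delta>) * (norm v)\<^sup>2) * (\<integral>\<^sup>+x. ennreal (mvn_prec_pdf (S \<tau>) ?m x) \<partial>lborel)
      + ennreal (1 + 1 / \<delta>) * (\<integral>\<^sup>+x. ennreal ((x - ?m) \<bullet> (S \<tau> *v (x - ?m))) * ennreal (mvn_prec_pdf (S \<tau>) ?m x) \<partial>lborel)"
  proof -
    have [measurable]: "(\<lambda>x. (x - ?m) \<bullet> (S \<tau> *v (x - ?m))) \<in> borel_measurable borel"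
      by (intro borel_measurable_continuous_onI continuous_intros)
    show ?thesis by (simp add: nn_integral_add nn_integral_cmult)
  qed
  also have "\<dots> \<le> ennreal ((1 + \<delta>) * (norm v)\<^sup>2) * 1 + ennreal (1 + 1 / \<delta>) * ennreal (4 * sqrt (2 ^ CARD('p + 'q)))"
    unfolding nn_integral_mvn_prec_pdf[OF P] by (intro add_left_mono mult_left_mono mvn_prec_pdf_quadratic_moment[OF P]) auto
  also have "\<dots> = ennreal ((1 + \<delta>) * (norm v)\<^sup>2 + (1 + 1 / \<delta>) * (4 * sqrt (2 ^ CARD('p + 'q))))"
    using \<delta> by (simp add: ennreal_mult'[symmetric] ennreal_plus[symmetric] del: ennreal_plus)
  finally show ?thesis .
qed

lemma fv_norm_moment:
  "(\<integral>\<^sup>+v. ennreal (fv \<eta> v) * ennreal ((norm v)\<^sup>2) \<partial>lborel) \<le> ennreal (2 * real CARD('n) + (\<Sum>i\<in>UNIV. (pos_part \<eta> i)\<^sup>2))"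
proof -
  have "(\<integral>\<^sup>+v. ennreal (fv \<eta> v) * ennreal ((norm v)\<^sup>2) \<partial>lborel)
      = (\<integral>\<^sup>+v. (\<Sum>k\<in>UNIV. (\<Prod>i\<in>UNIV. ennreal (tn_pdf ((W $ i) \<bullet> \<eta>) (y i) (v $ i))) * ennreal ((v $ k)\<^sup>2)) \<partial>lborel)"
  proof (rule nn_integral_cong)
    fix v :: "real^'n"
    have "(norm v)\<^sup>2 = (\<Sum>k\<in>UNIV. (v $ k)\<^sup>2)"
      unfolding power2_norm_eq_inner inner_vec_def by (simp add: power2_eq_square)
    then have "ennreal ((norm v)\<^sup>2) = (\<Sum>k\<in>UNIV. ennreal ((v $ k)\<^sup>2))" by simp
    then show "ennreal (fv \<eta> v) * ennreal ((norm v)\<^sup>2) = (\<Sum>k\<in>UNIV. (\<Prod>i\<in>UNIV. ennreal (tn_pdf ((W $ i) \<bullet> \<eta>) (y i) (v $ i))) * ennreal ((v $ k)\<^sup>2))"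
      by (simp add: fv_def prod_ennreal tn_pdf_nonneg sum_distrib_left del: sum_ennreal)
  qed
  also have "\<dots> = (\<Sum>k\<in>UNIV. \<integral>\<^sup>+v. (\<Prod>i\<in>UNIV. ennreal (tn_pdf ((W $ i) \<bullet> \<eta>) (y i) (v $ i))) * ennreal ((v $ k)\<^sup>2) \<partial>lborel)"
    by (rule nn_integral_sum) measurable
  also have "\<dots> = (\<Sum>k\<in>UNIV. \<integral>\<^sup>+t. ennreal (tn_pdf ((W $ k) \<bullet> \<eta>) (y k) t) * ennreal (t\<^sup>2) \<partial>lborel)"
    by (intro sum.cong refl nn_integral_vec_prod_coordinate) (auto simp: nn_integral_tn_pdf)
  also have "\<dots> \<le> (\<Sum>k\<in>UNIV. ennreal (2 + (pos_part \<eta> k)\<^sup>2))"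
    unfolding mult.commute[of "ennreal (tn_pdf _ _ _)"] using y01 by (intro sum_mono tn_pdf_second_moment) auto
  also have "\<dots> = ennreal (\<Sum>k\<in>UNIV. 2 + (pos_part \<eta> k)\<^sup>2)" by (rule sum_ennreal) auto
  also have "(\<Sum>k\<in>UNIV. 2 + (pos_part \<eta> k)\<^sup>2) = 2 * real CARD('n) + (\<Sum>i\<in>UNIV. (pos_part \<eta> i)\<^sup>2)"
    by (simp add: sum.distrib)
  finally show ?thesis .
qed

section \<open>Moments of the precisions and the singular terms\<close>

lemma f\<tau>_powr_moment:
  assumes c: "0 < c"
  shows "(\<integral>\<^sup>+\<tau>. ennreal (f\<tau> \<eta> \<tau>) * ennreal ((\<tau> $ j) powr c) \<partial>lborel)
    = ennreal (if 0 < rate \<eta> j then Gamma (\<alpha> j + c) / Gamma (\<alpha> j) * rate \<eta> j powr (- c) else Gamma (1 + c))"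
proof -
  let ?f = "\<lambda>j t. ennreal (if 0 < rate \<eta> j then gamma_pdf (\<alpha> j) (rate \<eta> j) t else gamma_pdf 1 1 t)"
  have one: "(\<integral>\<^sup>+t. ?f j t \<partial>lborel) = 1" for j
    by (cases "0 < rate \<eta> j") (auto simp: nn_integral_gamma_pdf \<alpha>_pos)
  have "(\<integral>\<^sup>+\<tau>. ennreal (f\<tau> \<eta> \<tau>) * ennreal ((\<tau> $ j) powr c) \<partial>lborel) = (\<integral>\<^sup>+\<tau>. (\<Prod>j\<in>UNIV. ?f j (\<tau> $ j)) * ennreal ((\<tau> $ j) powr c) \<partial>lborel)"
    unfolding f\<tau>_def by (subst prod_ennreal) (auto intro!: gamma_pdf_nonneg \<alpha>_pos)
  also have "\<dots> = (\<integral>\<^sup>+t. ?f j t * ennreal (t powr c) \<partial>lborel)"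
    by (rule nn_integral_vec_prod_coordinate) (auto simp: one)
  also have "\<dots> = ennreal (if 0 < rate \<eta> j then Gamma (\<alpha> j + c) / Gamma (\<alpha> j) * rate \<eta> j powr (- c) else Gamma (1 + c))"
    using gamma_pdf_moment[OF \<alpha>_pos[of j], of "rate \<eta> j" c] gamma_pdf_moment[of 1 1 c] \<alpha>_pos[of j] c
    by (cases "0 < rate \<eta> j") (simp_all add: mult.commute add_pos_pos)
  finally show ?thesis .
qed

text \<open>The cap 1 allows a power of \<open>lamW + \<tau> $ j\<close> to be split by
  subadditivity. The cap \<open>- a j / 2\<close> is the largest \<open>c\<close> with
  \<open>\<alpha> j + c \<le> q_j / 2 - c\<close>, the separation required by the strict Gamma
  inequality.\<close>

definition cexp :: "'r \<Rightarrow> real" where "cexp j = min 1 (- a j / 2)"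
definition lamW :: real where "lamW = 1 + (\<Sum>c\<in>UNIV. \<bar>(transpose W ** W) $ c $ c\<bar>)"
definition KG :: "'r \<Rightarrow> real" where
  "KG j = Gamma (real (qdim g j) / 2 - cexp j) / Gamma (real (qdim g j) / 2) * 2 powr (- cexp j)"

lemma cexp_bounds:
  assumes "b j = 0"
  shows "0 < cexp j" "cexp j \<le> 1" "cexp j < real (qdim g j) / 2" "\<alpha> j + cexp j \<le> real (qdim g j) / 2 - cexp j"
proof -
  have "a j < 0" "0 < 2 * a j + real (qdim g j)" using hyp_ab A3 assms by force+
  then show "0 < cexp j" "cexp j \<le> 1" "cexp j < real (qdim g j) / 2" "\<alpha> j + cexp j \<le> real (qdim g j) / 2 - cexp j"
    by (auto simp: cexp_def \<alpha>_def min_def field_simps)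
qed

lemma KG_nonneg: "b j = 0 \<Longrightarrow> 0 \<le> KG j"
  using cexp_bounds[of j] qdim_pos[of j] unfolding KG_def
  by (intro mult_nonneg_nonneg divide_nonneg_nonneg less_imp_le[OF Gamma_real_pos]) auto

text \<open>The determinant comparison looks only at the diagonal entries of block \<open>j\<close>,
  each at most \<open>lamW + \<tau> $ j\<close>. Splitting the power leaves a constant and a term
  whose average over the Gamma update is explicit.\<close>

lemma f\<eta>_negative_moment:
  assumes t: "\<And>j. 0 < \<tau> $ j" and b0: "b j = 0"
  shows "(\<integral>\<^sup>+x. ennreal (f\<eta> \<tau> v x) * ennreal (usq g x j powr (- cexp j)) \<partial>lborel)
    \<le> ennreal (KG j * lamW powr cexp j) + ennreal (KG j) * ennreal ((\<tau> $ j) powr cexp j)"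
proof -
  note cb = cexp_bounds[OF b0]
  let ?S = "Inr ` {k. g k = j} :: ('p + 'q) set" and ?c = "cexp j"
  have card: "card ?S = qdim g j" unfolding qdim_def by (rule card_image) simp
  have usq: "usq g x j = (\<Sum>k\<in>?S. (x $ k)\<^sup>2)" for x :: "real^('p + 'q)"
    unfolding usq_def by (subst sum.reindex) auto
  have lw: "0 < lamW" unfolding lamW_def by (intro add_pos_nonneg sum_nonneg) auto
  have diag: "S \<tau> $ k $ k \<le> lamW + \<tau> $ j" if "k \<in> ?S" for k
  proof -
    have "\<bar>(transpose W ** W) $ k $ k\<bar> \<le> (\<Sum>c\<in>UNIV. \<bar>(transpose W ** W) $ c $ c\<bar>)" by (rule member_le_sum) auto
    then show ?thesis using that unfolding Sigma_entry by (auto simp: lamW_def)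
  qed
  have "(\<integral>\<^sup>+x. ennreal (f\<eta> \<tau> v x) * ennreal (usq g x j powr (- ?c)) \<partial>lborel)
     \<le> ennreal (((lamW + \<tau> $ j) / 2) powr ?c * Gamma (real (card ?S) / 2 - ?c) / Gamma (real (card ?S) / 2))"
    unfolding f\<eta>_def usq using cb lw t[of j] diag
    by (intro mvn_prec_pdf_negative_moment[OF Sigma_pos_def[OF t]]) (auto simp: card)
  also have "\<dots> = ennreal (KG j * (lamW + \<tau> $ j) powr ?c)"
    unfolding card KG_def using lw t[of j] by (simp add: powr_divide powr_minus_divide mult_ac)
  also have "\<dots> \<le> ennreal (KG j * (lamW powr ?c + (\<tau> $ j) powr ?c))"
    using KG_nonneg[OF b0] cb lw t[of j] by (intro ennreal_leI mult_left_mono powr_add_le) auto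
  also have "\<dots> = ennreal (KG j * lamW powr ?c) + ennreal (KG j) * ennreal ((\<tau> $ j) powr ?c)"
    using KG_nonneg[OF b0] by (simp add: distrib_left ennreal_mult'[symmetric])
  finally show ?thesis .
qed

definition V :: "real^('p + 'q) \<Rightarrow> real" where
  "V \<eta> = (norm (W *v \<eta>))\<^sup>2 + (\<Sum>j\<in>{j. b j = 0}. usq g \<eta> j powr (- cexp j))"

lemma V_nonneg: "0 \<le> V \<eta>"
  unfolding V_def by (intro add_nonneg_nonneg sum_nonneg) auto

lemma V_measurable [measurable]: "V \<in> borel_measurable borel"
proof -
  have [measurable]: "(\<lambda>\<eta>. (norm (W *v \<eta>))\<^sup>2) \<in> borel_measurable borel"
    by (intro borel_measurable_continuous_onI continuous_intros)
  show ?thesis unfolding V_def by measurable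
qed

definition ratio :: "'r \<Rightarrow> real" where
  "ratio j = Gamma (real (qdim g j) / 2 - cexp j) * Gamma (\<alpha> j + cexp j) / (Gamma (real (qdim g j) / 2) * Gamma (\<alpha> j))"

lemma ratio_lt_1: "b j = 0 \<Longrightarrow> ratio j < 1"
  using Gamma_product_strict[OF \<alpha>_pos[of j] cexp_bounds(1,4)[of j]] Gamma_real_pos[OF \<alpha>_pos[of j]] Gamma_real_pos[of "real (qdim g j) / 2"] qdim_pos[of j]
  unfolding ratio_def by simp

lemma ratio_nonneg: "b j = 0 \<Longrightarrow> 0 \<le> ratio j"
  unfolding ratio_def using cexp_bounds[of j] \<alpha>_pos[of j] qdim_pos[of j]
  by (intro divide_nonneg_nonneg mult_nonneg_nonneg less_imp_le[OF Gamma_real_pos]) auto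

text \<open>At the exceptional points with \<open>rate = 0\<close> the convention \<open>0 powr x = 0\<close> makes the singular
  term of \<open>V\<close> vanish, and the Gamma(1,1) update contributes the constant.\<close>
lemma KG_tau_moment:
  assumes b0: "b j = 0"
  shows "ennreal (KG j) * (\<integral>\<^sup>+\<tau>. ennreal (f\<tau> \<eta> \<tau>) * ennreal ((\<tau> $ j) powr cexp j) \<partial>lborel)
    \<le> ennreal (ratio j * usq g \<eta> j powr (- cexp j)) + ennreal (KG j * Gamma (1 + cexp j))"
proof (cases "0 < rate \<eta> j")
  case True
  then have u: "0 < usq g \<eta> j" using b0 by (simp add: rate_def)
  have "KG j * (Gamma (\<alpha> j + cexp j) / Gamma (\<alpha> j) * rate \<eta> j powr (- cexp j)) = ratio j * usq g \<eta> j powr (- cexp j)"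
  proof -
    have "2 powr (- cexp j) * rate \<eta> j powr (- cexp j) = usq g \<eta> j powr (- cexp j)"
      using u b0 by (simp add: rate_def powr_mult[symmetric])
    moreover have "(p / q * A) * (r / s * B) = p * r / (q * s) * (A * B)" for p q r s A B :: real by simp
    ultimately show ?thesis unfolding KG_def ratio_def by metis
  qed
  then show ?thesis unfolding f\<tau>_powr_moment[OF cexp_bounds(1)[OF b0]]
    using True KG_nonneg[OF b0] by (simp add: ennreal_mult'[symmetric])
next
  case False
  then show ?thesis unfolding f\<tau>_powr_moment[OF cexp_bounds(1)[OF b0]]
    using KG_nonneg[OF b0] by (simp add: ennreal_mult'[symmetric])
qed

text \<open>The terms of \<open>V\<close> do not interact: the quadratic term is bounded through
  \<open>v\<close> alone, and the singular term of block \<open>j\<close> through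
  \<open>\<tau> $ j\<close>, whose law depends on that block only. The drift is diagonal up to
  constants, so the summands of \<open>V\<close> need no relative weights and the worst factor
  serves as \<rho>.\<close>

lemma drift: "\<exists>\<rho> L. 0 \<le> \<rho> \<and> \<rho> < 1 \<and> 0 \<le> L \<and> (\<forall>\<eta>. (\<integral>\<^sup>+x. V x \<partial>gibbs \<eta>) \<le> ennreal (\<rho> * V \<eta> + L))"
proof -
  obtain \<rho>0 where \<rho>0: "0 \<le> \<rho>0" "\<rho>0 < 1" "\<And>\<eta>. (\<Sum>i\<in>UNIV. (pos_part \<eta> i)\<^sup>2) \<le> \<rho>0 * (norm (W *v \<eta>))\<^sup>2"
    using pos_part_contraction by blast
  \<comment> \<open>Half of the gap below 1: then \<open>(1 + \<delta>) * \<rho>0 \<le> \<rho>0 +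
    \<delta> = (1 + \<rho>0) / 2\<close>.\<close>
  define \<delta> where "\<delta> = (1 - \<rho>0) / 2"
  have \<delta>: "0 < \<delta>" using \<rho>0 by (simp add: \<delta>_def)
  let ?B = "{j. b j = 0}"
  define D where "D = (1 + 1 / \<delta>) * (4 * sqrt (2 ^ CARD('p + 'q)))"
  have D: "0 \<le> D" using \<delta> by (simp add: D_def)
  define C where "C = D + (\<Sum>j\<in>?B. KG j * lamW powr cexp j)"
  have C: "0 \<le> C" using D KG_nonneg by (auto simp: C_def intro!: add_nonneg_nonneg sum_nonneg)
  \<comment> \<open>A maximum of finitely many numbers below 1; the inserted element also keeps the
    set nonempty when no block has \<open>b j = 0\<close>.\<close>
  define \<rho> where "\<rho> = Max (insert ((1 + \<rho>0) / 2) (ratio ` ?B))"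
  have \<rho>: "0 \<le> \<rho>" "\<rho> < 1" "(1 + \<rho>0) / 2 \<le> \<rho>" "\<And>j. b j = 0 \<Longrightarrow> ratio j \<le> \<rho>"
  proof -
    show 1: "(1 + \<rho>0) / 2 \<le> \<rho>" unfolding \<rho>_def by (intro Max_ge) auto
    show "0 \<le> \<rho>" using 1 \<rho>0 by simp
    show "\<rho> < 1" unfolding \<rho>_def using \<rho>0 ratio_lt_1 by (subst Max_less_iff) auto
    show "ratio j \<le> \<rho>" if "b j = 0" for j unfolding \<rho>_def using that by (intro Max_ge) auto
  qed
  define L where "L = (1 + \<delta>) * (2 * real CARD('n)) + C + (\<Sum>j\<in>?B. KG j * Gamma (1 + cexp j))"
  have KGG: "0 \<le> KG j * Gamma (1 + cexp j)" if "b j = 0" for j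
    using KG_nonneg[OF that] Gamma_real_pos[of "1 + cexp j"] cexp_bounds[OF that] by simp
  have L: "0 \<le> L" unfolding L_def using C \<delta> KGG by (intro add_nonneg_nonneg sum_nonneg) auto
  have x_step: "(\<integral>\<^sup>+x. ennreal (f\<eta> \<tau> v x) * ennreal (V x) \<partial>lborel)
      \<le> ennreal (1 + \<delta>) * ennreal ((norm v)\<^sup>2) + (ennreal C + (\<Sum>j\<in>?B. ennreal (KG j) * ennreal ((\<tau> $ j) powr cexp j)))"
    if t: "\<And>j. 0 < \<tau> $ j" for \<tau> v
  proof -
    have [measurable]: "(\<lambda>\<eta>. (norm (W *v \<eta>))\<^sup>2) \<in> borel_measurable borel"
      by (intro borel_measurable_continuous_onI continuous_intros)
    have "(\<integral>\<^sup>+x. ennreal (f\<eta> \<tau> v x) * ennreal (V x) \<partial>lborel)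
        = (\<integral>\<^sup>+x. ennreal (f\<eta> \<tau> v x) * ennreal ((norm (W *v x))\<^sup>2) + (\<Sum>j\<in>?B. ennreal (f\<eta> \<tau> v x) * ennreal (usq g x j powr (- cexp j))) \<partial>lborel)"
      by (simp add: V_def sum_nonneg distrib_left sum_distrib_left[symmetric])
    also have "\<dots> = (\<integral>\<^sup>+x. ennreal (f\<eta> \<tau> v x) * ennreal ((norm (W *v x))\<^sup>2) \<partial>lborel)
        + (\<Sum>j\<in>?B. \<integral>\<^sup>+x. ennreal (f\<eta> \<tau> v x) * ennreal (usq g x j powr (- cexp j)) \<partial>lborel)"
      by (subst nn_integral_add, measurable) (subst nn_integral_sum, measurable)
    also have "\<dots> \<le> ennreal ((1 + \<delta>) * (norm v)\<^sup>2 + D) + (\<Sum>j\<in>?B. ennreal (KG j * lamW powr cexp j) + ennreal (KG j) * ennreal ((\<tau> $ j) powr cexp j))"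
      unfolding D_def using t \<delta> by (intro add_mono sum_mono f\<eta>_norm_moment f\<eta>_negative_moment) auto
    also have "\<dots> = ennreal (1 + \<delta>) * ennreal ((norm v)\<^sup>2) + (ennreal C + (\<Sum>j\<in>?B. ennreal (KG j) * ennreal ((\<tau> $ j) powr cexp j)))"
    proof -
      have "(\<Sum>j\<in>?B. ennreal (KG j * lamW powr cexp j)) = ennreal (\<Sum>j\<in>?B. KG j * lamW powr cexp j)"
        using KG_nonneg by (intro sum_ennreal) auto
      moreover have "0 \<le> (\<Sum>j\<in>?B. KG j * lamW powr cexp j)" using KG_nonneg by (intro sum_nonneg) auto
      ultimately show ?thesis using D \<delta> unfolding sum.distrib C_def
        by (simp add: ennreal_mult' add.assoc)
    qed
    finally show ?thesis .
  qed
  have v_step: "(\<integral>\<^sup>+v. ennreal (fv \<eta> v) * (\<integral>\<^sup>+x. ennreal (f\<eta> \<tau> v x) * ennreal (V x) \<partial>lborel) \<partial>lborel)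
      \<le> ennreal ((1 + \<delta>) * (2 * real CARD('n) + \<rho>0 * (norm (W *v \<eta>))\<^sup>2) + C) + (\<Sum>j\<in>?B. ennreal (KG j) * ennreal ((\<tau> $ j) powr cexp j))"
    if t: "\<And>j. 0 < \<tau> $ j" for \<tau> \<eta>
  proof -
    let ?T = "\<Sum>j\<in>?B. ennreal (KG j) * ennreal ((\<tau> $ j) powr cexp j)"
    have "(\<integral>\<^sup>+v. ennreal (fv \<eta> v) * (\<integral>\<^sup>+x. ennreal (f\<eta> \<tau> v x) * ennreal (V x) \<partial>lborel) \<partial>lborel)
      \<le> (\<integral>\<^sup>+v. ennreal (fv \<eta> v) * (ennreal (1 + \<delta>) * ennreal ((norm v)\<^sup>2) + (ennreal C + ?T)) \<partial>lborel)"
      by (intro nn_integral_mono mult_left_mono x_step t) auto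
    also have "\<dots> = (\<integral>\<^sup>+v. ennreal (1 + \<delta>) * (ennreal (fv \<eta> v) * ennreal ((norm v)\<^sup>2)) + ennreal (fv \<eta> v) * (ennreal C + ?T) \<partial>lborel)"
      by (intro nn_integral_cong) (simp only: distrib_left mult_ac)
    also have "\<dots> = ennreal (1 + \<delta>) * (\<integral>\<^sup>+v. ennreal (fv \<eta> v) * ennreal ((norm v)\<^sup>2) \<partial>lborel) + 1 * (ennreal C + ?T)"
      by (subst nn_integral_add, measurable) (subst nn_integral_cmult, measurable, subst nn_integral_multc, measurable, simp only: nn_integral_fv)
    also have "\<dots> \<le> ennreal (1 + \<delta>) * ennreal (2 * real CARD('n) + \<rho>0 * (norm (W *v \<eta>))\<^sup>2) + 1 * (ennreal C + ?T)"
      using \<rho>0(3)[of \<eta>] by (intro add_right_mono mult_left_mono order_trans[OF fv_norm_moment] ennreal_leI) auto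
    also have "\<dots> = ennreal ((1 + \<delta>) * (2 * real CARD('n) + \<rho>0 * (norm (W *v \<eta>))\<^sup>2) + C) + ?T"
      using \<delta> C \<rho>0(1) by (simp add: ennreal_mult'[symmetric] add.assoc[symmetric] ennreal_plus[symmetric] del: ennreal_plus)
    finally show ?thesis .
  qed
  have "(\<integral>\<^sup>+x. V x \<partial>gibbs \<eta>) \<le> ennreal (\<rho> * V \<eta> + L)" for \<eta>
  proof -
    let ?N = "(norm (W *v \<eta>))\<^sup>2" and ?U = "\<lambda>j. usq g \<eta> j powr (- cexp j)"
    let ?E = "(1 + \<delta>) * (2 * real CARD('n) + \<rho>0 * ?N) + C"
    have E: "0 \<le> ?E" using \<delta> C \<rho>0(1) by (intro add_nonneg_nonneg mult_nonneg_nonneg) auto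
    have "(\<integral>\<^sup>+x. V x \<partial>gibbs \<eta>)
       = (\<integral>\<^sup>+\<tau>. ennreal (f\<tau> \<eta> \<tau>) * (\<integral>\<^sup>+v. ennreal (fv \<eta> v) * (\<integral>\<^sup>+x. ennreal (f\<eta> \<tau> v x) * ennreal (V x) \<partial>lborel) \<partial>lborel) \<partial>lborel)"
      by (rule nn_integral_gibbs) measurable
    also have "\<dots> \<le> (\<integral>\<^sup>+\<tau>. ennreal (f\<tau> \<eta> \<tau>) * (ennreal ?E + (\<Sum>j\<in>?B. ennreal (KG j) * ennreal ((\<tau> $ j) powr cexp j))) \<partial>lborel)"
    proof (rule nn_integral_mono)
      fix \<tau> :: "real^'r"
      show "ennreal (f\<tau> \<eta> \<tau>) * (\<integral>\<^sup>+v. ennreal (fv \<eta> v) * (\<integral>\<^sup>+x. ennreal (f\<eta> \<tau> v x) * ennreal (V x) \<partial>lborel) \<partial>lborel)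
        \<le> ennreal (f\<tau> \<eta> \<tau>) * (ennreal ?E + (\<Sum>j\<in>?B. ennreal (KG j) * ennreal ((\<tau> $ j) powr cexp j)))"
        by (cases "\<forall>j. 0 < \<tau> $ j") (auto simp del: ennreal_plus simp: f\<tau>_zero intro!: mult_left_mono v_step)
    qed
    also have "\<dots> = (\<integral>\<^sup>+\<tau>. ennreal (f\<tau> \<eta> \<tau>) * ennreal ?E + (\<Sum>j\<in>?B. ennreal (KG j) * (ennreal (f\<tau> \<eta> \<tau>) * ennreal ((\<tau> $ j) powr cexp j))) \<partial>lborel)"
      by (intro nn_integral_cong) (simp only: distrib_left sum_distrib_left mult_ac)
    also have "\<dots> = ennreal ?E + (\<Sum>j\<in>?B. ennreal (KG j) * (\<integral>\<^sup>+\<tau>. ennreal (f\<tau> \<eta> \<tau>) * ennreal ((\<tau> $ j) powr cexp j) \<partial>lborel))"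
      by (subst nn_integral_add, measurable)
         (simp add: nn_integral_sum nn_integral_cmult nn_integral_multc nn_integral_f\<tau> del: ennreal_plus)
    also have "\<dots> \<le> ennreal ?E + (\<Sum>j\<in>?B. ennreal (ratio j * ?U j) + ennreal (KG j * Gamma (1 + cexp j)))"
      by (intro add_left_mono sum_mono KG_tau_moment) auto
    also have "\<dots> = ennreal ?E + (\<Sum>j\<in>?B. ennreal (ratio j * ?U j + KG j * Gamma (1 + cexp j)))"
      using ratio_nonneg KGG by (intro arg_cong2[where f = "(+)"] sum.cong refl ennreal_plus[symmetric]) auto
    also have "\<dots> = ennreal (?E + (\<Sum>j\<in>?B. ratio j * ?U j + KG j * Gamma (1 + cexp j)))"
      using ratio_nonneg KGG E by (subst sum_ennreal) (auto intro!: ennreal_plus[symmetric] sum_nonneg add_nonneg_nonneg)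
    also have "\<dots> \<le> ennreal (\<rho> * V \<eta> + L)"
    proof (rule ennreal_leI)
      have "(1 + \<delta>) * \<rho>0 \<le> \<rho>"
      proof -
        have "\<delta> * \<rho>0 \<le> \<delta> * 1" using \<delta> \<rho>0 by (intro mult_left_mono) auto
        then have "(1 + \<delta>) * \<rho>0 \<le> \<rho>0 + \<delta>" by (simp add: distrib_right)
        also have "\<dots> = (1 + \<rho>0) / 2" by (simp add: \<delta>_def field_simps)
        finally show ?thesis using \<rho>(3) by linarith
      qed
      then have "(1 + \<delta>) * \<rho>0 * ?N \<le> \<rho> * ?N" by (intro mult_right_mono) auto
      moreover have "(\<Sum>j\<in>?B. ratio j * ?U j) \<le> (\<Sum>j\<in>?B. \<rho> * ?U j)"
        using \<rho>(4) by (intro sum_mono mult_right_mono) auto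
      ultimately show "?E + (\<Sum>j\<in>?B. ratio j * ?U j + KG j * Gamma (1 + cexp j)) \<le> \<rho> * V \<eta> + L"
        unfolding V_def L_def sum.distrib sum_distrib_left[symmetric] by (simp add: algebra_simps)
    qed
    finally show ?thesis .
  qed
  with \<rho> L show ?thesis by blast
qed

end

section \<open>Minorization\<close>

lemma nn_integral_pos_on_interval:
  fixes f :: "real \<Rightarrow> ennreal"
  assumes [measurable]: "f \<in> borel_measurable borel" and lu: "l < u" and pos: "\<And>t. t \<in> {l..u} \<Longrightarrow> 0 < f t"
  shows "0 < (\<integral>\<^sup>+t. f t \<partial>lborel)"
proof (rule ccontr)
  assume "\<not> 0 < (\<integral>\<^sup>+t. f t \<partial>lborel)"
  then have "AE t in lborel. f t = 0" by (subst nn_integral_0_iff_AE[symmetric]) auto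
  then have "AE t in lborel. t \<notin> {l..u}" by (rule eventually_mono) (use pos in force)
  then have "{l..u} \<in> null_sets lborel" by (subst AE_iff_null_sets) auto
  then show False using lu by (simp add: null_sets_def)
qed

lemma ennreal_prod_pos:
  fixes h :: "'z \<Rightarrow> ennreal"
  assumes "\<And>d. 0 < h d"
  shows "0 < (\<Prod>d\<in>A. h d)"
  using assms by (induction A rule: infinite_finite_induct) (auto simp: ennreal_zero_less_mult_iff)

context probit_lmm
begin

text \<open>On a sublevel set the linear predictors and the rates are bounded above, and the
  positive rates are bounded below, so all joint densities of \<open>\<tau>\<close> and
  \<open>v\<close> dominate one product \<open>H1 \<tau> * H2 v\<close>. The next state depends on
  the start only through these variables, so pushing the product through step (2) yields
  \<open>N\<close>.\<close>

lemma minorization: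
  "\<exists>N. sets N = sets borel \<and> 0 < measure N (space borel) \<and>
     (\<forall>\<eta>\<in>space borel. V \<eta> \<le> R \<longrightarrow> (\<forall>A\<in>sets borel. emeasure N A \<le> emeasure (gibbs \<eta>) A))"
proof -
  obtain \<kappa> where \<kappa>: "0 < \<kappa>" "\<And>x. \<kappa> * norm x \<le> norm (W *v x)" using W_bounded_below by blast
  define R' where "R' = max R 1"
  have R': "0 < R'" "R \<le> R'" by (auto simp: R'_def)
  define B where "B = sqrt R'"
  \<comment> \<open>For \<open>b j = 0\<close>, the bound \<open>usq powr (- c) \<le> R'\<close>
    means \<open>usq \<ge> R' powr (- 1 / c)\<close>, and the rate is half of
    \<open>usq\<close>.\<close>
  define r0 where "r0 = (\<lambda>j. if b j = 0 then R' powr (- 1 / cexp j) / 2 else b j)"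
  define r1 where "r1 = (\<lambda>j. b j + (R' / \<kappa>\<^sup>2) / 2)"
  have r0: "0 < r0 j" for j using R' hyp_ab[rule_format, of j] by (auto simp: r0_def)
  \<comment> \<open>The rate enters the Gamma density through an increasing power and a decreasing
    exponential, so the lower bound goes into the first and the upper bound into the second. The
    other argument of \<open>min\<close> is the Gamma(1,1) density used at rate 0; it also caps the
    mass at 1.\<close>
  define h1 where "h1 = (\<lambda>j t. if 0 < t then min (r0 j powr \<alpha> j * t powr (\<alpha> j - 1) * exp (- r1 j * t) / Gamma (\<alpha> j)) (exp (- t)) else 0)"
  \<comment> \<open>\<open>\<bar>t\<bar> + B\<close> is at least the distance from \<open>t\<close>
    to any mean in \<open>[- B, B]\<close>, and truncation only divides the normal density by a
    probability.\<close>
  define h2 where "h2 = (\<lambda>i t. if (if y i = 1 then 0 < t else t \<le> 0) then std_normal_density (\<bar>t\<bar> + B) else 0)"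
  have gp: "0 < Gamma (\<alpha> j)" for j using Gamma_real_pos[OF \<alpha>_pos] .
  have h1_nn: "0 \<le> h1 j t" for j t unfolding h1_def using gp[of j] by (auto simp: less_imp_le)
  have h2_nn: "0 \<le> h2 i t" for i t unfolding h2_def by (auto simp: normal_density_nonneg)
  have h1m [measurable]: "h1 j \<in> borel_measurable borel" for j unfolding h1_def by measurable
  have h2m [measurable]: "h2 i \<in> borel_measurable borel" for i unfolding h2_def std_normal_density_def by measurable
  define H1 where "H1 = (\<lambda>\<tau> :: real^'r. \<Prod>j\<in>UNIV. ennreal (h1 j (\<tau> $ j)))"
  define H2 where "H2 = (\<lambda>v :: real^'n. \<Prod>i\<in>UNIV. ennreal (h2 i (v $ i)))"
  have [measurable]: "H1 \<in> borel_measurable borel" "H2 \<in> borel_measurable borel"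
    unfolding H1_def H2_def by measurable
  define n where "n = (\<lambda>x. \<integral>\<^sup>+\<tau>. \<integral>\<^sup>+v. H1 \<tau> * (H2 v * ennreal (f\<eta> \<tau> v x)) \<partial>lborel \<partial>lborel)"
  have [measurable]: "n \<in> borel_measurable borel" unfolding n_def by measurable
  have eN: "emeasure (density lborel n) A = (\<integral>\<^sup>+\<tau>. H1 \<tau> * (\<integral>\<^sup>+v. H2 v * (\<integral>\<^sup>+x. ennreal (f\<eta> \<tau> v x) * indicator A x \<partial>lborel) \<partial>lborel) \<partial>lborel)"
    if [measurable]: "A \<in> sets borel" for A
  proof -
    have "emeasure (density lborel n) A = (\<integral>\<^sup>+x. \<integral>\<^sup>+\<tau>. \<integral>\<^sup>+v. H1 \<tau> * (H2 v * (ennreal (f\<eta> \<tau> v x) * indicator A x)) \<partial>lborel \<partial>lborel \<partial>lborel)"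
      by (simp add: emeasure_density n_def nn_integral_multc[symmetric] mult.assoc)
    also have "\<dots> = (\<integral>\<^sup>+\<tau>. \<integral>\<^sup>+x. \<integral>\<^sup>+v. H1 \<tau> * (H2 v * (ennreal (f\<eta> \<tau> v x) * indicator A x)) \<partial>lborel \<partial>lborel \<partial>lborel)"
      by (rule lborel_pair.Fubini') measurable
    also have "\<dots> = (\<integral>\<^sup>+\<tau>. \<integral>\<^sup>+v. \<integral>\<^sup>+x. H1 \<tau> * (H2 v * (ennreal (f\<eta> \<tau> v x) * indicator A x)) \<partial>lborel \<partial>lborel \<partial>lborel)"
      by (rule nn_integral_cong, rule lborel_pair.Fubini') measurable
    also have "\<dots> = (\<integral>\<^sup>+\<tau>. H1 \<tau> * (\<integral>\<^sup>+v. H2 v * (\<integral>\<^sup>+x. ennreal (f\<eta> \<tau> v x) * indicator A x \<partial>lborel) \<partial>lborel) \<partial>lborel)"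
      by (simp add: nn_integral_cmult)
    finally show ?thesis .
  qed
  have H1_zero: "H1 \<tau> = 0" if "\<not> (\<forall>j. 0 < \<tau> $ j)" for \<tau>
    using that unfolding H1_def h1_def by auto
  have H1_int: "(\<integral>\<^sup>+\<tau>. H1 \<tau> \<partial>lborel) = (\<Prod>j\<in>UNIV. \<integral>\<^sup>+t. ennreal (h1 j t) \<partial>lborel)"
    unfolding H1_def by (rule nn_integral_lborel_vec_prod) measurable
  have H2_int: "(\<integral>\<^sup>+v. H2 v \<partial>lborel) = (\<Prod>i\<in>UNIV. \<integral>\<^sup>+t. ennreal (h2 i t) \<partial>lborel)"
    unfolding H2_def by (rule nn_integral_lborel_vec_prod) measurable
  have "emeasure (density lborel n) UNIV = (\<integral>\<^sup>+\<tau>. H1 \<tau> * (\<integral>\<^sup>+v. H2 v \<partial>lborel) \<partial>lborel)"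
  proof (subst eN, simp, rule nn_integral_cong)
    fix \<tau> :: "real^'r"
    show "H1 \<tau> * (\<integral>\<^sup>+v. H2 v * (\<integral>\<^sup>+x. ennreal (f\<eta> \<tau> v x) * indicator UNIV x \<partial>lborel) \<partial>lborel) = H1 \<tau> * (\<integral>\<^sup>+v. H2 v \<partial>lborel)"
      by (cases "\<forall>j. 0 < \<tau> $ j") (auto simp: nn_integral_f\<eta> H1_zero)
  qed
  then have mass: "emeasure (density lborel n) UNIV = (\<integral>\<^sup>+\<tau>. H1 \<tau> \<partial>lborel) * (\<integral>\<^sup>+v. H2 v \<partial>lborel)"
    by (simp add: nn_integral_multc)
  have pos1: "0 < (\<integral>\<^sup>+t. ennreal (h1 j t) \<partial>lborel)" for j
    by (rule nn_integral_pos_on_interval[where l = 1 and u = 2]) (use r0[of j] gp[of j] in \<open>auto simp: h1_def\<close>)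
  have pos2: "0 < (\<integral>\<^sup>+t. ennreal (h2 i t) \<partial>lborel)" for i
    by (rule nn_integral_pos_on_interval[where l = "if y i = 1 then 1 else -1" and u = "if y i = 1 then 2 else 0"])
       (auto simp: h2_def normal_density_pos)
  have le1: "(\<integral>\<^sup>+t. ennreal (h1 j t) \<partial>lborel) \<le> 1" for j
  proof -
    have "(\<integral>\<^sup>+t. ennreal (h1 j t) \<partial>lborel) \<le> (\<integral>\<^sup>+t. ennreal (gamma_pdf 1 1 t) \<partial>lborel)"
      by (intro nn_integral_mono ennreal_leI) (auto simp: h1_def gamma_pdf_def)
    then show ?thesis by (simp add: nn_integral_gamma_pdf)
  qed
  have B0: "0 \<le> B" using R' by (simp add: B_def)
  have phi_mono: "std_normal_density s \<le> std_normal_density t" if "\<bar>t\<bar> \<le> s" for s t :: real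
  proof -
    have "t\<^sup>2 \<le> s\<^sup>2" using that by (metis abs_le_square_iff abs_ge_self order_trans)
    then show ?thesis by (auto simp: std_normal_density_def intro!: mult_left_mono divide_right_mono)
  qed
  have le2: "(\<integral>\<^sup>+t. ennreal (h2 i t) \<partial>lborel) \<le> 1" for i
  proof -
    have "(\<integral>\<^sup>+t. ennreal (h2 i t) \<partial>lborel) \<le> (\<integral>\<^sup>+t. ennreal (std_normal_density t) \<partial>lborel)"
      using B0 by (intro nn_integral_mono ennreal_leI) (auto simp: h2_def normal_density_nonneg intro!: phi_mono)
    then show ?thesis by (simp add: nn_integral_std_normal)
  qed
  have "0 < emeasure (density lborel n) UNIV"
    unfolding mass H1_int H2_int ennreal_zero_less_mult_iff
    by (intro conjI ennreal_prod_pos pos1 pos2)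
  \<comment> \<open>Finiteness is part of positivity here, since \<open>measure\<close> returns 0 on
    infinite mass.\<close>
  moreover have "emeasure (density lborel n) UNIV < \<infinity>"
  proof -
    have "(\<Prod>j\<in>UNIV. \<integral>\<^sup>+t. ennreal (h1 j t) \<partial>lborel) < \<infinity>"
      by (intro ennreal_prod_less_top le_less_trans[OF le1]) auto
    moreover have "(\<Prod>i\<in>UNIV. \<integral>\<^sup>+t. ennreal (h2 i t) \<partial>lborel) < \<infinity>"
      by (intro ennreal_prod_less_top le_less_trans[OF le2]) auto
    ultimately show ?thesis unfolding mass H1_int H2_int by (simp add: ennreal_mult_less_top)
  qed
  ultimately have m: "0 < measure (density lborel n) (space borel)"
    by (simp add: measure_def enn2real_positive_iff)
  have main: "emeasure (density lborel n) A \<le> emeasure (gibbs \<eta>) A" if V: "V \<eta> \<le> R" and A [measurable]: "A \<in> sets borel" for \<eta> A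
  proof -
    have sing_nn: "0 \<le> (\<Sum>j\<in>{j. b j = 0}. usq g \<eta> j powr (- cexp j))" by (intro sum_nonneg) auto
    have N: "(norm (W *v \<eta>))\<^sup>2 \<le> R'" using V R' sing_nn unfolding V_def by linarith
    have mu: "\<bar>(W $ i) \<bullet> \<eta>\<bar> \<le> B" for i
    proof -
      have "\<bar>(W $ i) \<bullet> \<eta>\<bar> = \<bar>(W *v \<eta>) $ i\<bar>" by (simp add: matrix_vector_mul_component)
      also have "\<dots> \<le> norm (W *v \<eta>)" by (rule component_le_norm_cart)
      also have "\<dots> \<le> B" unfolding B_def using N by (rule real_le_rsqrt)
      finally show ?thesis .
    qed
    have "(\<kappa> * norm \<eta>)\<^sup>2 \<le> (norm (W *v \<eta>))\<^sup>2" using \<kappa> by (intro power_mono) auto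
    with N have "\<kappa>\<^sup>2 * (norm \<eta>)\<^sup>2 \<le> R'" by (simp add: power_mult_distrib)
    then have nrm: "(norm \<eta>)\<^sup>2 \<le> R' / \<kappa>\<^sup>2" using \<kappa> by (simp add: field_simps)
    have usq_le: "usq g \<eta> j \<le> R' / \<kappa>\<^sup>2" for j
    proof -
      have "usq g \<eta> j = (\<Sum>c\<in>Inr ` {k. g k = j}. (\<eta> $ c)\<^sup>2)" unfolding usq_def by (subst sum.reindex) auto
      also have "\<dots> \<le> (\<Sum>c\<in>UNIV. (\<eta> $ c)\<^sup>2)" by (intro sum_mono2) auto
      also have "\<dots> = (norm \<eta>)\<^sup>2" unfolding power2_norm_eq_inner inner_vec_def by (simp add: power2_eq_square)
      finally show ?thesis using nrm by simp
    qed
    have rate_le: "rate \<eta> j \<le> r1 j" for j using usq_le[of j] by (simp add: rate_def r1_def)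
    have rate_ge: "r0 j \<le> rate \<eta> j" if r: "0 < rate \<eta> j" for j
    proof (cases "b j = 0")
      case True
      then have u: "0 < usq g \<eta> j" using r by (simp add: rate_def)
      note c = cexp_bounds[OF True]
      have "usq g \<eta> j powr (- cexp j) \<le> (\<Sum>j\<in>{j. b j = 0}. usq g \<eta> j powr (- cexp j))"
        using True by (intro member_le_sum) auto
      then have "usq g \<eta> j powr (- cexp j) \<le> R'" using V R' unfolding V_def by (smt (verit) zero_le_power2)
      then have "R' powr (- 1 / cexp j) \<le> (usq g \<eta> j powr (- cexp j)) powr (- 1 / cexp j)"
        using u c by (intro powr_mono2') auto
      also have "\<dots> = usq g \<eta> j" using u c by (simp add: powr_powr)
      finally show ?thesis using True by (simp add: r0_def rate_def)
    next
      case False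
      then show ?thesis using usq_nonneg[of \<eta> j] by (simp add: r0_def rate_def)
    qed
    have "H1 \<tau> \<le> ennreal (f\<tau> \<eta> \<tau>)" for \<tau>
    proof -
      have "h1 j t \<le> (if 0 < rate \<eta> j then gamma_pdf (\<alpha> j) (rate \<eta> j) t else gamma_pdf 1 1 t)" for j t
      proof (cases "0 < t \<and> 0 < rate \<eta> j")
        case True
        have "r0 j powr \<alpha> j \<le> rate \<eta> j powr \<alpha> j"
          using True r0[of j] rate_ge[of j] \<alpha>_pos[of j] by (intro powr_mono2) (auto simp: less_imp_le)
        moreover have "exp (- r1 j * t) \<le> exp (- rate \<eta> j * t)" using True rate_le[of j] by simp
        ultimately have "r0 j powr \<alpha> j * t powr (\<alpha> j - 1) * exp (- r1 j * t) \<le> rate \<eta> j powr \<alpha> j * t powr (\<alpha> j - 1) * exp (- rate \<eta> j * t)"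
          by (intro mult_mono order_refl) auto
        then show ?thesis using True gp[of j] by (auto simp: h1_def gamma_pdf_def min_le_iff_disj divide_right_mono)
      next
        case False
        then show ?thesis by (auto simp: h1_def gamma_pdf_def)
      qed
      then have "(\<Prod>j\<in>UNIV. h1 j (\<tau> $ j)) \<le> f\<tau> \<eta> \<tau>"
        unfolding f\<tau>_def using h1_nn by (intro prod_mono) auto
      then show ?thesis unfolding H1_def using h1_nn by (simp add: prod_ennreal ennreal_leI)
    qed
    moreover have "H2 v \<le> ennreal (fv \<eta> v)" for v
    proof -
      have "h2 i t \<le> tn_pdf ((W $ i) \<bullet> \<eta>) (y i) t" for i t
      proof -
        have "std_normal_density (\<bar>t\<bar> + B) \<le> std_normal_density (t - (W $ i) \<bullet> \<eta>)"
          using mu[of i] by (intro phi_mono) linarith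
        moreover have "x \<le> x / p" if "0 < p" "p \<le> 1" "0 \<le> x" for x p :: real
          using that by (simp add: pos_le_divide_eq mult_left_le)
        ultimately have "std_normal_density (\<bar>t\<bar> + B) \<le> std_normal_density (t - (W $ i) \<bullet> \<eta>) / p" if "0 < p" "p \<le> 1" for p
          using that by (meson normal_density_nonneg order_trans)
        then show ?thesis unfolding h2_def tn_pdf_def
          using Phi_pos[of "(W $ i) \<bullet> \<eta>"] Phi_lt_1[of "(W $ i) \<bullet> \<eta>"] by auto
      qed
      then have "(\<Prod>i\<in>UNIV. h2 i (v $ i)) \<le> fv \<eta> v"
        unfolding fv_def using h2_nn by (intro prod_mono) auto
      then show ?thesis unfolding H2_def using h2_nn by (simp add: prod_ennreal ennreal_leI)
    qed
    ultimately have "emeasure (density lborel n) A \<le> (\<integral>\<^sup>+\<tau>. ennreal (f\<tau> \<eta> \<tau>) * (\<integral>\<^sup>+v. ennreal (fv \<eta> v) * (\<integral>\<^sup>+x. ennreal (f\<eta> \<tau> v x) * indicator A x \<partial>lborel) \<partial>lborel) \<partial>lborel)"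
      unfolding eN[OF A] by (intro nn_integral_mono mult_mono) auto
    also have "\<dots> = emeasure (gibbs \<eta>) A"
      using nn_integral_gibbs[of "indicator A" \<eta>] A by simp
    finally show ?thesis .
  qed
  show ?thesis using m main by (intro exI[of _ "density lborel n"]) auto
qed

lemma gibbs_geom_ergodic: "geom_ergodic (gibbs) borel (Post)"
proof -
  obtain \<rho> L where d: "0 \<le> \<rho>" "\<rho> < 1" "0 \<le> L" "\<And>\<eta>. (\<integral>\<^sup>+x. V x \<partial>gibbs \<eta>) \<le> ennreal (\<rho> * V \<eta> + L)"
    using drift by blast
  show ?thesis
    by (rule harris_geom_ergodic[OF gibbs_measurable prob_space_gibbs V_measurable V_nonneg d(4) d(1-3) minorization prob_space_posterior sets_posterior posterior_invariant])
qed

end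

text \<open>Because \<open>posterior\<close> divides by \<open>post_const\<close>, the bounds on
  that constant are what give the remaining conjuncts their meaning, and invariance certifies that
  the limit in the last one is a stationary law of the chain.\<close>

theorem theorem2:
  fixes X :: "real^'p::finite^'n::finite" and Z :: "real^'q::finite^'n" and g :: "'q \<Rightarrow> 'r::finite"
    and y :: "'n \<Rightarrow> real" and a b :: "'r \<Rightarrow> real"
  assumes y01: "\<forall>i. y i = 0 \<or> y i = 1"
    and blocks: "surj g"
    and hyp_ab: "\<forall>j. (a j < 0 \<and> b j = 0) \<or> 0 < b j"
    and A1: "rank (Wmat X Z) = CARD('p + 'q)"
    and A2: "\<exists>e :: real^'n. (\<forall>i. 0 < e $ i) \<and> e v* Wstar X Z y = 0"
    and A3: "\<forall>j. 0 < 2 * a j + real (qdim g j)"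
  shows "0 < post_const X Z g y a b \<and> post_const X Z g y a b < \<infinity>
    \<and> prob_space (posterior X Z g y a b)
    \<and> (posterior X Z g y a b \<bind> gibbs_kernel X Z g y a b) = posterior X Z g y a b
    \<and> geom_ergodic (gibbs_kernel X Z g y a b) borel (posterior X Z g y a b)"
proof -
  interpret probit_lmm X Z g y a b
    using assms by unfold_locales
  show ?thesis
    using post_const_pos post_const_finite prob_space_posterior posterior_invariant gibbs_geom_ergodic by blast
qed

end
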